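(* Let $\mathcal D=\{(\mu,\nu)\in\mathcal P^2:\mu\preceq_C\nu\}$. The map $\mathrm{Curt}:(\mu,\nu)\in\mathcal D\mapsto\pi_{\mathrm{lc}}$, which sends a pair to its left-curtain coupling, is continuous from $\mathcal D$ to $\mathcal P(\mathbb R^2)$, where $\mathcal P$ and $\mathcal P(\mathbb R^2)$ carry the usual weak topology (convergence against continuous bounded functions) and $\mathcal D$ the topology induced from the product.
   Context: $\mathcal M$ is the set of finite positive Borel measures on $\mathbb R$ with finite first moment, $\mathcal P\subset\mathcal M$ the probability measures; $\mathcal P(\mathbb R^2)$ is the set of Borel probability measures on $\mathbb R^2$ with finite first moment. Orders on $\mathcal M$: $\mu\preceq_C\nu$ means $\int\varphi\,d\mu\le\int\varphi\,d\nu$ for every convex $\varphi$ growing at most linearly at $\pm\infty$; $\mu\preceq_{C,+}\nu$ is the same with $\varphi$ convex and non-negative; $\preceq_+$ is the setwise order of measures. If $\mu\preceq_{C,+}\nu$, the shadow $S^\nu(\mu)$ is the unique $\eta$ such that $\mu\preceq_C\eta\preceq_+\nu$ and $\eta\preceq_C\eta'$ for all $\eta'$ with $\mu\preceq_C\eta'\preceq_+\nu$. For $\mu,\nu\in\mathcal P$, $\Pi_M(\mu,\nu)$ is the set of $\pi=\mathrm{Law}(X,Y)$ with marginals $\mu,\nu$ and $\mathbb E(Y|X)=X$. If $\mu\preceq_C\nu$, the left-curtain coupling $\pi_{\mathrm{lc}}=\mathrm{Curt}(\mu,\nu)$ is the unique $\pi\in\Pi_M(\mu,\nu)$ such that for every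 $x\in\mathbb R$ the restriction of $\pi$ to $]-\infty,x]\times\mathbb R$ has first marginal $\mu|_{]-\infty,x]}$ and second marginal $S^\nu(\mu|_{]-\infty,x]})$ (existence and uniqueness are known). Known characterisation: $\pi\in\Pi_M(\mu,\nu)$ is the left-curtain coupling if and only if it is left-monotone, i.e. there is a Borel set $\Gamma\subset\mathbb R^2$ with $\pi(\Gamma)=1$ such that whenever $(x,y^-),(x,y^+),(x',y')\in\Gamma$ with $x<x'$ and $y^-<y^+$, one has $y'\notin]y^-,y^+[$. *)

theory Defs
  imports "HOL-Probability.Probability" "HOL-Library.Landau_Symbols"
begin

definition finite_measures :: "real measure set" where
  "finite_measures =
     {\<mu>. finite_measure \<mu> \<and> sets \<mu> = sets borel \<and> integrable \<mu> (\<lambda>x. \<bar>x\<bar>)}"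

text \<open>Used at \<^typ>\<open>real\<close> and at \<^typ>\<open>real \<times> real\<close>.\<close>

definition prob_measures :: "'a::real_normed_vector measure set" where
  "prob_measures = {\<mu>. prob_space \<mu> \<and> sets \<mu> = sets borel \<and> integrable \<mu> norm}"

text \<open>
  The weak topology is the initial topology for the maps
  \<open>\<mu> \<mapsto> \<integral> f d\<mu>\<close>, with \<open>f\<close> continuous and bounded: the pullback of the product topology
  (which is \<open>euclidean\<close> on a function type) under \<open>\<mu> \<mapsto> (f \<mapsto> \<integral> f d\<mu>)\<close>.
\<close>

definition weak_topology :: "'a::topological_space measure set \<Rightarrow> 'a measure topology" where
  "weak_topology P =
     pullback_topology P
       (\<lambda>\<mu> (f :: 'a \<Rightarrow>\<^sub>C real). \<integral>x. apply_bcontfun f x \<partial>\<mu>) euclidean"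

lemma topspace_weak_topology [simp]: "topspace (weak_topology P) = P"
  by (simp add: weak_topology_def topspace_pullback_topology)

definition convex_order :: "real measure \<Rightarrow> real measure \<Rightarrow> bool"  (infix \<open>\<preceq>\<^sub>C\<close> 50) where
  "\<mu> \<preceq>\<^sub>C \<nu> \<longleftrightarrow>
     (\<forall>\<phi> :: real \<Rightarrow> real. convex_on UNIV \<phi> \<and> \<phi> \<in> O[at_infinity](\<lambda>x. x) \<longrightarrow>
        (\<integral>x. \<phi> x \<partial>\<mu>) \<le> (\<integral>x. \<phi> x \<partial>\<nu>))"

text \<open>
  On measures with a common \<open>\<sigma>\<close>-algebra, \<open>\<le>\<close> is the setwise order.
  The shadow of \<open>\<mu>\<close> in \<open>\<nu>\<close> is meaningful when \<open>\<integral> \<phi> d\<mu> \<le> \<integral> \<phi> d\<nu>\<close> for all non-negative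
  convex \<open>\<phi>\<close> of at most linear growth; this holds in particular when \<open>\<mu>\<close> is a restriction of a
  measure that is below \<open>\<nu>\<close> in the convex order.
\<close>

definition is_shadow :: "real measure \<Rightarrow> real measure \<Rightarrow> real measure \<Rightarrow> bool" where
  "is_shadow \<nu> \<mu> \<eta> \<longleftrightarrow>
     \<eta> \<in> finite_measures \<and> \<mu> \<preceq>\<^sub>C \<eta> \<and> \<eta> \<le> \<nu> \<and>
     (\<forall>\<eta>'\<in>finite_measures. \<mu> \<preceq>\<^sub>C \<eta>' \<and> \<eta>' \<le> \<nu> \<longrightarrow> \<eta> \<preceq>\<^sub>C \<eta>')"

definition shadow :: "real measure \<Rightarrow> real measure \<Rightarrow> real measure" where
  "shadow \<nu> \<mu> = (THE \<eta>. is_shadow \<nu> \<mu> \<eta>)"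

text \<open>Restriction to \<open>A\<close> as a measure on the whole space, unlike \<^const>\<open>restrict_space\<close>.\<close>

definition restr :: "'a measure \<Rightarrow> 'a set \<Rightarrow> 'a measure" where
  "restr \<mu> A = density \<mu> (indicator A)"

abbreviation marginal1 :: "(real \<times> real) measure \<Rightarrow> real measure" where
  "marginal1 \<pi> \<equiv> distr \<pi> borel fst"

abbreviation marginal2 :: "(real \<times> real) measure \<Rightarrow> real measure" where
  "marginal2 \<pi> \<equiv> distr \<pi> borel snd"

text \<open>
  The coordinates \<^const>\<open>fst\<close>, \<^const>\<open>snd\<close> play the role of \<open>X\<close>, \<open>Y\<close>; the algebra pulled back
  along \<^const>\<open>fst\<close> is \<open>\<sigma>(X)\<close>.
\<close>

definition martingale_couplings ::
    "real measure \<Rightarrow> real measure \<Rightarrow> (real \<times> real) measure set" where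
  "martingale_couplings \<mu> \<nu> =
     {\<pi> \<in> prob_measures. marginal1 \<pi> = \<mu> \<and> marginal2 \<pi> = \<nu> \<and>
        (AE z in \<pi>. real_cond_exp \<pi> (vimage_algebra UNIV fst borel) snd z = fst z)}"

definition is_left_curtain ::
    "real measure \<Rightarrow> real measure \<Rightarrow> (real \<times> real) measure \<Rightarrow> bool" where
  "is_left_curtain \<mu> \<nu> \<pi> \<longleftrightarrow>
     \<pi> \<in> martingale_couplings \<mu> \<nu> \<and>
     (\<forall>x. marginal1 (restr \<pi> ({..x} \<times> UNIV)) = restr \<mu> {..x} \<and>
          marginal2 (restr \<pi> ({..x} \<times> UNIV)) = shadow \<nu> (restr \<mu> {..x}))"

definition Curt :: "real measure \<times> real measure \<Rightarrow> (real \<times> real) measure" where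
  "Curt = (\<lambda>(\<mu>, \<nu>). THE \<pi>. is_left_curtain \<mu> \<nu> \<pi>)"

definition curtain_domain :: "(real measure \<times> real measure) set" where
  "curtain_domain = {(\<mu>, \<nu>). \<mu> \<in> prob_measures \<and> \<nu> \<in> prob_measures \<and> \<mu> \<preceq>\<^sub>C \<nu>}"

end

theory Submission
  imports Defs "HOL-Real_Asymp.Real_Asymp"
begin

text \<open>
  With \<open>P\<^sub>\<mu>(k) = \<integral> max 0 (k - x) d\<mu>\<close>, the potential of the shadow of \<open>\<mu>\<close> in \<open>\<nu>\<close> is
  \<open>P\<^sub>\<nu> - h\<close>, where \<open>h\<close> is the convex hull of \<open>P\<^sub>\<nu> - P\<^sub>\<mu>\<close>; the point is that \<open>g - hull (g - f)\<close>
  is convex whenever \<open>f\<close> and \<open>g\<close> are. Since \<open>hull (G - f) = hull (hull G - f)\<close> for convex \<open>f\<close>, the same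
  fact makes the shadows of the restrictions of \<open>\<mu>\<close> to \<open>{..x}\<close> increase with \<open>x\<close>, and
  these shadows are the second marginals of a unique coupling, the left-curtain coupling.

  Under weak convergence the potentials converge up to additive constants, because mass may escape to
  infinity together with first moments. The hulls nevertheless converge up to the same kind of constant:
  an affine function with slope strictly between the two asymptotic slopes of \<open>P\<^sub>\<nu> - P\<^sub>\<mu>\<close> stays
  below the approximating functions near infinity, and an upper limit of convex minorants is a convex
  minorant. Taking derivatives, the distribution functions of the shadows converge, that is, the
  couplings converge on quadrants.
\<close>

section \<open>Subgradients and convex hulls of functions of a real variable\<close>

text \<open>Measures are recovered from potentials through supporting slopes. The cdf is a
  subgradient of the potential, and a convex function has only one right-continuous subgradient, so
  splitting the potential of \<nu> into two non-negative convex functions amounts to splitting \<nu>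
  into two measures. This is why convexity of \<open>g - hull (g - f)\<close> yields both the
  existence of shadows and, with a shadow in the place of \<nu>, their monotonicity. It also makes
  unknown additive constants harmless: they cancel in difference quotients, and only those are
  compared with cdfs. The weak topology is given as an initial topology, so limits are taken along
  arbitrary filters; upper limits are therefore infima of eventual upper bounds. The hull argument
  needs room between the asymptotic slopes \<open>0\<close> and \<open>1 - cdf \<mu>0 x\<close>. If
  they coincide, the shadow differs from \<nu> by a measure of vanishing mass, and this case is
  settled by counting mass.\<close>

definition subgradient :: "(real \<Rightarrow> real) \<Rightarrow> (real \<Rightarrow> real) \<Rightarrow> bool" where
  "subgradient f F \<longleftrightarrow> (\<forall>a b. f a + F a * (b - a) \<le> f b)"

lemma subgradientD: "subgradient f F \<Longrightarrow> f a + F a * (b - a) \<le> f b"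
  by (simp add: subgradient_def)

lemma subgradient_upper: "subgradient f F \<Longrightarrow> f b - f a \<le> F b * (b - a)"
  using subgradientD[of f F b a] by (simp add: algebra_simps)

lemma subgradient_mono:
  assumes "subgradient f F"
  shows "mono F"
proof (rule monoI)
  fix a b :: real
  assume ab: "a \<le> b"
  have "F a * (b - a) \<le> F b * (b - a)"
    using subgradientD[OF assms, of a b] subgradient_upper[OF assms, of b a] by linarith
  then show "F a \<le> F b"
    using ab by (cases "a = b") (auto simp: mult_le_cancel_right)
qed

lemma subgradient_add:
  assumes "subgradient f F" "subgradient g G"
  shows "subgradient (\<lambda>x. f x + g x) (\<lambda>x. F x + G x)"
  unfolding subgradient_def
  using add_mono[OF subgradientD[OF assms(1)] subgradientD[OF assms(2)]]
  by (simp add: algebra_simps)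

lemma subgradient_imp_convex:
  assumes "subgradient f F"
  shows "convex_on UNIV f"
proof (rule convex_onI)
  fix t x y :: real
  assume t: "0 < t" "t < 1"
  define z where "z = (1 - t) *\<^sub>R x + t *\<^sub>R y"
  have "(1 - t) * (f z + F z * (x - z)) + t * (f z + F z * (y - z)) \<le> (1 - t) * f x + t * f y"
    using t by (intro add_mono mult_left_mono subgradientD[OF assms]) auto
  moreover have "(1 - t) * (f z + F z * (x - z)) + t * (f z + F z * (y - z)) = f z"
    by (simp add: z_def algebra_simps)
  ultimately show "f z \<le> (1 - t) * f x + t * f y" by simp
qed simp

text \<open>The selection is the right derivative, the infimum of the slopes to the right. Its right
  continuity is what allows it to be compared with a cdf.\<close>

lemma convex_imp_subgradient:
  assumes "convex_on UNIV f"
  obtains F where "subgradient f F" "\<And>a. (F \<longlongrightarrow> F a) (at_right a)"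
proof -
  define slope where "slope = (\<lambda>a t. (f a - f t) / (a - t))"
  define F where "F = (\<lambda>a. Inf (slope a ` {a<..}))"
  have sub: "subgradient f F"
    unfolding subgradient_def F_def slope_def
    using convex_le_Inf_differential[OF assms] by auto
  have le: "F a \<le> slope a b" if "a < b" for a b
    using subgradientD[OF sub, of a b] that by (simp add: slope_def field_simps)
  have cont: "continuous_on UNIV f"
    using assms by (intro convex_on_continuous) auto
  have "(F \<longlongrightarrow> F a) (at_right a)" for a
  proof (rule order_tendstoI)
    fix u assume "u < F a"
    then show "eventually (\<lambda>x. u < F x) (at_right a)"
      unfolding eventually_at_right_field
      using monoD[OF subgradient_mono[OF sub], of a]
      by (metis less_eq_real_def gt_ex order_less_le_trans)
  next
    fix u assume "F a < u"
    \<comment> \<open>A slope close to the infimum depends continuously on its left end, and it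
      bounds \<open>F x\<close> for every \<open>x\<close> just to the right of
      \<open>a\<close>.\<close>
    then obtain b where b: "a < b" "slope a b < u"
      unfolding F_def by (subst (asm) cInf_less_iff)
        (auto intro!: bdd_belowI2[of _ "F a"] le simp: gt_ex)
    have c: "(f \<longlongrightarrow> f a) (at_right a)"
      using cont by (metis UNIV_I continuous_on_def filterlim_within_subset subset_UNIV)
    have "((\<lambda>x. slope x b) \<longlongrightarrow> slope a b) (at_right a)"
      unfolding slope_def using b(1) by (intro tendsto_intros c) auto
    then have "eventually (\<lambda>x. slope x b < u) (at_right a)"
      using b(2) by (rule order_tendstoD)
    moreover have "eventually (\<lambda>x. x < b) (at_right a)"
      using b(1) by (rule eventually_at_right_real[THEN eventually_mono]) auto
    ultimately show "eventually (\<lambda>x. F x < u) (at_right a)"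
      by eventually_elim (rule order_le_less_trans[OF le])
  qed
  with sub show ?thesis by (rule that)
qed

text \<open>Two selections interlace: \<open>F a \<le> G b\<close> whenever \<open>a < b\<close>, as
  both are compared with the same difference quotient. Right continuity lets \<open>b\<close>
  descend to \<open>a\<close>.\<close>

lemma subgradient_unique:
  assumes "subgradient f F" "subgradient f G"
    and rF: "\<And>a. (F \<longlongrightarrow> F a) (at_right a)" and rG: "\<And>a. (G \<longlongrightarrow> G a) (at_right a)"
  shows "F = G"
proof -
  have *: "F a \<le> G a" if FG: "subgradient f F" "subgradient f G" "(G \<longlongrightarrow> G a) (at_right a)" for a F G
  proof (rule tendsto_lowerbound[OF FG(3)])
    have "F a \<le> G b" if "a < b" for b
    proof -
      have "F a * (b - a) \<le> G b * (b - a)"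
        using subgradientD[OF FG(1), of a b] subgradient_upper[OF FG(2), of b a] by linarith
      with that show ?thesis by simp
    qed
    then show "eventually (\<lambda>b. F a \<le> G b) (at_right a)"
      by (auto simp: eventually_at_filter)
  qed simp
  show ?thesis
    using *[OF assms(1,2) rG] *[OF assms(2,1) rF] by (intro ext antisym) auto
qed

text \<open>Without derivatives, increments are compared on \<open>Suc n\<close> equal pieces: on
  each of them the two functions differ by at most the rise of \<open>F\<close> times the length,
  and the rises telescope. The total error is of order \<open>1 / n\<close>.\<close>

lemma subgradient_diff_eq:
  assumes f: "subgradient f F" and g: "subgradient g F"
  shows "f b - g b = f a - g a"
proof -
  have less: "f b - g b = f a - g a" if ab: "a < b" for a b
  proof -
    define D where "D = (\<lambda>t. f t - g t)"
    have bound: "\<bar>D b - D a\<bar> \<le> (F b - F a) * (b - a) / real (Suc n)" for n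
    proof -
      define t where "t = (\<lambda>i. a + real i * ((b - a) / real (Suc n)))"
      have t0: "t 0 = a" and tn: "t (Suc n) = b"
        by (simp_all add: t_def del: of_nat_Suc)
      have step: "t (Suc i) - t i = (b - a) / real (Suc n)" for i
        unfolding t_def of_nat_Suc[of i] distrib_right by simp
      have st: "\<bar>D (t (Suc i)) - D (t i)\<bar> \<le> (F (t (Suc i)) - F (t i)) * ((b - a) / real (Suc n))" for i
        using subgradientD[OF f, of "t i" "t (Suc i)"] subgradientD[OF g, of "t i" "t (Suc i)"]
          subgradient_upper[OF f, of "t (Suc i)" "t i"] subgradient_upper[OF g, of "t (Suc i)" "t i"]
        unfolding step D_def left_diff_distrib by linarith
      have "\<bar>D b - D a\<bar> = \<bar>\<Sum>i<Suc n. D (t (Suc i)) - D (t i)\<bar>"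
        by (subst sum_lessThan_telescope) (simp add: t0 tn)
      also have "\<dots> \<le> (\<Sum>i<Suc n. \<bar>D (t (Suc i)) - D (t i)\<bar>)"
        by (rule sum_abs)
      also have "\<dots> \<le> (\<Sum>i<Suc n. (F (t (Suc i)) - F (t i)) * ((b - a) / real (Suc n)))"
        by (intro sum_mono st)
      also have "\<dots> = (F b - F a) * (b - a) / real (Suc n)"
        by (subst sum_distrib_right[symmetric], subst sum_lessThan_telescope) (simp add: t0 tn)
      finally show ?thesis .
    qed
    have "(\<lambda>n. (F b - F a) * (b - a) / real (Suc n)) \<longlonglongrightarrow> 0"
      by real_asymp
    then have "\<bar>D b - D a\<bar> \<le> 0"
      by (rule tendsto_lowerbound) (use bound in auto)
    then show ?thesis by (simp add: D_def)
  qed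
  show ?thesis
    using less[of a b] less[of b a] by (cases a b rule: linorder_cases) auto
qed

text \<open>The constants \<open>c i\<close> may diverge: they cancel in difference quotients, and
  the quotient over an interval lies between the subgradients at its ends. At a continuity point of
  \<open>G\<close> the interval can be shrunk.\<close>

lemma subgradient_tendsto:
  fixes f :: "'i \<Rightarrow> real \<Rightarrow> real"
  assumes sub: "\<And>i. subgradient (f i) (F i)" "subgradient g G"
    and lim: "\<And>k. ((\<lambda>i. f i k - c i) \<longlongrightarrow> g k) L"
  shows subgradient_eventually_less: "\<And>e. e > 0 \<Longrightarrow> a < b \<Longrightarrow> \<forall>\<^sub>F i in L. F i a < G b + e"
    and subgradient_eventually_greater: "\<And>e. e > 0 \<Longrightarrow> a < b \<Longrightarrow> \<forall>\<^sub>F i in L. G a - e < F i b"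
    and subgradient_tendsto_isCont: "isCont G k \<Longrightarrow> ((\<lambda>i. F i k) \<longlongrightarrow> G k) L"
proof -
  have slope: "((\<lambda>i. (f i b - f i a) / (b - a)) \<longlongrightarrow> (g b - g a) / (b - a)) L" if "a < b" for a b
  proof -
    have "((\<lambda>i. ((f i b - c i) - (f i a - c i)) / (b - a)) \<longlongrightarrow> (g b - g a) / (b - a)) L"
      using that by (intro tendsto_intros lim) auto
    then show ?thesis by simp
  qed
  have below: "(f i b - f i a) / (b - a) \<ge> F i a" "(f i b - f i a) / (b - a) \<le> F i b"
    "(g b - g a) / (b - a) \<ge> G a" "(g b - g a) / (b - a) \<le> G b" if "a < b" for i a b
    using that subgradientD[OF sub(1), of i a b] subgradientD[OF sub(2), of a b]
      subgradient_upper[OF sub(1), of i b a] subgradient_upper[OF sub(2), of b a]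
    by (auto simp: field_simps)
  show less: "\<forall>\<^sub>F i in L. F i a < G b + e" if "e > 0" "a < b" for a b e
  proof -
    have "(g b - g a) / (b - a) < G b + e" using below(4)[OF that(2)] that(1) by linarith
    from order_tendstoD(2)[OF slope[OF that(2)] this] show ?thesis
      by eventually_elim (use below(1)[OF that(2)] in \<open>auto intro: order_le_less_trans\<close>)
  qed
  show greater: "\<forall>\<^sub>F i in L. G a - e < F i b" if "e > 0" "a < b" for a b e
  proof -
    have "G a - e < (g b - g a) / (b - a)" using below(3)[OF that(2)] that(1) by linarith
    from order_tendstoD(1)[OF slope[OF that(2)] this] show ?thesis
      by eventually_elim (use below(2)[OF that(2)] in \<open>auto intro: order_less_le_trans\<close>)
  qed
  show "((\<lambda>i. F i k) \<longlongrightarrow> G k) L" if k: "isCont G k"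
  proof (rule order_tendstoI)
    fix u assume u: "u < G k"
    have "eventually (\<lambda>x. (u + G k) / 2 < G x) (at k)"
      using k u by (intro order_tendstoD(1)[of _ "G k"]) (auto simp: isCont_def)
    then obtain d where "d > 0" "\<And>x. x \<noteq> k \<Longrightarrow> dist x k < d \<Longrightarrow> (u + G k) / 2 < G x"
      by (auto simp: eventually_at)
    then have "(u + G k) / 2 < G (k - d / 2)" by (simp add: dist_real_def)
    moreover have "\<forall>\<^sub>F i in L. G (k - d / 2) - (G k - u) / 2 < F i k"
      using u \<open>d > 0\<close> by (intro greater) auto
    ultimately show "\<forall>\<^sub>F i in L. u < F i k"
      by (auto elim!: eventually_mono simp: field_simps)
  next
    fix u assume u: "G k < u"
    have "eventually (\<lambda>x. G x < (u + G k) / 2) (at k)"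
      using k u by (intro order_tendstoD(2)[of _ "G k"]) (auto simp: isCont_def)
    then obtain d where "d > 0" "\<And>x. x \<noteq> k \<Longrightarrow> dist x k < d \<Longrightarrow> G x < (u + G k) / 2"
      by (auto simp: eventually_at)
    then have "G (k + d / 2) < (u + G k) / 2" by (simp add: dist_real_def)
    moreover have "\<forall>\<^sub>F i in L. F i k < G (k + d / 2) + (u - G k) / 2"
      using u \<open>d > 0\<close> by (intro less) auto
    ultimately show "\<forall>\<^sub>F i in L. F i k < u"
      by (auto elim!: eventually_mono simp: field_simps)
  qed
qed

section \<open>Convex hulls as suprema of convex minorants\<close>

definition convex_hull_fun :: "(real \<Rightarrow> real) \<Rightarrow> real \<Rightarrow> real" where
  "convex_hull_fun G x = (SUP c\<in>{c. convex_on UNIV c \<and> c \<le> G}. c x)"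

lemma convex_hull_fun_upper:
  assumes "convex_on UNIV c" "c \<le> G"
  shows "c \<le> convex_hull_fun G"
  unfolding convex_hull_fun_def le_fun_def using assms
  by (auto intro!: cSUP_upper bdd_aboveI2 simp: le_fun_def)

text \<open>The minorant \<open>c\<close> guarantees that the supremum runs over a non-empty family;
  a real supremum over the empty family carries no information. This is why such a witness recurs in
  the facts about hulls.\<close>

lemma convex_hull_fun_le:
  assumes "convex_on UNIV c" "c \<le> G"
  shows "convex_hull_fun G \<le> G"
  unfolding convex_hull_fun_def le_fun_def using assms
  by (auto intro!: cSUP_least simp: le_fun_def)

lemma convex_convex_hull_fun:
  assumes "convex_on UNIV c" "c \<le> G"
  shows "convex_on UNIV (convex_hull_fun G)"
proof (rule convex_onI)
  fix t x y :: real
  assume t: "0 < t" "t < 1"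
  show "convex_hull_fun G ((1 - t) *\<^sub>R x + t *\<^sub>R y)
      \<le> (1 - t) * convex_hull_fun G x + t * convex_hull_fun G y"
    unfolding convex_hull_fun_def[of G "(1 - t) *\<^sub>R x + t *\<^sub>R y"]
  proof (rule cSUP_least)
    fix c assume "c \<in> {c. convex_on UNIV c \<and> c \<le> G}"
    then have c: "convex_on UNIV c" "c \<le> convex_hull_fun G"
      using convex_hull_fun_upper by auto
    have "c ((1 - t) *\<^sub>R x + t *\<^sub>R y) \<le> (1 - t) * c x + t * c y"
      using t by (intro convex_onD[OF c(1)]) auto
    also have "\<dots> \<le> (1 - t) * convex_hull_fun G x + t * convex_hull_fun G y"
      using t c(2) by (intro add_mono mult_left_mono) (auto simp: le_fun_def)
    finally show "c ((1 - t) *\<^sub>R x + t *\<^sub>R y) \<le> \<dots>" .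
  qed (use assms in auto)
qed simp

text \<open>Where the hull lies strictly below the function it is affine; only midpoint concavity at
  the given point is needed.\<close>

lemma convex_hull_fun_midpoint:
  assumes c: "convex_on UNIV c" "c \<le> G" and G: "continuous_on UNIV G"
    and less: "convex_hull_fun G b < G b" and r: "r > 0"
  obtains d where "0 < d" "d < r"
    "convex_hull_fun G (b - d) + convex_hull_fun G (b + d) \<le> 2 * convex_hull_fun G b"
proof -
  define h where "h = convex_hull_fun G"
  have h: "convex_on UNIV h" "h \<le> G"
    using c convex_convex_hull_fun convex_hull_fun_le by (auto simp: h_def)
  \<comment> \<open>Half the gap: near \<open>b\<close>, the hull stays below the level
    \<open>h b + e = G b - e\<close> and \<open>G\<close> stays above it.\<close>
  define e where "e = (G b - h b) / 2"
  have e: "e > 0" using less by (simp add: e_def h_def)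
  have ch: "continuous_on UNIV h" using h(1) by (intro convex_on_continuous) auto
  obtain d1 where d1: "d1 > 0" "\<And>u. dist u b < d1 \<Longrightarrow> dist (h u) (h b) < e"
    using ch e unfolding continuous_on_iff by (metis UNIV_I)
  obtain d2 where d2: "d2 > 0" "\<And>u. dist u b < d2 \<Longrightarrow> dist (G u) (G b) < e"
    using G e unfolding continuous_on_iff by (metis UNIV_I)
  define d where "d = min r (min d1 d2) / 2"
  have d: "0 < d" "d < r" "d < d1" "d < d2" using r d1(1) d2(1) by (auto simp: d_def min_def)
  define m where "m = (h (b + d) - h (b - d)) / (2 * d)"
  \<comment> \<open>The chord of \<open>h\<close> between \<open>b - d\<close> and
    \<open>b + d\<close> is a minorant of \<open>G\<close>: outside the interval it is below
    \<open>h\<close> by convexity, inside it is below the level that separates \<open>h\<close> from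
    \<open>G\<close>. Hence \<open>L b \<le> h b\<close>.\<close>
  define L where "L = (\<lambda>u. h (b - d) + m * (u - (b - d)))"
  have L2: "L u = h (b + d) + m * (u - (b + d))" for u
    using d(1) by (simp add: L_def m_def field_simps)
  obtain s where s: "subgradient h s" using convex_imp_subgradient[OF h(1)] by blast
  have out: "L u \<le> h u" if "u \<le> b - d \<or> u \<ge> b + d" for u
    using that
  proof
    assume u: "u \<ge> b + d"
    have "s (b + d) * (2 * d) \<ge> h (b + d) - h (b - d)"
      using subgradientD[OF s, of "b + d" "b - d"] by (simp add: algebra_simps)
    then have "m \<le> s (b + d)" using d(1) by (simp add: m_def field_simps)
    then have "m * (u - (b + d)) \<le> s (b + d) * (u - (b + d))"
      using u by (intro mult_right_mono) auto
    then show ?thesis using subgradientD[OF s, of "b + d" u] unfolding L2 by linarith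
  next
    assume u: "u \<le> b - d"
    have "s (b - d) * (2 * d) \<le> h (b + d) - h (b - d)"
      using subgradientD[OF s, of "b - d" "b + d"] by (simp add: algebra_simps)
    then have "s (b - d) \<le> m" using d(1) by (simp add: m_def field_simps)
    then have "m * (u - (b - d)) \<le> s (b - d) * (u - (b - d))"
      using u by (intro mult_right_mono_neg) auto
    then show ?thesis using subgradientD[OF s, of "b - d" u] unfolding L_def by linarith
  qed
  have inside: "L u \<le> G u" if "b - d < u" "u < b + d" for u
  proof -
    have "L u \<le> max (h (b - d)) (h (b + d))"
    proof (cases "m \<ge> 0")
      case True
      then have "m * (u - (b + d)) \<le> 0" using that by (intro mult_nonneg_nonpos) auto
      then show ?thesis unfolding L2 by linarith
    next
      case False
      then have "m * (u - (b - d)) \<le> 0" using that by (intro mult_nonpos_nonneg) auto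
      then show ?thesis unfolding L_def by linarith
    qed
    also have "\<dots> < h b + e"
      using d1(2)[of "b - d"] d1(2)[of "b + d"] d by (auto simp: dist_real_def)
    also have "\<dots> = G b - e" by (simp add: e_def field_simps)
    also have "\<dots> < G u" using d2(2)[of u] d that unfolding dist_real_def by linarith
    finally show ?thesis by simp
  qed
  have "L u \<le> G u" for u
    using out[of u] inside[of u] h(2) by (cases "u \<le> b - d \<or> u \<ge> b + d") (auto simp: le_fun_def intro: order_trans)
  moreover have "subgradient L (\<lambda>_. m)"
    by (auto simp: subgradient_def L_def algebra_simps)
  ultimately have "L b \<le> h b"
    using convex_hull_fun_upper[of L G] subgradient_imp_convex by (auto simp: h_def le_fun_def)
  moreover have "2 * L b = h (b - d) + h (b + d)"
    using d(1) by (simp add: L_def m_def field_simps)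
  ultimately show ?thesis using that[of d] d by (auto simp: h_def)
qed

text \<open>Suppose \<open>p = g - h\<close> rises above one of its chords, and look at a point
  where the excess is maximal. If \<open>h < G\<close> there, the hull is midpoint concave, so
  \<open>p\<close> is midpoint convex like \<open>g\<close>, which a maximum of the excess
  contradicts. If \<open>h = G\<close> there, then \<open>p\<close> touches the convex function
  \<open>f\<close>, which lies below \<open>p\<close> everywhere and so below the chord.\<close>

lemma convex_minus_convex_hull_fun:
  assumes f: "convex_on UNIV f" and g: "convex_on UNIV g"
    and c: "convex_on UNIV c" "c \<le> (\<lambda>x. g x - f x)"
  shows "convex_on UNIV (\<lambda>x. g x - convex_hull_fun (\<lambda>x. g x - f x) x)"
proof -
  define G where "G = (\<lambda>x. g x - f x)"
  define h where "h = convex_hull_fun G"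
  define p where "p = (\<lambda>x. g x - h x)"
  have h: "convex_on UNIV h" "h \<le> G"
    using c convex_convex_hull_fun convex_hull_fun_le by (auto simp: h_def G_def)
  have cont: "continuous_on UNIV f" "continuous_on UNIV g" "continuous_on UNIV h"
    using f g h by (auto intro: convex_on_continuous)
  have contG: "continuous_on UNIV G" and contp: "continuous_on UNIV p"
    unfolding G_def p_def by (intro continuous_intros cont)+
  have fp: "f x \<le> p x" for x using h(2) by (auto simp: p_def G_def le_fun_def dest: spec[of _ x])
  have "p ((1 - t) *\<^sub>R x + t *\<^sub>R y) \<le> (1 - t) * p x + t * p y"
    if t: "0 < t" "t < 1" and xy: "x < y" for t x y
  proof (rule ccontr)
    assume neg: "\<not> ?thesis"
    define z where "z = (1 - t) *\<^sub>R x + t *\<^sub>R y"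
    define m where "m = (p y - p x) / (y - x)"
    define l where "l = (\<lambda>u. p x + m * (u - x))"
    define q where "q = (\<lambda>u. p u - l u)"
    have zx: "z - x = t * (y - x)" by (simp add: z_def algebra_simps)
    have "m * (z - x) = t * (p y - p x)"
      using xy unfolding zx m_def by simp
    then have lz: "l z = (1 - t) * p x + t * p y" by (simp add: l_def algebra_simps)
    have qz: "q z > 0" using neg unfolding q_def lz z_def[symmetric] by simp
    have zin: "z \<in> {x..y}"
    proof -
      have "0 \<le> t * (y - x)" "t * (y - x) \<le> 1 * (y - x)"
        using t xy by (intro mult_nonneg_nonneg mult_right_mono; simp)+
      then show ?thesis using zx by simp
    qed
    have ly: "l y = p y" using xy by (simp add: l_def m_def)
    have qx: "q x = 0" and qy: "q y = 0" by (auto simp: q_def ly) (simp add: l_def)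
    have cq: "continuous_on A q" for A unfolding q_def l_def
      by (intro continuous_intros continuous_on_subset[OF contp]) auto
    obtain w where w: "w \<in> {x..y}" "\<And>u. u \<in> {x..y} \<Longrightarrow> q u \<le> q w"
      using continuous_attains_sup[OF compact_Icc _ cq, of x y] xy by fastforce
    \<comment> \<open>The leftmost maximiser \<open>b\<close> is taken: \<open>q\<close> is strictly
      smaller on its left, and this strictness contradicts the midpoint inequality in the first
      case.\<close>
    define Z where "Z = {u \<in> {x..y}. q u = q w}"
    have "closed {u. q u = q w}"
      by (rule closed_Collect_eq) (intro cq continuous_on_const)+
    moreover have "Z = {x..y} \<inter> {u. q u = q w}" by (auto simp: Z_def)
    ultimately have "compact Z" by (simp add: compact_Int_closed)
    moreover have "Z \<noteq> {}" using w(1) unfolding Z_def by blast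
    ultimately obtain b where b: "b \<in> Z" "\<And>u. u \<in> Z \<Longrightarrow> b \<le> u"
      using compact_attains_inf[of Z] by metis
    have bin: "b \<in> {x..y}" "q b = q w" using b(1) unfolding Z_def by blast+
    have qb: "q b \<ge> q u" if "u \<in> {x..y}" for u using w(2)[OF that] bin(2) by simp
    have qb0: "q b > 0" using qb[OF zin] qz by linarith
    have "x \<noteq> b" "b \<noteq> y" using qb0 qx qy by auto
    then have bxy: "x < b" "b < y" using bin(1) by auto
    have bl: "q u < q b" if "x \<le> u" "u < b" for u
    proof -
      have "u \<in> {x..y}" using that bxy by simp
      moreover have "u \<notin> Z" using b(2)[of u] that by auto
      ultimately show ?thesis using qb[of u] bin(2) by (simp add: Z_def)
    qed
    show False
    proof (cases "h b < G b")
      case True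
      then obtain d where d: "0 < d" "d < min (b - x) (y - b)" "h (b - d) + h (b + d) \<le> 2 * h b"
        using convex_hull_fun_midpoint[OF c[folded G_def] contG, of b "min (b - x) (y - b)"] bxy
        by (auto simp: h_def)
      obtain s where s: "subgradient g s" using convex_imp_subgradient[OF g] by blast
      have "2 * g b \<le> g (b - d) + g (b + d)"
        using subgradientD[OF s, of b "b - d"] subgradientD[OF s, of b "b + d"] by (simp add: algebra_simps)
      then have "2 * p b \<le> p (b - d) + p (b + d)" using d(3) by (simp add: p_def)
      then have "2 * q b \<le> q (b - d) + q (b + d)" by (simp add: q_def l_def algebra_simps)
      moreover have "q (b - d) < q b" using d by (intro bl) auto
      moreover have "q (b + d) \<le> q b" using d bxy by (intro qb) auto
      ultimately show False by linarith
    next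
      case False
      then have "p b = f b" using h(2) by (auto simp: p_def G_def le_fun_def dest: spec[of _ b])
      \<comment> \<open>At a contact point the supporting line of \<open>f\<close> at
        \<open>b\<close> lies below the chord \<open>l\<close> at both ends, since
        \<open>f \<le> p\<close>. So it does at \<open>b\<close>, where its value is
        \<open>p b\<close>.\<close>
      obtain s where s: "subgradient f s" using convex_imp_subgradient[OF f] by blast
      have "f b + s b * (x - b) \<le> l x" "f b + s b * (y - b) \<le> l y"
        using subgradientD[OF s, of b x] subgradientD[OF s, of b y] fp[of x] fp[of y] ly by (auto simp: l_def)
      then have "(y - b) * (f b + s b * (x - b)) + (b - x) * (f b + s b * (y - b)) \<le> (y - b) * l x + (b - x) * l y"
        using bxy by (intro add_mono mult_left_mono) auto
      then have "(y - x) * f b \<le> (y - x) * l b" by (simp add: l_def algebra_simps)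
      then have "f b \<le> l b" using xy by simp
      then show False using qb0 \<open>p b = f b\<close> by (simp add: q_def)
    qed
  qed
  then have "convex_on UNIV p" by (intro convex_on_linorderI) auto
  then show ?thesis by (simp add: p_def h_def G_def)
qed

section \<open>Convergence of convex hulls\<close>

lemma eventually_affine_le:
  fixes G :: "'i \<Rightarrow> real \<Rightarrow> real"
  assumes lip: "\<And>i a b. \<bar>G i a - G i b\<bar> \<le> C * \<bar>a - b\<bar>" "\<And>a b. \<bar>H a - H b\<bar> \<le> C * \<bar>a - b\<bar>"
    and lim: "\<And>k. ((\<lambda>i. G i k - c i) \<longlongrightarrow> H k) L"
    and tail: "\<forall>\<^sub>F i in L. (\<forall>k\<ge>K. s * (k - K) \<le> G i k - G i K) \<and> (\<forall>k\<le>-K. s * (k + K) \<le> G i k - G i (-K))"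
    and le: "\<And>k. l + s * k \<le> H k" and e: "e > 0"
  shows "\<forall>\<^sub>F i in L. \<forall>k. l + s * k - e + c i \<le> G i k"
proof -
  have C: "C \<ge> 0" using order_trans[OF abs_ge_zero lip(2)[of 0 1]] by simp
  \<comment> \<open>Pointwise convergence is used on a finite \<open>d\<close>-net of the middle
    part only; the Lipschitz bound carries it to the other points at a cost of \<open>e / 3\<close>
    for each of \<open>G i\<close> and \<open>H\<close>. Beyond \<open>K\<close> the growth in
    \<open>tail\<close> takes over. The \<open>+ 1\<close> covers \<open>C = 0\<close>.\<close>
  define d where "d = e / (3 * (C + 1))"
  have d: "d > 0" using C e by (simp add: d_def)
  have Cd: "C * d \<le> e / 3" using C e by (simp add: d_def field_simps)
  have "{-\<bar>K\<bar>..\<bar>K\<bar>} \<subseteq> (\<Union>t\<in>{-\<bar>K\<bar>..\<bar>K\<bar>}. ball t d)" using d by auto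
  then obtain D where D: "D \<subseteq> {-\<bar>K\<bar>..\<bar>K\<bar>}" "finite D" "{-\<bar>K\<bar>..\<bar>K\<bar>} \<subseteq> (\<Union>t\<in>D. ball t d)"
    using compactE_image[of "{-\<bar>K\<bar>..\<bar>K\<bar>}" "{-\<bar>K\<bar>..\<bar>K\<bar>}" "\<lambda>t. ball t d"] by (metis compact_Icc open_ball)
  have "\<forall>\<^sub>F i in L. \<forall>t\<in>D. dist (G i t - c i) (H t) < e / 3"
    using D(2) e by (intro eventually_ball_finite ballI tendstoD[OF lim]) auto
  with tail show ?thesis
  proof eventually_elim
    case (elim i)
    have mid: "l + s * k - e + c i \<le> G i k" if k: "\<bar>k\<bar> \<le> \<bar>K\<bar>" for k
    proof -
      from k have "k \<in> (\<Union>t\<in>D. ball t d)" by (intro subsetD[OF D(3)]) auto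
      then obtain t where t: "t \<in> D" "dist t k < d" by auto
      have "C * \<bar>k - t\<bar> \<le> C * d" using t(2) C by (intro mult_left_mono) (auto simp: dist_real_def)
      then have "\<bar>G i k - G i t\<bar> \<le> e / 3" "\<bar>H k - H t\<bar> \<le> e / 3"
        using lip(1)[of i k t] lip(2)[of k t] Cd by linarith+
      moreover have "\<bar>G i t - c i - H t\<bar> < e / 3" using elim(2) t(1) by (auto simp: dist_real_def)
      ultimately show ?thesis using le[of k] by linarith
    qed
    show ?case
    proof
      fix k
      consider "\<bar>k\<bar> \<le> \<bar>K\<bar>" | "k \<ge> K" "k > \<bar>K\<bar>" | "k \<le> - K" "k < - \<bar>K\<bar>" by linarith
      then show "l + s * k - e + c i \<le> G i k"
      proof cases
        case 2
        then show ?thesis using mid[of K] elim(1) by (auto simp: algebra_simps dest!: spec[of _ k])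
      next
        case 3
        then show ?thesis using mid[of "-K"] elim(1) by (auto simp: algebra_simps dest!: spec[of _ k])
      qed (rule mid)
    qed
  qed
qed

lemma convex_hull_fun_upper_affine:
  assumes "\<And>k. l + s * k \<le> G k"
  shows "l + s * k \<le> convex_hull_fun G k"
proof -
  have "subgradient (\<lambda>k. l + s * k) (\<lambda>_. s)" by (auto simp: subgradient_def algebra_simps)
  then show ?thesis
    using convex_hull_fun_upper[of "\<lambda>k. l + s * k" G] assms subgradient_imp_convex
    by (auto simp: le_fun_def)
qed

text \<open>\<open>lower\<close> and \<open>upper\<close> fix the asymptotic slopes of
  \<open>H\<close> as \<open>0\<close> and \<open>S\<close>, so supporting lines of its hull have
  slopes in \<open>[0, S]\<close>. The growth \<open>tail\<close>, uniform along the filter,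
  concerns slopes strictly inside, so the extreme ones have to be approximated.\<close>

lemma convex_hull_fun_tendsto:
  fixes G :: "'i \<Rightarrow> real \<Rightarrow> real"
  assumes lip: "\<And>i a b. \<bar>G i a - G i b\<bar> \<le> C * \<bar>a - b\<bar>" "\<And>a b. \<bar>H a - H b\<bar> \<le> C * \<bar>a - b\<bar>"
    and lim: "\<And>k. ((\<lambda>i. G i k - c i) \<longlongrightarrow> H k) L"
    and nonneg: "\<And>i k. 0 \<le> G i k"
    and tail: "\<And>s. 0 < s \<Longrightarrow> s < S \<Longrightarrow> \<exists>K. \<forall>\<^sub>F i in L.
      (\<forall>k\<ge>K. s * (k - K) \<le> G i k - G i K) \<and> (\<forall>k\<le>-K. s * (k + K) \<le> G i k - G i (-K))"
    and S: "S > 0" and lower: "\<And>k. max 0 (S * k - b) \<le> H k"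
    and upper: "\<And>k. H k \<le> B + max 0 (S * k)"
  shows "((\<lambda>i. convex_hull_fun (G i) k - c i) \<longlongrightarrow> convex_hull_fun H k) L"
proof (cases "L = bot")
  case False
  have conv0: "convex_on UNIV (\<lambda>_::real. 0::real)" by (simp add: convex_on_def)
  define h where "h = convex_hull_fun H"
  have le0: "(\<lambda>_. 0) \<le> G i" "(\<lambda>_. 0) \<le> H" for i
    using nonneg lower by (auto simp: le_fun_def intro: order_trans[OF max.cobounded1])
  have h: "convex_on UNIV h" "h \<le> H"
    using convex_convex_hull_fun convex_hull_fun_le conv0 le0 by (auto simp: h_def)
  have hi: "convex_on UNIV (convex_hull_fun (G i))" "convex_hull_fun (G i) \<le> G i" for i
    using convex_convex_hull_fun convex_hull_fun_le conv0 le0 by auto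
  obtain sg where sg: "subgradient h sg" using convex_imp_subgradient[OF h(1)] by blast
  have sg0: "0 \<le> sg k" for k
  proof (rule ccontr)
    assume neg: "\<not> ?thesis"
    \<comment> \<open>So far to the left that the supporting line at \<open>k\<close> exceeds
      \<open>B\<close>; \<open>t \<le> 0\<close> turns \<open>upper\<close> into
      \<open>h t \<le> B\<close>.\<close>
    define t where "t = min 0 (k - (B - h k + 1) / (- sg k))"
    have "- sg k * (k - t) \<ge> B - h k + 1"
    proof -
      have "k - t \<ge> (B - h k + 1) / (- sg k)" by (simp add: t_def)
      then show ?thesis using neg by (simp add: field_simps)
    qed
    moreover have "h k + sg k * (t - k) \<le> h t" by (rule subgradientD[OF sg])
    moreover have "S * t \<le> 0" using S by (intro mult_nonneg_nonpos) (auto simp: t_def)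
    then have "h t \<le> B" using h(2) upper[of t] by (auto simp: le_fun_def intro: order_trans)
    ultimately show False by (simp add: algebra_simps)
  qed
  have sgS: "sg k \<le> S" for k
  proof (rule ccontr)
    assume neg: "\<not> ?thesis"
    \<comment> \<open>So far to the right that the supporting line at \<open>k\<close> overtakes
      \<open>B + S * t\<close>.\<close>
    define t where "t = max 0 ((B - h k + sg k * k + 1) / (sg k - S))"
    have "t \<ge> (B - h k + sg k * k + 1) / (sg k - S)" by (simp add: t_def)
    then have "(sg k - S) * t \<ge> B - h k + sg k * k + 1" using neg by (simp add: field_simps)
    moreover have "h k + sg k * (t - k) \<le> h t" by (rule subgradientD[OF sg])
    moreover have "S * t \<ge> 0" using S by (simp add: t_def)
    then have "h t \<le> B + S * t" using h(2) upper[of t] by (auto simp: le_fun_def intro: order_trans)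
    ultimately show False by (simp add: algebra_simps)
  qed
  have low: "\<forall>\<^sub>F i in L. h k - e < convex_hull_fun (G i) k - c i" if e: "e > 0" for e k
  proof -
    \<comment> \<open>tilting the supporting line towards one of slope \<open>S / 2\<close> makes its slope admissible for \<open>tail\<close>\<close>
    define m where "m = h k - (S * k - b) / 2"
    \<comment> \<open>Small enough for the tilt to lose at most \<open>e / 2\<close> at
      \<open>k\<close>; a further \<open>e / 4\<close> goes to \<open>eventually_affine_le\<close>,
      which leaves a strict inequality.\<close>
    define r where "r = min 1 (e / (2 * (\<bar>m\<bar> + 1)))"
    have r: "0 < r" "r \<le> 1" using e by (auto simp: r_def)
    have "r * \<bar>m\<bar> \<le> e / (2 * (\<bar>m\<bar> + 1)) * (\<bar>m\<bar> + 1)"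
      using e r by (intro mult_mono) (auto simp: r_def)
    also have "\<dots> = e / 2" using e by (simp add: field_simps)
    finally have rm: "r * \<bar>m\<bar> \<le> e / 2" .
    define s where "s = (1 - r) * sg k + r * (S / 2)"
    define l where "l = (1 - r) * (h k - sg k * k) + r * (- b / 2)"
    have s: "0 < s"
      unfolding s_def using r S sg0[of k] by (intro add_nonneg_pos mult_nonneg_nonneg mult_pos_pos) auto
    have "s \<le> (1 - r) * S + r * (S / 2)" unfolding s_def using r sgS[of k] by (intro add_mono mult_left_mono) auto
    also have "\<dots> < S" using r S by (simp add: algebra_simps)
    finally have sS: "s < S" .
    have ls: "l + s * t \<le> H t" for t
    proof -
      have "h k + sg k * (t - k) \<le> H t" using subgradientD[OF sg, of k t] h(2) by (auto simp: le_fun_def intro: order_trans)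
      moreover have "(S * t - b) / 2 \<le> H t" using lower[of t] by (auto simp: max_def split: if_splits)
      ultimately have "(1 - r) * (h k + sg k * (t - k)) + r * ((S * t - b) / 2) \<le> (1 - r) * H t + r * H t"
        using r by (intro add_mono mult_left_mono) auto
      also have "\<dots> = H t" by (simp add: algebra_simps)
      also have "(1 - r) * (h k + sg k * (t - k)) + r * ((S * t - b) / 2) = l + s * t"
        by (simp add: l_def s_def algebra_simps diff_divide_distrib)
      finally show ?thesis .
    qed
    have lsk: "l + s * k = h k - r * m"
      by (simp add: l_def s_def m_def algebra_simps diff_divide_distrib)
    have "r * m \<le> r * \<bar>m\<bar>" using r by (intro mult_left_mono) auto
    with rm lsk have lk: "h k - e / 2 \<le> l + s * k" by linarith
    obtain K where "\<forall>\<^sub>F i in L. (\<forall>k\<ge>K. s * (k - K) \<le> G i k - G i K) \<and> (\<forall>k\<le>-K. s * (k + K) \<le> G i k - G i (-K))"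
      using tail[OF s sS] by blast
    from eventually_affine_le[OF lip lim this ls, of "e / 4"] e
    have "\<forall>\<^sub>F i in L. \<forall>t. (l - e / 4 + c i) + s * t \<le> G i t" by (simp add: algebra_simps)
    then show ?thesis
    proof eventually_elim
      case (elim i)
      then show ?case using convex_hull_fun_upper_affine[of "l - e / 4 + c i" s "G i" k] lk e by simp
    qed
  qed
  \<comment> \<open>the upper limit is a convex minorant of \<open>H\<close>\<close>
  define v where "v = (\<lambda>i k. convex_hull_fun (G i) k - c i)"
  define A where "A = (\<lambda>k. {r. \<forall>\<^sub>F i in L. v i k \<le> r})"
  define U where "U = (\<lambda>k. Inf (A k))"
  have vH: "\<forall>\<^sub>F i in L. v i k \<le> H k + e" if "e > 0" for k e
  proof -
    have "\<forall>\<^sub>F i in L. G i k - c i < H k + e" using that by (intro order_tendstoD(2)[OF lim]) auto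
    then show ?thesis
    proof eventually_elim
      case (elim i)
      then show ?case using hi(2)[of i] by (auto simp: v_def le_fun_def dest: spec[of _ k])
    qed
  qed
  \<comment> \<open>In a proper filter two eventual events occur together, so every eventual upper
    bound lies above the lower bound from \<open>low\<close>. This makes the infimum
    \<open>U k\<close> meaningful.\<close>
  have lb: "h k - 1 \<le> r" if "r \<in> A k" for r k
  proof -
    have "\<forall>\<^sub>F i in L. h k - 1 < v i k \<and> v i k \<le> r"
      using low[of 1 k] that by (auto simp: A_def v_def eventually_conj_iff)
    then show ?thesis using False eventually_happens[of _ L] by fastforce
  qed
  have bdd: "bdd_below (A k)" for k using lb by (intro bdd_belowI) auto
  have ne: "H k + 1 \<in> A k" for k using vH[of 1 k] by (simp add: A_def)
  have Uv: "\<forall>\<^sub>F i in L. v i k < U k + e" if "e > 0" for e k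
  proof -
    have "Inf (A k) < U k + e" using that by (simp add: U_def)
    moreover have "A k \<noteq> {}" using ne[of k] by force
    ultimately obtain r where "r \<in> A k" "r < U k + e"
      using cInf_lessD[of "A k" "U k + e"] by metis
    then show ?thesis by (auto simp: A_def elim: eventually_mono)
  qed
  have UH: "U \<le> H"
  proof (rule le_funI)
    fix k
    show "U k \<le> H k"
    proof (rule field_le_epsilon)
      fix e :: real assume "e > 0"
      then have "H k + e \<in> A k" unfolding A_def mem_Collect_eq by (rule vH)
      then show "U k \<le> H k + e" unfolding U_def by (rule cInf_lower[OF _ bdd])
    qed
  qed
  have "convex_on UNIV U"
  proof (rule convex_onI)
    fix t x y :: real
    assume t: "0 < t" "t < 1"
    define z where "z = (1 - t) *\<^sub>R x + t *\<^sub>R y"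
    show "U z \<le> (1 - t) * U x + t * U y"
    proof (rule field_le_epsilon)
      fix e :: real assume e: "e > 0"
      have "\<forall>\<^sub>F i in L. v i z \<le> (1 - t) * U x + t * U y + e"
        using Uv[OF e, of x] Uv[OF e, of y]
      proof eventually_elim
        case (elim i)
        have "convex_hull_fun (G i) z \<le> (1 - t) * convex_hull_fun (G i) x + t * convex_hull_fun (G i) y"
          unfolding z_def using t by (intro convex_onD[OF hi(1)]) auto
        then have "v i z \<le> (1 - t) * v i x + t * v i y" by (simp add: v_def algebra_simps)
        also have "\<dots> \<le> (1 - t) * (U x + e) + t * (U y + e)"
          using t elim by (intro add_mono mult_left_mono) auto
        finally show ?case by (simp add: algebra_simps)
      qed
      then have "(1 - t) * U x + t * U y + e \<in> A z" by (simp add: A_def)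
      then show "U z \<le> (1 - t) * U x + t * U y + e"
        unfolding fun_cong[OF U_def, of z] by (rule cInf_lower[OF _ bdd])
    qed
  qed simp
  then have Uh: "U k \<le> h k" for k
    using convex_hull_fun_upper[OF _ UH] by (simp add: h_def le_fun_def)
  show ?thesis
  proof (rule tendstoI)
    fix e :: real assume "e > 0"
    from low[OF this, of k] Uv[OF this, of k]
    show "\<forall>\<^sub>F i in L. dist (convex_hull_fun (G i) k - c i) (convex_hull_fun H k) < e"
    proof eventually_elim
      case (elim i)
      then show ?case using Uh[of k] by (simp add: dist_real_def h_def v_def abs_less_iff)
    qed
  qed
qed simp

section \<open>Potentials\<close>

definition potential :: "real measure \<Rightarrow> real \<Rightarrow> real" where
  "potential \<mu> k = (\<integral>x. max 0 (k - x) \<partial>\<mu>)"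

lemma finite_measuresD:
  assumes "\<mu> \<in> finite_measures"
  shows "finite_measure \<mu>" "sets \<mu> = sets borel" "space \<mu> = UNIV" "integrable \<mu> (\<lambda>x. \<bar>x\<bar>)"
    "finite_borel_measure \<mu>"
  using assms sets_eq_imp_space_eq[of \<mu> borel]
  by (auto simp: finite_measures_def finite_borel_measure_def finite_borel_measure_axioms_def)

lemma finite_measures_measurable:
  "\<mu> \<in> finite_measures \<Longrightarrow> f \<in> borel_measurable borel \<Longrightarrow> f \<in> borel_measurable \<mu>"
  using measurable_cong_sets[OF finite_measuresD(2) refl] by blast

lemma integrable_linear_growth:
  fixes f :: "real \<Rightarrow> real"
  assumes \<mu>: "\<mu> \<in> finite_measures" and f: "f \<in> borel_measurable borel" "\<And>x. \<bar>f x\<bar> \<le> A + B * \<bar>x\<bar>"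
  shows "integrable \<mu> f"
proof (rule Bochner_Integration.integrable_bound)
  interpret finite_measure \<mu> by (rule finite_measuresD[OF \<mu>])
  show "integrable \<mu> (\<lambda>x. A + B * \<bar>x\<bar>)"
    using finite_measuresD(4)[OF \<mu>] by (intro Bochner_Integration.integrable_add integrable_mult_right) auto
  show "f \<in> borel_measurable \<mu>" by (rule finite_measures_measurable[OF \<mu> f(1)])
qed (auto intro!: AE_I2 order_trans[OF f(2)])

lemma integrable_finite_measures:
  assumes "\<mu> \<in> finite_measures"
  shows "integrable \<mu> (\<lambda>x. max 0 (k - x))" "integrable \<mu> (\<lambda>x. max 0 (x - k))" "integrable \<mu> (\<lambda>x. x)"
    "A \<in> sets borel \<Longrightarrow> integrable \<mu> (indicator A :: real \<Rightarrow> real)" "integrable \<mu> (\<lambda>x. c :: real)"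
  by (rule integrable_linear_growth[OF assms, of _ "\<bar>k\<bar> + 1 + \<bar>c\<bar>" 1]; auto simp: max_def indicator_def)+

lemma finite_measures_mono:
  assumes \<nu>: "\<nu> \<in> finite_measures" and s: "sets \<eta> = sets borel" and le: "\<eta> \<le> \<nu>"
  shows "\<eta> \<in> finite_measures"
proof -
  have s': "sets \<eta> = sets \<nu>" using s finite_measuresD(2)[OF \<nu>] by simp
  then have sp: "space \<eta> = space \<nu>" by (rule sets_eq_imp_space_eq)
  have "emeasure \<eta> (space \<eta>) \<le> emeasure \<nu> (space \<nu>)"
    unfolding sp by (rule le_measureD3[OF le s'])
  also have "\<dots> < \<infinity>" using finite_measure.emeasure_finite[OF finite_measuresD(1)[OF \<nu>]] by (simp add: less_top)
  finally have "finite_measure \<eta>" by (intro finite_measureI) auto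
  moreover have "integrable \<eta> (\<lambda>x. \<bar>x\<bar>)"
  proof -
    have "(\<integral>\<^sup>+ x. ennreal (norm \<bar>x\<bar>) \<partial>\<eta>) \<le> (\<integral>\<^sup>+ x. ennreal (norm \<bar>x\<bar>) \<partial>\<nu>)"
      by (rule nn_integral_mono_measure[OF s' le])
    also have "\<dots> < \<infinity>" using finite_measuresD(4)[OF \<nu>] by (simp add: integrable_iff_bounded)
    finally have "(\<integral>\<^sup>+ x. ennreal (norm \<bar>x\<bar>) \<partial>\<eta>) < \<infinity>" .
    moreover have "(\<lambda>x::real. \<bar>x\<bar>) \<in> borel_measurable \<eta>"
      unfolding measurable_cong_sets[OF s refl] by measurable
    ultimately show ?thesis by (simp add: integrable_iff_bounded)
  qed
  ultimately show ?thesis using s by (simp add: finite_measures_def)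
qed

lemma integral_mono_finite_measures:
  assumes \<nu>: "\<nu> \<in> finite_measures" and \<eta>: "\<eta> \<in> finite_measures" and le: "\<eta> \<le> \<nu>"
    and f: "integrable \<nu> f" "\<And>x. 0 \<le> (f x :: real)"
  shows "(\<integral>x. f x \<partial>\<eta>) \<le> (\<integral>x. f x \<partial>\<nu>)"
proof -
  have s': "sets \<eta> = sets \<nu>" using finite_measuresD(2) \<nu> \<eta> by simp
  have m: "f \<in> borel_measurable \<nu>" "f \<in> borel_measurable \<eta>"
    using f(1) measurable_cong_sets[OF s' refl] by auto
  have "(\<integral>\<^sup>+x. ennreal (f x) \<partial>\<eta>) \<le> (\<integral>\<^sup>+x. ennreal (f x) \<partial>\<nu>)"
    by (rule nn_integral_mono_measure[OF s' le])
  moreover have "(\<integral>\<^sup>+x. ennreal (f x) \<partial>\<nu>) < \<infinity>" using f by (simp add: integrable_iff_bounded)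
  ultimately show ?thesis
    using f m by (simp add: integral_eq_nn_integral enn2real_mono)
qed

lemma potential_nonneg: "0 \<le> potential \<mu> k"
  by (simp add: potential_def)

text \<open>For fixed \<open>x\<close>, the function \<open>max 0 (k - x)\<close> of
  \<open>k\<close> has the subgradient \<open>indicator {..k} x\<close>; its supporting line
  inequality is integrated.\<close>

lemma potential_subgradient:
  assumes \<mu>: "\<mu> \<in> finite_measures"
  shows "subgradient (potential \<mu>) (cdf \<mu>)"
  unfolding subgradient_def
proof (intro allI)
  fix a b
  have "potential \<mu> a + cdf \<mu> a * (b - a) = (\<integral>x. max 0 (a - x) + indicator {..a} x * (b - a) \<partial>\<mu>)"
    unfolding potential_def cdf_def
    using finite_measuresD(3)[OF \<mu>]
    by (subst Bochner_Integration.integral_add)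
       (auto intro!: integrable_finite_measures[OF \<mu>] integrable_mult_left)
  also have "\<dots> \<le> (\<integral>x. max 0 (b - x) \<partial>\<mu>)"
    by (intro integral_mono integrable_finite_measures[OF \<mu>] Bochner_Integration.integrable_add integrable_mult_left)
       (auto simp: indicator_def)
  finally show "potential \<mu> a + cdf \<mu> a * (b - a) \<le> potential \<mu> b" by (simp add: potential_def)
qed

lemma potential_mono: "\<mu> \<in> finite_measures \<Longrightarrow> a \<le> b \<Longrightarrow> potential \<mu> a \<le> potential \<mu> b"
  unfolding potential_def by (intro integral_mono integrable_finite_measures) auto

lemma potential_diff_le:
  assumes "\<mu> \<in> finite_measures" "a \<le> b"
  shows "potential \<mu> b - potential \<mu> a \<le> measure \<mu> UNIV * (b - a)"
proof -
  interpret finite_borel_measure \<mu> using finite_measuresD assms by auto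
  have "potential \<mu> b - potential \<mu> a \<le> cdf \<mu> b * (b - a)"
    by (rule subgradient_upper[OF potential_subgradient[OF assms(1)]])
  also have "\<dots> \<le> measure \<mu> UNIV * (b - a)"
    using assms cdf_bounded[of b] finite_measuresD(3)[OF assms(1)] by (intro mult_right_mono) auto
  finally show ?thesis .
qed

lemma potential_lipschitz:
  assumes "\<mu> \<in> finite_measures"
  shows "\<bar>potential \<mu> a - potential \<mu> b\<bar> \<le> measure \<mu> UNIV * \<bar>a - b\<bar>"
  using potential_mono[OF assms, of a b] potential_mono[OF assms, of b a]
    potential_diff_le[OF assms, of a b] potential_diff_le[OF assms, of b a]
  by (cases "a \<le> b") auto

text \<open>Put-call parity: \<open>max 0 (x - k) = max 0 (k - x) - (k - x)\<close>.\<close>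

lemma potential_reflect:
  assumes \<mu>: "\<mu> \<in> finite_measures"
  shows "(\<integral>x. max 0 (x - k) \<partial>\<mu>) = potential \<mu> k - (measure \<mu> UNIV * k - (\<integral>x. x \<partial>\<mu>))"
proof -
  have "(\<integral>x. max 0 (x - k) \<partial>\<mu>) = (\<integral>x. max 0 (k - x) - (k - x) \<partial>\<mu>)"
    by (intro Bochner_Integration.integral_cong) auto
  also have "\<dots> = potential \<mu> k - (\<integral>x. k - x \<partial>\<mu>)"
    unfolding potential_def
    by (intro Bochner_Integration.integral_diff integrable_finite_measures[OF \<mu>] Bochner_Integration.integrable_diff)
  also have "(\<integral>x. k - x \<partial>\<mu>) = measure \<mu> UNIV * k - (\<integral>x. x \<partial>\<mu>)"
    using finite_measuresD(3)[OF \<mu>]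
    by (subst Bochner_Integration.integral_diff) (auto intro!: integrable_finite_measures[OF \<mu>])
  finally show ?thesis .
qed

lemma potential_ge:
  assumes "\<mu> \<in> finite_measures"
  shows "measure \<mu> UNIV * k - (\<integral>x. x \<partial>\<mu>) \<le> potential \<mu> k"
proof -
  have "0 \<le> (\<integral>x. max 0 (x - k) \<partial>\<mu>)" by simp
  then show ?thesis using potential_reflect[OF assms, of k] by linarith
qed

lemma potential_tendsto_at_bot:
  assumes \<mu>: "\<mu> \<in> finite_measures"
  shows "(\<lambda>n. potential \<mu> (- real n)) \<longlonglongrightarrow> 0"
proof -
  have "(\<lambda>n. \<integral>x. max 0 (- real n - x) \<partial>\<mu>) \<longlonglongrightarrow> (\<integral>x. 0 \<partial>\<mu>)"
  proof (rule integral_dominated_convergence[where w = "\<lambda>x. \<bar>x\<bar>"])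
    show "AE x in \<mu>. (\<lambda>n. max 0 (- real n - x)) \<longlonglongrightarrow> 0"
    proof (rule AE_I2)
      fix x :: real
      obtain N :: nat where N: "- x \<le> real N" using real_arch_simple by blast
      have "\<forall>\<^sub>F n in sequentially. max 0 (- real n - x) = 0"
        using eventually_ge_at_top[of N] by eventually_elim (use N in auto)
      then show "(\<lambda>n. max 0 (- real n - x)) \<longlonglongrightarrow> 0" by (rule tendsto_eventually)
    qed
  qed (auto intro!: finite_measures_measurable[OF \<mu>] finite_measuresD(4)[OF \<mu>])
  then show ?thesis by (simp add: potential_def)
qed

text \<open>The affine asymptote on the right has the mass as slope and minus the mean as intercept,
  so both can be read off the potential.\<close>

lemma potential_tendsto_at_top:
  assumes \<mu>: "\<mu> \<in> finite_measures"
  shows "(\<lambda>n. potential \<mu> (real n) - (measure \<mu> UNIV * real n - (\<integral>x. x \<partial>\<mu>))) \<longlonglongrightarrow> 0"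
proof -
  have "(\<lambda>n. \<integral>x. max 0 (x - real n) \<partial>\<mu>) \<longlonglongrightarrow> (\<integral>x. 0 \<partial>\<mu>)"
  proof (rule integral_dominated_convergence[where w = "\<lambda>x. \<bar>x\<bar>"])
    show "AE x in \<mu>. (\<lambda>n. max 0 (x - real n)) \<longlonglongrightarrow> 0"
    proof (rule AE_I2)
      fix x :: real
      obtain N :: nat where N: "x \<le> real N" using real_arch_simple by blast
      have "\<forall>\<^sub>F n in sequentially. max 0 (x - real n) = 0"
        using eventually_ge_at_top[of N] by eventually_elim (use N in auto)
      then show "(\<lambda>n. max 0 (x - real n)) \<longlonglongrightarrow> 0" by (rule tendsto_eventually)
    qed
  qed (auto intro!: finite_measures_measurable[OF \<mu>] finite_measuresD(4)[OF \<mu>])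
  then show ?thesis by (simp add: potential_reflect[OF \<mu>])
qed

lemma potential_inject:
  assumes "\<mu> \<in> finite_measures" "\<nu> \<in> finite_measures" "potential \<mu> = potential \<nu>"
  shows "\<mu> = \<nu>"
proof (rule cdf_unique')
  have r: "(cdf \<mu> \<longlongrightarrow> cdf \<mu> a) (at_right a)" if "\<mu> \<in> finite_measures" for a \<mu>
    using finite_borel_measure.cdf_is_right_cont[OF finite_measuresD(5)[OF that]]
    by (simp add: continuous_within)
  show "cdf \<mu> = cdf \<nu>"
    by (rule subgradient_unique[OF potential_subgradient[OF assms(1)] _ r r])
       (use assms potential_subgradient[OF assms(2)] in auto)
qed (use assms finite_measuresD in auto)

text \<open>This is the potential of \<nu> - \<eta> without forming that measure: the defect \<psi>
  in the supporting line inequality is non-negative, so its integral is monotone in the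
  measure.\<close>

lemma convex_potential_diff:
  assumes \<nu>: "\<nu> \<in> finite_measures" and \<eta>: "\<eta> \<in> finite_measures" and le: "\<eta> \<le> \<nu>"
  shows "convex_on UNIV (\<lambda>k. potential \<nu> k - potential \<eta> k)"
proof (rule subgradient_imp_convex)
  show "subgradient (\<lambda>k. potential \<nu> k - potential \<eta> k) (\<lambda>k. cdf \<nu> k - cdf \<eta> k)"
    unfolding subgradient_def
  proof (intro allI)
    fix a b :: real
    define \<psi> where "\<psi> = (\<lambda>x::real. max 0 (b - x) - max 0 (a - x) - indicator {..a} x * (b - a))"
    have i: "integrable \<mu> \<psi>" if \<mu>: "\<mu> \<in> finite_measures" for \<mu> unfolding \<psi>_def
      by (intro Bochner_Integration.integrable_diff integrable_finite_measures[OF \<mu>] integrable_mult_left) auto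
    have e: "(\<integral>x. \<psi> x \<partial>\<mu>) = potential \<mu> b - potential \<mu> a - cdf \<mu> a * (b - a)"
      if \<mu>: "\<mu> \<in> finite_measures" for \<mu>
      unfolding \<psi>_def potential_def cdf_def using finite_measuresD(3)[OF \<mu>]
      by (subst Bochner_Integration.integral_diff, (intro Bochner_Integration.integrable_diff integrable_finite_measures[OF \<mu>] integrable_mult_left; simp)+)+ simp
    have "(\<integral>x. \<psi> x \<partial>\<eta>) \<le> (\<integral>x. \<psi> x \<partial>\<nu>)"
      by (rule integral_mono_finite_measures[OF \<nu> \<eta> le i[OF \<nu>]]) (auto simp: \<psi>_def indicator_def)
    then show "potential \<nu> a - potential \<eta> a + (cdf \<nu> a - cdf \<eta> a) * (b - a) \<le> potential \<nu> b - potential \<eta> b"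
      unfolding e[OF \<nu>] e[OF \<eta>] by (simp add: algebra_simps)
  qed
qed

section \<open>Measures with a prescribed potential\<close>

lemma measure_add_of_cdf_add:
  assumes M: "finite_borel_measure M" "finite_borel_measure N" "finite_borel_measure K"
    and cdf: "\<And>x. cdf K x = cdf M x + cdf N x"
    and A: "A \<in> sets borel"
  shows "measure K A = measure M A + measure N A"
proof -
  interpret M: finite_borel_measure M by fact
  interpret N: finite_borel_measure N by fact
  interpret K: finite_borel_measure K by fact
  have top: "measure K UNIV = measure M UNIV + measure N UNIV"
  proof (rule LIMSEQ_unique[OF K.cdf_lim_infty[unfolded K.borel_UNIV]])
    show "(\<lambda>i. cdf K (real i)) \<longlonglongrightarrow> measure M UNIV + measure N UNIV"
      unfolding cdf using tendsto_add[OF M.cdf_lim_infty N.cdf_lim_infty]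
      by (simp add: M.borel_UNIV N.borel_UNIV)
  qed
  have "Int_stable (range atMost :: real set set)" by (auto simp: Int_stable_def)
  moreover have "(range atMost :: real set set) \<subseteq> Pow UNIV" by simp
  moreover have "A \<in> sigma_sets UNIV (range atMost)" using A by (simp add: borel_eq_atMost)
  ultimately show ?thesis
  proof (induct rule: sigma_sets_induct_disjoint)
    show "measure K A = measure M A + measure N A" if "A \<in> range atMost" for A
      using that cdf by (auto simp: cdf_def)
  next
    fix A :: "real set" assume "A \<in> sigma_sets UNIV (range atMost)"
    then have A: "A \<in> sets borel" by (simp add: borel_eq_atMost)
    assume "measure K A = measure M A + measure N A"
    moreover have "measure M (UNIV - A) = measure M UNIV - measure M A"
      using M.finite_measure_compl[of A] A by (simp add: M.borel_UNIV M.sets_M)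
    moreover have "measure N (UNIV - A) = measure N UNIV - measure N A"
      using N.finite_measure_compl[of A] A by (simp add: N.borel_UNIV N.sets_M)
    moreover have "measure K (UNIV - A) = measure K UNIV - measure K A"
      using K.finite_measure_compl[of A] A by (simp add: K.borel_UNIV K.sets_M)
    ultimately show "measure K (UNIV - A) = measure M (UNIV - A) + measure N (UNIV - A)"
      using top by simp
  next
    fix A :: "nat \<Rightarrow> real set"
    assume dis: "disjoint_family A" and A: "range A \<subseteq> sigma_sets UNIV (range atMost)"
      and eq: "\<And>i. measure K (A i) = measure M (A i) + measure N (A i)"
    have A: "range A \<subseteq> sets borel" using A by (simp add: borel_eq_atMost)
    have "(\<lambda>i. measure M (A i) + measure N (A i)) sums (measure M (\<Union>i. A i) + measure N (\<Union>i. A i))"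
      using A by (intro sums_add M.finite_measure_UNION N.finite_measure_UNION dis) (auto simp: M.M_is_borel N.M_is_borel)
    moreover have "(\<lambda>i. measure K (A i)) sums measure K (\<Union>i. A i)"
      using A by (intro K.finite_measure_UNION dis) (auto simp: K.M_is_borel)
    ultimately show "measure K (\<Union>i. A i) = measure M (\<Union>i. A i) + measure N (\<Union>i. A i)"
      unfolding eq by (rule sums_unique2[symmetric])
  qed auto
qed

text \<open>The majorant \<open>G\<close>, a cdf in the applications, makes \<open>F\<close> vanish
  at \<open>-\<infinity>\<close> and keeps it bounded at \<open>+\<infinity>\<close>.\<close>

lemma cdf_of_subgradient:
  assumes sub: "subgradient f F" and r: "\<And>a. (F \<longlongrightarrow> F a) (at_right a)"
    and F: "\<And>a. 0 \<le> F a" "\<And>a. F a \<le> G a" and G: "(G \<longlongrightarrow> 0) at_bot" "\<And>a. G a \<le> B"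
  shows "finite_borel_measure (interval_measure F)" "cdf (interval_measure F) = F"
proof -
  note m = monoD[OF subgradient_mono[OF sub]]
  have c: "continuous (at_right a) F" for a using r by (simp add: continuous_within)
  have bot: "(F \<longlongrightarrow> 0) at_bot"
    by (rule tendsto_sandwich[OF _ _ tendsto_const G(1)]) (use F in auto)
  have "incseq (\<lambda>n. F (real n))" by (auto simp: incseq_def m)
  moreover have "F (real n) \<le> B" for n using F(2) G(2) order_trans by blast
  ultimately obtain l where "(\<lambda>n. F (real n)) \<longlonglongrightarrow> l" using incseq_convergent[of _ B] by metis
  then have top: "(F \<longlongrightarrow> l) at_top" by (intro tendsto_at_topI_sequentially_real subgradient_mono[OF sub])
  have "l \<ge> 0" by (rule tendsto_lowerbound[OF top]) (use F in auto)
  then show "finite_borel_measure (interval_measure F)"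
    by (intro finite_borel_measure_interval_measure[OF m c bot top])
  show "cdf (interval_measure F) = F" by (rule cdf_interval_measure[OF m c bot])
qed

text \<open>Converse to \<open>convex_potential_diff\<close>: the right derivatives of the two
  convex parts add up to \<open>cdf \<nu>\<close>, and each is itself a cdf. The complementary
  measure \<theta> is constructed too, since additivity on all Borel sets is what gives
  \<open>\<eta> \<le> \<nu>\<close>.\<close>

lemma exists_measure_of_potential:
  assumes \<nu>: "\<nu> \<in> finite_measures" and h: "convex_on UNIV h" "convex_on UNIV (\<lambda>k. potential \<nu> k - h k)"
    and bounds: "\<And>k. 0 \<le> h k" "\<And>k. h k \<le> potential \<nu> k"
  obtains \<eta> where "\<eta> \<in> finite_measures" "\<eta> \<le> \<nu>" "potential \<eta> = (\<lambda>k. potential \<nu> k - h k)"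
proof -
  interpret \<nu>: finite_borel_measure \<nu> using finite_measuresD[OF \<nu>] by auto
  define p where "p = (\<lambda>k. potential \<nu> k - h k)"
  obtain F where F: "subgradient h F" "\<And>a. (F \<longlongrightarrow> F a) (at_right a)"
    using convex_imp_subgradient[OF h(1)] by metis
  obtain P where P: "subgradient p P" "\<And>a. (P \<longlongrightarrow> P a) (at_right a)"
    using convex_imp_subgradient[OF h(2)] unfolding p_def by metis
  have r: "(cdf \<nu> \<longlongrightarrow> cdf \<nu> a) (at_right a)" for a
    using \<nu>.cdf_is_right_cont by (simp add: continuous_within)
  have "(\<lambda>k. P k + F k) = cdf \<nu>"
  proof (rule subgradient_unique[OF _ potential_subgradient[OF \<nu>]])
    show "subgradient (potential \<nu>) (\<lambda>k. P k + F k)"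
      using subgradient_add[OF P(1) F(1)] by (simp add: p_def)
  qed (intro tendsto_intros P F r)+
  then have PF: "cdf \<nu> k = P k + F k" for k by metis
  have nonneg: "0 \<le> F a" if f: "subgradient f F" "\<And>k. 0 \<le> f k" "\<And>k. f k \<le> potential \<nu> k" for f F and a :: real
  proof (rule ccontr)
    assume neg: "\<not> ?thesis"
    \<comment> \<open>With a negative slope at \<open>a\<close>, the supporting line followed to the
      left reaches \<open>potential \<nu> a + 1\<close> or more at \<open>t\<close>, whereas
      \<open>f t\<close> is bounded by the increasing function
      \<open>potential \<nu>\<close>.\<close>
    define t where "t = a - (potential \<nu> a + 1) / (- F a)"
    have "(potential \<nu> a + 1) / (- F a) \<ge> 0" using neg potential_nonneg[of \<nu> a] by (intro divide_nonneg_pos) auto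
    then have "t \<le> a" by (simp add: t_def)
    then have "f t \<le> potential \<nu> a" using potential_mono[OF \<nu>] f(3) order_trans by blast
    moreover have "F a * (t - a) = potential \<nu> a + 1" using neg by (simp add: t_def field_simps)
    ultimately show False using subgradientD[OF f(1), of a t] f(2)[of a] by linarith
  qed
  have F0: "0 \<le> F a" for a by (rule nonneg[OF F(1) bounds])
  have P0: "0 \<le> P a" for a
    by (rule nonneg[OF P(1)]) (use bounds in \<open>auto simp: p_def\<close>)
  define \<eta> where "\<eta> = interval_measure P"
  define \<theta> where "\<theta> = interval_measure F"
  have \<eta>: "finite_borel_measure \<eta>" "cdf \<eta> = P"
    unfolding \<eta>_def using cdf_of_subgradient[OF P P0 _ \<nu>.cdf_lim_at_bot \<nu>.cdf_bounded] F0 PF by simp_all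
  have \<theta>: "finite_borel_measure \<theta>" "cdf \<theta> = F"
    unfolding \<theta>_def using cdf_of_subgradient[OF F F0 _ \<nu>.cdf_lim_at_bot \<nu>.cdf_bounded] P0 PF by simp_all
  have add: "measure \<nu> A = measure \<eta> A + measure \<theta> A" if "A \<in> sets borel" for A
    by (rule measure_add_of_cdf_add[OF \<eta>(1) \<theta>(1) \<nu>.finite_borel_measure_axioms _ that]) (simp add: \<eta> \<theta> PF)
  have s: "sets \<eta> = sets borel" using \<eta>(1) finite_borel_measure.M_is_borel by blast
  have le: "\<eta> \<le> \<nu>"
  proof (subst le_measure)
    show "\<forall>A\<in>sets \<eta>. emeasure \<eta> A \<le> emeasure \<nu> A"
      using \<eta>(1) add s
      by (auto simp: \<nu>.emeasure_eq_measure finite_measure.emeasure_eq_measure finite_borel_measure_def)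
  qed (simp add: s \<nu>.M_is_borel)
  have fm: "\<eta> \<in> finite_measures" by (rule finite_measures_mono[OF \<nu> s le])
  \<comment> \<open>A common subgradient determines the two functions up to a constant, and both
    tend to \<open>0\<close> at \<open>-\<infinity>\<close>.\<close>
  have "potential \<eta> k = p k" for k
  proof -
    have "subgradient (potential \<eta>) P" using potential_subgradient[OF fm] \<eta>(2) by simp
    then have const: "potential \<eta> k - p k = potential \<eta> a - p a" for a
      by (rule subgradient_diff_eq[OF _ P(1)])
    have "(\<lambda>n. potential \<eta> (- real n) - p (- real n)) \<longlonglongrightarrow> 0 - 0"
    proof (intro tendsto_diff potential_tendsto_at_bot[OF fm])
      show "(\<lambda>n. p (- real n)) \<longlonglongrightarrow> 0"
        by (rule tendsto_sandwich[OF _ _ tendsto_const potential_tendsto_at_bot[OF \<nu>]])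
           (use bounds in \<open>auto simp: p_def\<close>)
    qed
    moreover have "(\<lambda>n. potential \<eta> (- real n) - p (- real n)) = (\<lambda>_. potential \<eta> k - p k)"
      by (rule ext, rule const[symmetric])
    ultimately show ?thesis by (simp add: tendsto_const_iff)
  qed
  then show ?thesis using fm le that[of \<eta>] by (auto simp: p_def)
qed

section \<open>Convex order and shadows\<close>

lemma bigo_linear_growth:
  fixes f :: "real \<Rightarrow> real"
  assumes "\<And>x. \<bar>f x\<bar> \<le> A + B * \<bar>x\<bar>"
  shows "f \<in> O[at_infinity](\<lambda>x. x)"
proof (rule bigoI[where c = "\<bar>A\<bar> + \<bar>B\<bar>"])
  have "\<bar>f x\<bar> \<le> (\<bar>A\<bar> + \<bar>B\<bar>) * \<bar>x\<bar>" if "1 \<le> \<bar>x\<bar>" for x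
  proof -
    have "A \<le> \<bar>A\<bar> * \<bar>x\<bar>" using that mult_left_mono[of 1 "\<bar>x\<bar>" "\<bar>A\<bar>"] by simp
    moreover have "B * \<bar>x\<bar> \<le> \<bar>B\<bar> * \<bar>x\<bar>" by (intro mult_right_mono) auto
    ultimately show ?thesis using assms[of x] by (simp add: algebra_simps)
  qed
  then show "\<forall>\<^sub>F x in at_infinity. norm (f x) \<le> (\<bar>A\<bar> + \<bar>B\<bar>) * norm x"
    by (auto simp: eventually_at_infinity)
qed

text \<open>A slope outside \<open>[-c, c]\<close>, with \<open>c\<close> the growth constant, would
  let a supporting line outgrow \<open>c * \<bar>x\<bar>\<close> on one side.\<close>

lemma convex_linear_growth_lipschitz:
  fixes f :: "real \<Rightarrow> real"
  assumes f: "convex_on UNIV f" "f \<in> O[at_infinity](\<lambda>x. x)"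
  obtains L where "\<And>a b. \<bar>f a - f b\<bar> \<le> L * \<bar>a - b\<bar>"
proof -
  obtain c where c: "c > 0" "\<forall>\<^sub>F x in at_infinity. norm (f x) \<le> c * norm x"
    using landau_o.bigE[OF f(2)] by blast
  then obtain R where R: "\<And>x. R \<le> \<bar>x\<bar> \<Longrightarrow> \<bar>f x\<bar> \<le> c * \<bar>x\<bar>"
    by (auto simp: eventually_at_infinity)
  obtain s where s: "subgradient f s" using convex_imp_subgradient[OF f(1)] by blast
  have up: "s a \<le> c" for a
  proof (rule ccontr)
    assume neg: "\<not> ?thesis"
    define t where "t = max \<bar>R\<bar> ((s a * a - f a + 1) / (s a - c))"
    have "t \<ge> (s a * a - f a + 1) / (s a - c)" by (simp add: t_def)
    then have "(s a - c) * t \<ge> s a * a - f a + 1" using neg by (simp add: field_simps)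
    moreover have "t \<ge> \<bar>R\<bar>" by (simp add: t_def)
    then have "f t \<le> c * t" using R[of t] by (auto dest: abs_le_D1)
    ultimately show False using subgradientD[OF s, of a t] by (simp add: algebra_simps)
  qed
  have lo: "- c \<le> s a" for a
  proof (rule ccontr)
    assume neg: "\<not> ?thesis"
    define t where "t = max \<bar>R\<bar> ((s a * a - f a + 1) / (- s a - c))"
    have "t \<ge> (s a * a - f a + 1) / (- s a - c)" by (simp add: t_def)
    then have "(- s a - c) * t \<ge> s a * a - f a + 1" using neg by (simp add: field_simps)
    moreover have "t \<ge> \<bar>R\<bar>" by (simp add: t_def)
    then have "f (- t) \<le> c * t" using R[of "-t"] by (auto dest: abs_le_D1)
    ultimately show False using subgradientD[OF s, of a "-t"] by (simp add: algebra_simps)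
  qed
  have "f a - f b \<le> c * \<bar>a - b\<bar>" for a b
  proof -
    have "f a - f b \<le> s a * (a - b)" by (rule subgradient_upper[OF s])
    also have "\<dots> \<le> \<bar>s a\<bar> * \<bar>a - b\<bar>" by (metis abs_ge_self abs_mult)
    also have "\<dots> \<le> c * \<bar>a - b\<bar>" using up lo by (intro mult_right_mono) (auto simp: abs_le_iff minus_le_iff)
    finally show ?thesis .
  qed
  then have "\<bar>f a - f b\<bar> \<le> c * \<bar>a - b\<bar>" for a b
    by (metis abs_le_iff abs_minus_commute minus_diff_eq)
  then show ?thesis by (rule that)
qed

section \<open>Piecewise affine interpolation on a grid\<close>

context
  fixes \<phi> :: "real \<Rightarrow> real" and L \<delta> a :: real
  assumes lip: "\<And>a b. \<bar>\<phi> a - \<phi> b\<bar> \<le> L * \<bar>a - b\<bar>" and \<delta>: "\<delta> > 0"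
begin

definition grid_point :: "nat \<Rightarrow> real" where
  "grid_point i = a + real i * \<delta>"

definition grid_slope :: "nat \<Rightarrow> real" where
  "grid_slope i = (\<phi> (grid_point (Suc i)) - \<phi> (grid_point i)) / \<delta>"

text \<open>Written as a sum over kinks rather than cell by cell, so that its integral depends only
  on mass, mean and integrals of \<open>max 0 (x - k)\<close>. The coefficients are second
  differences of \<phi>, non-negative if \<phi> is convex.\<close>

definition interpolant :: "nat \<Rightarrow> real \<Rightarrow> real" where
  "interpolant m x = \<phi> a + grid_slope 0 * (x - a)
    + (\<Sum>i<m. (grid_slope (Suc i) - grid_slope i) * max 0 (x - grid_point (Suc i)))"

lemma grid_point_Suc: "grid_point (Suc i) = grid_point i + \<delta>"
  by (simp add: grid_point_def algebra_simps)

lemma grid_point_ge: "a \<le> grid_point i"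
  using \<delta> by (simp add: grid_point_def)

lemma abs_grid_slope_le: "\<bar>grid_slope i\<bar> \<le> L"
  using lip[of "grid_point (Suc i)" "grid_point i"] \<delta>
  by (simp add: grid_slope_def grid_point_Suc abs_divide field_simps)

lemma interpolant_left: "x \<le> a \<Longrightarrow> interpolant m x = \<phi> a + grid_slope 0 * (x - a)"
proof -
  assume x: "x \<le> a"
  have "max 0 (x - grid_point i) = 0" for i using x grid_point_ge[of i] by (simp add: max_def)
  then show ?thesis by (simp add: interpolant_def)
qed

lemma interpolant_right:
  "grid_point m \<le> x \<Longrightarrow> interpolant m x = \<phi> (grid_point m) + grid_slope m * (x - grid_point m)"
proof (induction m)
  case 0
  then show ?case by (simp add: interpolant_def grid_point_def)
next
  case (Suc m)
  have le: "grid_point m \<le> grid_point (Suc m)" using \<delta> by (simp add: grid_point_Suc)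
  have "interpolant (Suc m) x = interpolant m x + (grid_slope (Suc m) - grid_slope m) * (x - grid_point (Suc m))"
    using Suc.prems by (simp add: interpolant_def max_def)
  also have "\<dots> = \<phi> (grid_point m) + grid_slope m * (x - grid_point m) + (grid_slope (Suc m) - grid_slope m) * (x - grid_point (Suc m))"
    using Suc.IH Suc.prems le by simp
  also have "\<dots> = \<phi> (grid_point m) + grid_slope m * (grid_point (Suc m) - grid_point m) + grid_slope (Suc m) * (x - grid_point (Suc m))"
    by (simp add: algebra_simps)
  also have "\<phi> (grid_point m) + grid_slope m * (grid_point (Suc m) - grid_point m) = \<phi> (grid_point (Suc m))"
    unfolding grid_slope_def using \<delta> by (simp add: grid_point_Suc)
  finally show ?case .
qed

lemma affine_error:
  assumes "\<bar>s\<bar> \<le> L"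
  shows "\<bar>\<phi> p + s * (x - p) - \<phi> x\<bar> \<le> 2 * L * \<bar>x - p\<bar>"
proof -
  have "\<bar>s * (x - p)\<bar> \<le> L * \<bar>x - p\<bar>" unfolding abs_mult by (intro mult_right_mono assms) auto
  then show ?thesis using lip[of p x] by (simp add: abs_minus_commute)
qed

lemma interpolant_error:
  "a \<le> x \<Longrightarrow> x \<le> grid_point (Suc m) \<Longrightarrow> \<bar>interpolant m x - \<phi> x\<bar> \<le> 2 * L * \<delta>"
proof (induction m)
  have L: "L \<ge> 0" using order_trans[OF abs_ge_zero lip[of 0 1]] by simp
  case 0
  have "\<bar>interpolant 0 x - \<phi> x\<bar> \<le> 2 * L * \<bar>x - a\<bar>"
    using affine_error[OF abs_grid_slope_le[of 0], of a x] by (simp add: interpolant_def)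
  also have "\<dots> \<le> 2 * L * \<delta>" using 0 L by (intro mult_left_mono) (auto simp: grid_point_def)
  finally show ?case .
next
  have L: "L \<ge> 0" using order_trans[OF abs_ge_zero lip[of 0 1]] by simp
  case (Suc m)
  show ?case
  proof (cases "x \<le> grid_point (Suc m)")
    case True
    then have "interpolant (Suc m) x = interpolant m x" by (simp add: interpolant_def max_def)
    then show ?thesis using Suc.IH[OF Suc.prems(1) True] by simp
  next
    case False
    have "\<bar>interpolant (Suc m) x - \<phi> x\<bar> \<le> 2 * L * \<bar>x - grid_point (Suc m)\<bar>"
      using False affine_error[OF abs_grid_slope_le[of "Suc m"], of "grid_point (Suc m)" x]
      by (subst interpolant_right) auto
    also have "\<dots> \<le> 2 * L * \<delta>"
      using False Suc.prems L by (intro mult_left_mono) (auto simp: grid_point_Suc[of "Suc m"])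
    finally show ?thesis .
  qed
qed

lemma interpolant_error_global:
  "\<bar>interpolant m x - \<phi> x\<bar> \<le> 2 * L * (\<delta> + max 0 (a - x) + max 0 (x - grid_point m))"
proof -
  have L: "L \<ge> 0" using order_trans[OF abs_ge_zero lip[of 0 1]] by simp
  have mono: "2 * L * t \<le> 2 * L * (\<delta> + max 0 (a - x) + max 0 (x - grid_point m))"
    if "t \<le> \<delta> + max 0 (a - x) + max 0 (x - grid_point m)" for t
    using that L by (intro mult_left_mono) auto
  consider "x \<le> a" | "a \<le> x" "x \<le> grid_point m" | "grid_point m \<le> x" by linarith
  then show ?thesis
  proof cases
    case 1
    then have "\<bar>interpolant m x - \<phi> x\<bar> \<le> 2 * L * \<bar>x - a\<bar>"
      using affine_error[OF abs_grid_slope_le[of 0], of a x] by (simp add: interpolant_left)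
    also have "\<dots> \<le> 2 * L * (\<delta> + max 0 (a - x) + max 0 (x - grid_point m))"
      using 1 \<delta> by (intro mono) auto
    finally show ?thesis .
  next
    case 2
    then have "\<bar>interpolant m x - \<phi> x\<bar> \<le> 2 * L * \<delta>"
      using \<delta> by (intro interpolant_error) (auto simp: grid_point_Suc)
    also have "\<dots> \<le> 2 * L * (\<delta> + max 0 (a - x) + max 0 (x - grid_point m))" by (intro mono) auto
    finally show ?thesis .
  next
    case 3
    then have "\<bar>interpolant m x - \<phi> x\<bar> \<le> 2 * L * \<bar>x - grid_point m\<bar>"
      using affine_error[OF abs_grid_slope_le[of m], of "grid_point m" x] by (simp add: interpolant_right)
    also have "\<dots> \<le> 2 * L * (\<delta> + max 0 (a - x) + max 0 (x - grid_point m))"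
      using 3 \<delta> by (intro mono) auto
    finally show ?thesis .
  qed
qed

lemma grid_slope_mono:
  assumes "convex_on UNIV \<phi>"
  shows "grid_slope i \<le> grid_slope (Suc i)"
proof -
  obtain s where s: "subgradient \<phi> s" using convex_imp_subgradient[OF assms] by blast
  have "2 * \<phi> (grid_point (Suc i)) \<le> \<phi> (grid_point i) + \<phi> (grid_point (Suc (Suc i)))"
    using subgradientD[OF s, of "grid_point (Suc i)" "grid_point i"]
      subgradientD[OF s, of "grid_point (Suc i)" "grid_point (Suc (Suc i))"]
    by (simp add: grid_point_Suc algebra_simps)
  then show ?thesis using \<delta> by (simp add: grid_slope_def divide_right_mono)
qed

lemma integral_interpolant_mono:
  assumes \<phi>: "convex_on UNIV \<phi>" and \<mu>: "\<mu> \<in> finite_measures" and \<eta>: "\<eta> \<in> finite_measures"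
    and le: "\<And>k. potential \<mu> k \<le> potential \<eta> k" and mass: "measure \<mu> UNIV = measure \<eta> UNIV"
    and mean: "(\<integral>x. x \<partial>\<mu>) = (\<integral>x. x \<partial>\<eta>)"
  shows "(\<integral>x. interpolant m x \<partial>\<mu>) \<le> (\<integral>x. interpolant m x \<partial>\<eta>)"
proof -
  have eq: "(\<integral>x. interpolant m x \<partial>\<mu>) = measure \<mu> UNIV * (\<phi> a - grid_slope 0 * a) + grid_slope 0 * (\<integral>x. x \<partial>\<mu>)
      + (\<Sum>i<m. (grid_slope (Suc i) - grid_slope i) * (\<integral>x. max 0 (x - grid_point (Suc i)) \<partial>\<mu>))"
    if \<mu>: "\<mu> \<in> finite_measures" for \<mu>
  proof -
    have "(\<integral>x. interpolant m x \<partial>\<mu>) = (\<integral>x. (\<phi> a - grid_slope 0 * a) + grid_slope 0 * x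
      + (\<Sum>i<m. (grid_slope (Suc i) - grid_slope i) * max 0 (x - grid_point (Suc i))) \<partial>\<mu>)"
      by (simp add: interpolant_def algebra_simps)
    also have "\<dots> = (\<integral>x. (\<phi> a - grid_slope 0 * a) + grid_slope 0 * x \<partial>\<mu>)
      + (\<integral>x. (\<Sum>i<m. (grid_slope (Suc i) - grid_slope i) * max 0 (x - grid_point (Suc i))) \<partial>\<mu>)"
      by (intro Bochner_Integration.integral_add Bochner_Integration.integrable_add
          Bochner_Integration.integrable_sum integrable_mult_right integrable_finite_measures[OF \<mu>])
    also have "(\<integral>x. (\<phi> a - grid_slope 0 * a) + grid_slope 0 * x \<partial>\<mu>)
        = measure \<mu> UNIV * (\<phi> a - grid_slope 0 * a) + grid_slope 0 * (\<integral>x. x \<partial>\<mu>)"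
      by (subst Bochner_Integration.integral_add)
         (auto intro!: integrable_mult_right integrable_finite_measures[OF \<mu>] simp: finite_measuresD[OF \<mu>])
    also have "(\<integral>x. (\<Sum>i<m. (grid_slope (Suc i) - grid_slope i) * max 0 (x - grid_point (Suc i))) \<partial>\<mu>)
        = (\<Sum>i<m. (grid_slope (Suc i) - grid_slope i) * (\<integral>x. max 0 (x - grid_point (Suc i)) \<partial>\<mu>))"
      by (subst Bochner_Integration.integral_sum)
         (auto intro!: integrable_mult_right integrable_finite_measures[OF \<mu>])
    finally show ?thesis .
  qed
  show ?thesis
    unfolding eq[OF \<mu>] eq[OF \<eta>] mass mean
    using le mass mean grid_slope_mono[OF \<phi>]
    by (intro add_left_mono sum_mono mult_left_mono) (auto simp: potential_reflect[OF \<mu>] potential_reflect[OF \<eta>])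
qed

lemma interpolant_measurable: "interpolant m \<in> borel_measurable borel"
  unfolding interpolant_def[abs_def] by measurable

end

text \<open>The window is \<open>[-n, n]\<close> with mesh \<open>1 / (n + 1)\<close>, hence
  \<open>2 * n * Suc n\<close> cells; the mesh shrinks while the window exhausts the line.\<close>

lemma interpolant_tendsto:
  assumes lip: "\<And>a b. \<bar>\<phi> a - \<phi> b\<bar> \<le> L * \<bar>a - b\<bar>" and \<mu>: "\<mu> \<in> finite_measures"
  shows "(\<lambda>n. \<integral>x. interpolant \<phi> (inverse (real (Suc n))) (- real n) (2 * n * Suc n) x \<partial>\<mu>)
    \<longlonglongrightarrow> (\<integral>x. \<phi> x \<partial>\<mu>)"
proof -
  define \<psi> where "\<psi> = (\<lambda>n x. interpolant \<phi> (inverse (real (Suc n))) (- real n) (2 * n * Suc n) x)"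
  have L: "L \<ge> 0" using order_trans[OF abs_ge_zero lip[of 0 1]] by simp
  have err: "\<bar>\<psi> n x - \<phi> x\<bar> \<le> 2 * L * (inverse (real (Suc n)) + max 0 (\<bar>x\<bar> - real n))" for n x
  proof -
    have "real (2 * n * Suc n) = 2 * real n * real (Suc n)" by (simp only: of_nat_mult of_nat_numeral)
    then have "real (2 * n * Suc n) * inverse (real (Suc n)) = 2 * real n" by (simp del: of_nat_Suc of_nat_mult)
    then have "grid_point (inverse (real (Suc n))) (- real n) (2 * n * Suc n) = real n"
      by (subst grid_point_def[OF lip]) (simp_all del: of_nat_Suc of_nat_mult)
    then have "\<bar>\<psi> n x - \<phi> x\<bar> \<le> 2 * L * (inverse (real (Suc n)) + max 0 (- real n - x) + max 0 (x - real n))"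
      using interpolant_error_global[OF lip, of "inverse (real (Suc n))" "- real n" "2 * n * Suc n" x]
      by (simp add: \<psi>_def del: of_nat_Suc)
    also have "\<dots> \<le> 2 * L * (inverse (real (Suc n)) + max 0 (\<bar>x\<bar> - real n))"
      using L by (intro mult_left_mono) auto
    finally show ?thesis .
  qed
  have cont: "continuous_on UNIV \<phi>"
    by (rule lipschitz_on_continuous_on[of L]) (use lip L in \<open>auto simp: lipschitz_on_def dist_real_def\<close>)
  have m\<phi>: "\<phi> \<in> borel_measurable borel" by (rule borel_measurable_continuous_onI[OF cont])
  have "(\<lambda>n. \<integral>x. \<psi> n x \<partial>\<mu>) \<longlonglongrightarrow> (\<integral>x. \<phi> x \<partial>\<mu>)"
  proof (rule integral_dominated_convergence[where w = "\<lambda>x. \<bar>\<phi> 0\<bar> + 2 * L + 3 * L * \<bar>x\<bar>"])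
    show "\<phi> \<in> borel_measurable \<mu>" by (rule finite_measures_measurable[OF \<mu> m\<phi>])
    show "\<psi> n \<in> borel_measurable \<mu>" for n
      unfolding \<psi>_def by (rule finite_measures_measurable[OF \<mu> interpolant_measurable[OF lip]]) simp
    show "integrable \<mu> (\<lambda>x. \<bar>\<phi> 0\<bar> + 2 * L + 3 * L * \<bar>x\<bar>)"
      using finite_measuresD(4)[OF \<mu>]
      by (intro Bochner_Integration.integrable_add integrable_mult_right integrable_finite_measures[OF \<mu>])
    \<comment> \<open>The interpolation error is at most \<open>2 * L * (1 + \<bar>x\<bar>)\<close>,
      and \<phi> itself is at most \<open>\<bar>\<phi> 0\<bar> + L * \<bar>x\<bar>\<close>.\<close>
    show "AE x in \<mu>. norm (\<psi> n x) \<le> \<bar>\<phi> 0\<bar> + 2 * L + 3 * L * \<bar>x\<bar>" for n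
    proof (rule AE_I2)
      fix x
      have "inverse (real (Suc n)) + max 0 (\<bar>x\<bar> - real n) \<le> 1 + \<bar>x\<bar>"
        by (intro add_mono) (auto simp: field_simps)
      then have "2 * L * (inverse (real (Suc n)) + max 0 (\<bar>x\<bar> - real n)) \<le> 2 * L * (1 + \<bar>x\<bar>)"
        using L by (intro mult_left_mono) auto
      then show "norm (\<psi> n x) \<le> \<bar>\<phi> 0\<bar> + 2 * L + 3 * L * \<bar>x\<bar>"
        using err[of n x] lip[of x 0] unfolding real_norm_def
        by (simp only: distrib_left diff_0_right mult.assoc) linarith
    qed
    show "AE x in \<mu>. (\<lambda>n. \<psi> n x) \<longlonglongrightarrow> \<phi> x"
    proof (rule AE_I2)
      fix x
      obtain N :: nat where N: "\<bar>x\<bar> \<le> real N" using real_arch_simple by blast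
      show "(\<lambda>n. \<psi> n x) \<longlonglongrightarrow> \<phi> x"
      proof (rule LIM_zero_cancel, rule Lim_null_comparison)
        show "(\<lambda>n. 2 * L * inverse (real (Suc n))) \<longlonglongrightarrow> 0"
          by (rule tendsto_mult_right_zero) (rule LIMSEQ_inverse_real_of_nat)
        show "\<forall>\<^sub>F n in sequentially. norm (\<psi> n x - \<phi> x) \<le> 2 * L * inverse (real (Suc n))"
          using eventually_ge_at_top[of N]
        proof eventually_elim
          case (elim n)
          then have "max 0 (\<bar>x\<bar> - real n) = 0" using N by simp
          then show ?case using err[of n x] by (simp del: of_nat_Suc)
        qed
      qed
    qed
  qed
  then show ?thesis by (simp add: \<psi>_def)
qed

text \<open>A convex function of linear growth is a limit of interpolants, whose integrals are
  monotone under the conditions on the right. Conversely \<open>max 0 (k - x)\<close>,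
  \<open>x\<close>, \<open>- x\<close> and the constants \<open>1\<close> and \<open>-1\<close> are
  admissible test functions.\<close>

lemma convex_order_iff:
  assumes \<mu>: "\<mu> \<in> finite_measures" and \<eta>: "\<eta> \<in> finite_measures"
  shows "\<mu> \<preceq>\<^sub>C \<eta> \<longleftrightarrow> (\<forall>k. potential \<mu> k \<le> potential \<eta> k) \<and> measure \<mu> UNIV = measure \<eta> UNIV
    \<and> (\<integral>x. x \<partial>\<mu>) = (\<integral>x. x \<partial>\<eta>)" (is "_ \<longleftrightarrow> ?R")
proof
  assume R: ?R
  show "\<mu> \<preceq>\<^sub>C \<eta>"
    unfolding convex_order_def
  proof (intro allI impI)
    fix \<phi> :: "real \<Rightarrow> real"
    assume \<phi>: "convex_on UNIV \<phi> \<and> \<phi> \<in> O[at_infinity](\<lambda>x. x)"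
    obtain L where L: "\<And>a b. \<bar>\<phi> a - \<phi> b\<bar> \<le> L * \<bar>a - b\<bar>"
      using convex_linear_growth_lipschitz \<phi> by metis
    show "(\<integral>x. \<phi> x \<partial>\<mu>) \<le> (\<integral>x. \<phi> x \<partial>\<eta>)"
    proof (rule LIMSEQ_le[OF interpolant_tendsto[OF L \<mu>] interpolant_tendsto[OF L \<eta>]], intro exI allI impI)
      fix n
      show "(\<integral>x. interpolant \<phi> (inverse (real (Suc n))) (- real n) (2 * n * Suc n) x \<partial>\<mu>)
        \<le> (\<integral>x. interpolant \<phi> (inverse (real (Suc n))) (- real n) (2 * n * Suc n) x \<partial>\<eta>)"
        using R \<phi> by (intro integral_interpolant_mono[OF L _ _ \<mu> \<eta>]) auto
    qed
  qed
next
  assume "\<mu> \<preceq>\<^sub>C \<eta>"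
  then have le: "(\<integral>x. \<phi> x \<partial>\<mu>) \<le> (\<integral>x. \<phi> x \<partial>\<eta>)"
    if "subgradient \<phi> s" "\<And>x. \<bar>\<phi> x\<bar> \<le> A + B * \<bar>x\<bar>" for \<phi> s A B
    using subgradient_imp_convex[OF that(1)] bigo_linear_growth[OF that(2)] by (auto simp: convex_order_def)
  have "potential \<mu> k \<le> potential \<eta> k" for k
    unfolding potential_def
    by (rule le[where s = "\<lambda>x. if x < k then - 1 else 0" and A = "\<bar>k\<bar>" and B = 1]) (auto simp: subgradient_def max_def)
  moreover have "(\<integral>x. c * x + d \<partial>\<mu>) \<le> (\<integral>x. c * x + d \<partial>\<eta>)" for c d :: real
  proof (rule le[where s = "\<lambda>x. c" and A = "\<bar>d\<bar>" and B = "\<bar>c\<bar>"])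
    show "\<bar>c * x + d\<bar> \<le> \<bar>d\<bar> + \<bar>c\<bar> * \<bar>x\<bar>" for x
      using abs_triangle_ineq[of "c * x" d] by (simp add: abs_mult)
  qed (auto simp: subgradient_def algebra_simps)
  from this[of 1 0] this[of "-1" 0] this[of 0 1] this[of 0 "-1"]
  have "(\<integral>x. x \<partial>\<mu>) = (\<integral>x. x \<partial>\<eta>)" "measure \<mu> UNIV = measure \<eta> UNIV"
    by (auto simp: finite_measuresD[OF \<mu>] finite_measuresD[OF \<eta>])
  ultimately show ?R by auto
qed

section \<open>Shadows through hulls of differences of potentials\<close>

definition shadow_hull :: "real measure \<Rightarrow> real measure \<Rightarrow> real \<Rightarrow> real" where
  "shadow_hull \<nu> \<mu> = convex_hull_fun (\<lambda>k. potential \<nu> k - potential \<mu> k)"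

text \<open>The two bounds say that \<open>\<mu>\<close> lies below \<open>\<nu>\<close> when tested against the functions
  \<open>x \<mapsto> max 0 (k - x)\<close> and \<open>x \<mapsto> max 0 (x - k)\<close>, which is \<open>\<preceq>\<^bsub>C,+\<^esub>\<close> in terms of potentials.\<close>

definition subdominated :: "real measure \<Rightarrow> real measure \<Rightarrow> bool" where
  "subdominated \<mu> \<nu> \<longleftrightarrow> (\<forall>k. 0 \<le> potential \<nu> k - potential \<mu> k \<and>
     (measure \<nu> UNIV - measure \<mu> UNIV) * k - ((\<integral>x. x \<partial>\<nu>) - (\<integral>x. x \<partial>\<mu>)) \<le> potential \<nu> k - potential \<mu> k)"

text \<open>Both bounds in \<open>subdominated\<close> are affine minorants of the difference of
  potentials, so the hull inherits them.\<close>

lemma shadow_hull_facts: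
  assumes \<mu>: "\<mu> \<in> finite_measures" and \<nu>: "\<nu> \<in> finite_measures" and sub: "subdominated \<mu> \<nu>"
  shows convex_shadow_hull: "convex_on UNIV (shadow_hull \<nu> \<mu>)"
    and shadow_hull_le: "shadow_hull \<nu> \<mu> k \<le> potential \<nu> k - potential \<mu> k"
    and shadow_hull_nonneg: "0 \<le> shadow_hull \<nu> \<mu> k"
    and shadow_hull_ge: "(measure \<nu> UNIV - measure \<mu> UNIV) * k - ((\<integral>x. x \<partial>\<nu>) - (\<integral>x. x \<partial>\<mu>)) \<le> shadow_hull \<nu> \<mu> k"
    and convex_potential_minus_hull: "convex_on UNIV (\<lambda>k. potential \<nu> k - shadow_hull \<nu> \<mu> k)"
proof -
  have c: "convex_on UNIV (\<lambda>_::real. 0::real)" "(\<lambda>_. 0) \<le> (\<lambda>k. potential \<nu> k - potential \<mu> k)"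
    using sub by (auto simp: subdominated_def le_fun_def convex_on_def)
  show "convex_on UNIV (shadow_hull \<nu> \<mu>)" "shadow_hull \<nu> \<mu> k \<le> potential \<nu> k - potential \<mu> k" "0 \<le> shadow_hull \<nu> \<mu> k"
    using convex_convex_hull_fun[OF c] convex_hull_fun_le[OF c] convex_hull_fun_upper[OF c]
    by (auto simp: shadow_hull_def le_fun_def)
  show "(measure \<nu> UNIV - measure \<mu> UNIV) * k - ((\<integral>x. x \<partial>\<nu>) - (\<integral>x. x \<partial>\<mu>)) \<le> shadow_hull \<nu> \<mu> k"
    using convex_hull_fun_upper_affine[of "- ((\<integral>x. x \<partial>\<nu>) - (\<integral>x. x \<partial>\<mu>))" "measure \<nu> UNIV - measure \<mu> UNIV"
      "\<lambda>k. potential \<nu> k - potential \<mu> k" k] sub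
    by (simp add: shadow_hull_def subdominated_def algebra_simps)
  show "convex_on UNIV (\<lambda>k. potential \<nu> k - shadow_hull \<nu> \<mu> k)"
    unfolding shadow_hull_def
    by (rule convex_minus_convex_hull_fun[OF _ _ c]) (use subgradient_imp_convex potential_subgradient \<mu> \<nu> in auto)
qed

lemma is_shadow_unique:
  assumes "is_shadow \<nu> \<mu> \<eta>" "is_shadow \<nu> \<mu> \<eta>'"
  shows "\<eta> = \<eta>'"
proof -
  have f: "\<eta> \<in> finite_measures" "\<eta>' \<in> finite_measures" "\<eta> \<preceq>\<^sub>C \<eta>'" "\<eta>' \<preceq>\<^sub>C \<eta>"
    using assms by (auto simp: is_shadow_def)
  then have "potential \<eta> = potential \<eta>'"
    using convex_order_iff by (intro ext antisym) blast+
  then show ?thesis by (rule potential_inject[OF f(1,2)])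
qed

text \<open>A competitor \<open>\<eta>'\<close> gives the convex minorant
  \<open>potential \<nu> - potential \<eta>'\<close> of
  \<open>potential \<nu> - potential \<mu>\<close>. The hull is the greatest such minorant, so the
  measure built from it has the least potential.\<close>

lemma shadow_exists:
  assumes \<mu>: "\<mu> \<in> finite_measures" and \<nu>: "\<nu> \<in> finite_measures" and sub: "subdominated \<mu> \<nu>"
  shows is_shadow_shadow: "is_shadow \<nu> \<mu> (shadow \<nu> \<mu>)"
    and potential_shadow: "potential (shadow \<nu> \<mu>) k = potential \<nu> k - shadow_hull \<nu> \<mu> k"
proof -
  note facts = shadow_hull_facts[OF \<mu> \<nu> sub]
  have "shadow_hull \<nu> \<mu> k \<le> potential \<nu> k" for k
    using facts(2)[of k] potential_nonneg[of \<mu> k] by linarith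
  then obtain \<eta> where \<eta>: "\<eta> \<in> finite_measures" "\<eta> \<le> \<nu>" "potential \<eta> = (\<lambda>k. potential \<nu> k - shadow_hull \<nu> \<mu> k)"
    using exists_measure_of_potential[OF \<nu> facts(1,5,3)] by metis
  define S where "S = measure \<nu> UNIV - measure \<mu> UNIV"
  define b where "b = (\<integral>x. x \<partial>\<nu>) - (\<integral>x. x \<partial>\<mu>)"
  \<comment> \<open>Mass and mean of \<eta> are found at \<open>+\<infinity>\<close>, where the hull
    is squeezed between \<open>potential \<nu> - potential \<mu>\<close> and the asymptote of this
    difference.\<close>
  have "(\<lambda>n. potential \<eta> (real n) - potential \<mu> (real n)) \<longlonglongrightarrow> 0"
  proof (rule tendsto_sandwich[OF _ _ tendsto_const])
    show "\<forall>\<^sub>F n in sequentially. 0 \<le> potential \<eta> (real n) - potential \<mu> (real n)"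
      using facts(2) by (auto simp: \<eta>(3) algebra_simps intro!: always_eventually)
    show "\<forall>\<^sub>F n in sequentially. potential \<eta> (real n) - potential \<mu> (real n)
        \<le> (potential \<nu> (real n) - (measure \<nu> UNIV * real n - (\<integral>x. x \<partial>\<nu>)))
          - (potential \<mu> (real n) - (measure \<mu> UNIV * real n - (\<integral>x. x \<partial>\<mu>)))"
      using facts(4) by (auto simp: \<eta>(3) algebra_simps intro!: always_eventually)
    show "(\<lambda>n. (potential \<nu> (real n) - (measure \<nu> UNIV * real n - (\<integral>x. x \<partial>\<nu>)))
          - (potential \<mu> (real n) - (measure \<mu> UNIV * real n - (\<integral>x. x \<partial>\<mu>)))) \<longlonglongrightarrow> 0"
      using tendsto_diff[OF potential_tendsto_at_top[OF \<nu>] potential_tendsto_at_top[OF \<mu>]] by simp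
  qed
  from tendsto_diff[OF this tendsto_diff[OF potential_tendsto_at_top[OF \<eta>(1)] potential_tendsto_at_top[OF \<mu>]]]
  have lim: "(\<lambda>n. (measure \<eta> UNIV - measure \<mu> UNIV) * real n - ((\<integral>x. x \<partial>\<eta>) - (\<integral>x. x \<partial>\<mu>))) \<longlonglongrightarrow> 0"
    by (simp add: algebra_simps)
  \<comment> \<open>Consecutive terms of an affine sequence differ by its slope, which is therefore
    \<open>0\<close>.\<close>
  have "(\<lambda>n. ((measure \<eta> UNIV - measure \<mu> UNIV) * real (Suc n) - ((\<integral>x. x \<partial>\<eta>) - (\<integral>x. x \<partial>\<mu>)))
      - ((measure \<eta> UNIV - measure \<mu> UNIV) * real n - ((\<integral>x. x \<partial>\<eta>) - (\<integral>x. x \<partial>\<mu>)))) \<longlonglongrightarrow> 0 - 0"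
    by (intro tendsto_diff lim LIMSEQ_Suc)
  then have mass: "measure \<mu> UNIV = measure \<eta> UNIV"
    by (simp add: algebra_simps tendsto_const_iff)
  with lim have mean: "(\<integral>x. x \<partial>\<mu>) = (\<integral>x. x \<partial>\<eta>)" by (simp add: tendsto_const_iff)
  have "\<mu> \<preceq>\<^sub>C \<eta>"
    unfolding convex_order_iff[OF \<mu> \<eta>(1)] using facts(2) mass mean by (simp add: \<eta>(3) algebra_simps)
  moreover have "\<eta> \<preceq>\<^sub>C \<eta>'" if \<eta>': "\<eta>' \<in> finite_measures" "\<mu> \<preceq>\<^sub>C \<eta>'" "\<eta>' \<le> \<nu>" for \<eta>'
  proof -
    note o = that(2)[unfolded convex_order_iff[OF \<mu> \<eta>'(1)]]
    have "(\<lambda>k. potential \<nu> k - potential \<eta>' k) \<le> shadow_hull \<nu> \<mu>"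
      unfolding shadow_hull_def using o
      by (intro convex_hull_fun_upper convex_potential_diff \<nu> \<eta>') (auto simp: le_fun_def)
    then show ?thesis
      unfolding convex_order_iff[OF \<eta>(1) \<eta>'(1)] using o mass mean
      by (auto simp: \<eta>(3) le_fun_def algebra_simps)
  qed
  ultimately have s: "is_shadow \<nu> \<mu> \<eta>" using \<eta> by (auto simp: is_shadow_def)
  then have "shadow \<nu> \<mu> = \<eta>"
    unfolding shadow_def by (rule the_equality) (rule is_shadow_unique[OF _ s])
  then show "is_shadow \<nu> \<mu> (shadow \<nu> \<mu>)" "potential (shadow \<nu> \<mu>) k = potential \<nu> k - shadow_hull \<nu> \<mu> k"
    using s \<eta>(3) by auto
qed

lemma potential_measure_mono:
  assumes "\<mu> \<in> finite_measures" "\<mu>' \<in> finite_measures" "\<mu>' \<le> \<mu>"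
  shows "potential \<mu>' k \<le> potential \<mu> k"
  unfolding potential_def by (intro integral_mono_finite_measures assms integrable_finite_measures) auto

text \<open>Passing to a smaller measure lowers the integrals of both \<open>max 0 (k - x)\<close>
  and \<open>max 0 (x - k)\<close>; the affine bound is the second statement after
  reflection.\<close>

lemma subdominated_of_le:
  assumes \<mu>: "\<mu> \<in> finite_measures" and \<nu>: "\<nu> \<in> finite_measures" and \<mu>': "\<mu>' \<in> finite_measures" "\<mu>' \<le> \<mu>"
    and order: "\<mu> \<preceq>\<^sub>C \<nu>"
  shows "subdominated \<mu>' \<nu>"
  unfolding subdominated_def
proof (intro allI conjI)
  fix k
  note o = order[unfolded convex_order_iff[OF \<mu> \<nu>]]
  show "0 \<le> potential \<nu> k - potential \<mu>' k"
    using potential_measure_mono[OF \<mu> \<mu>', of k] o by (smt (verit))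
  have "(\<integral>x. max 0 (x - k) \<partial>\<mu>') \<le> (\<integral>x. max 0 (x - k) \<partial>\<mu>)"
    by (intro integral_mono_finite_measures \<mu> \<mu>' integrable_finite_measures) auto
  then show "(measure \<nu> UNIV - measure \<mu>' UNIV) * k - ((\<integral>x. x \<partial>\<nu>) - (\<integral>x. x \<partial>\<mu>')) \<le> potential \<nu> k - potential \<mu>' k"
    unfolding potential_reflect[OF \<mu>] potential_reflect[OF \<mu>'(1)]
    using o by (auto simp: algebra_simps dest!: spec[of _ k])
qed

text \<open>\<open>shadow_hull \<nu> \<mu>2\<close> is the hull of \<open>shadow_hull \<nu> \<mu>1\<close> minus the potential of \<open>\<mu>2 - \<mu>1\<close>,
  that is, the shadow of \<open>\<mu>2 - \<mu>1\<close> in \<open>\<nu> - shadow \<nu> \<mu>1\<close> accounts for the difference.\<close>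

lemma shadow_mono:
  assumes \<nu>: "\<nu> \<in> finite_measures" and \<mu>1: "\<mu>1 \<in> finite_measures" and \<mu>2: "\<mu>2 \<in> finite_measures"
    and le: "\<mu>1 \<le> \<mu>2" and sub: "subdominated \<mu>1 \<nu>" "subdominated \<mu>2 \<nu>"
  shows "shadow \<nu> \<mu>1 \<le> shadow \<nu> \<mu>2"
proof -
  define h1 where "h1 = shadow_hull \<nu> \<mu>1"
  define h2 where "h2 = shadow_hull \<nu> \<mu>2"
  define f where "f = (\<lambda>k. potential \<mu>2 k - potential \<mu>1 k)"
  note facts1 = shadow_hull_facts[OF \<mu>1 \<nu> sub(1), folded h1_def]
  note facts2 = shadow_hull_facts[OF \<mu>2 \<nu> sub(2), folded h2_def]
  have f: "convex_on UNIV f" "0 \<le> f k" for k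
    using convex_potential_diff[OF \<mu>2 \<mu>1 le] potential_measure_mono[OF \<mu>2 \<mu>1 le] by (auto simp: f_def)
  have "(\<lambda>k. h2 k + f k) \<le> h1"
    unfolding h1_def shadow_hull_def
  proof (rule convex_hull_fun_upper)
    show "convex_on UNIV (\<lambda>k. h2 k + f k)" by (intro convex_on_add facts2 f)
    show "(\<lambda>k. h2 k + f k) \<le> (\<lambda>k. potential \<nu> k - potential \<mu>1 k)"
      using facts2(2) by (auto simp: le_fun_def f_def algebra_simps)
  qed
  then have h2f: "h2 k + f k \<le> h1 k" for k by (simp add: le_fun_def)
  then have h2f': "h2 \<le> (\<lambda>k. h1 k - f k)" by (auto simp: le_fun_def algebra_simps)
  have "convex_hull_fun (\<lambda>k. h1 k - f k) = h2"
  proof (rule antisym)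
    show "h2 \<le> convex_hull_fun (\<lambda>k. h1 k - f k)" by (intro convex_hull_fun_upper facts2 h2f')
    show "convex_hull_fun (\<lambda>k. h1 k - f k) \<le> h2"
      unfolding h2_def shadow_hull_def
    proof (rule convex_hull_fun_upper)
      show "convex_on UNIV (convex_hull_fun (\<lambda>k. h1 k - f k))" by (rule convex_convex_hull_fun[OF facts2(1) h2f'])
      have "convex_hull_fun (\<lambda>k. h1 k - f k) \<le> (\<lambda>k. h1 k - f k)" by (rule convex_hull_fun_le[OF facts2(1) h2f'])
      also have "\<dots> \<le> (\<lambda>k. potential \<nu> k - potential \<mu>2 k)"
        using facts1(2) by (auto simp: le_fun_def f_def algebra_simps)
      finally show "convex_hull_fun (\<lambda>k. h1 k - f k) \<le> (\<lambda>k. potential \<nu> k - potential \<mu>2 k)" .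
    qed
  qed
  then have conv: "convex_on UNIV (\<lambda>k. h1 k - h2 k)"
    using convex_minus_convex_hull_fun[OF f(1) facts1(1) facts2(1) h2f'] by simp
  note s1 = is_shadow_shadow[OF \<mu>1 \<nu> sub(1)] and s2 = is_shadow_shadow[OF \<mu>2 \<nu> sub(2)]
  have p1: "potential (shadow \<nu> \<mu>1) k = potential \<nu> k - h1 k" for k
    unfolding h1_def by (rule potential_shadow[OF \<mu>1 \<nu> sub(1)])
  have p2: "potential (shadow \<nu> \<mu>2) k = potential \<nu> k - h2 k" for k
    unfolding h2_def by (rule potential_shadow[OF \<mu>2 \<nu> sub(2)])
  have m: "shadow \<nu> \<mu>1 \<in> finite_measures" "shadow \<nu> \<mu>2 \<in> finite_measures"
    using s1 s2 by (auto simp: is_shadow_def)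
  \<comment> \<open>\<open>potential \<nu> - h1\<close> equals
    \<open>potential (shadow \<nu> \<mu>2) - (h1 - h2)\<close>, a splitting of the potential of the
    larger shadow. The submeasure it produces has the potential of
    \<open>shadow \<nu> \<mu>1\<close>.\<close>
  have "convex_on UNIV (\<lambda>k. potential \<nu> k - h1 k)" by (rule facts1(5))
  then have "convex_on UNIV (\<lambda>k. potential (shadow \<nu> \<mu>2) k - (h1 k - h2 k))" by (simp add: p2)
  moreover have "0 \<le> h1 k - h2 k" for k using h2f[of k] f(2)[of k] by linarith
  moreover have "h1 k - h2 k \<le> potential (shadow \<nu> \<mu>2) k" for k
    using facts1(2)[of k] potential_nonneg[of \<mu>1 k] by (simp add: p2)
  ultimately obtain \<eta> where \<eta>: "\<eta> \<in> finite_measures" "\<eta> \<le> shadow \<nu> \<mu>2"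
    "potential \<eta> = (\<lambda>k. potential (shadow \<nu> \<mu>2) k - (h1 k - h2 k))"
    using exists_measure_of_potential[OF m(2) conv] by metis
  have "\<eta> = shadow \<nu> \<mu>1"
    by (rule potential_inject[OF \<eta>(1) m(1)]) (auto simp: \<eta>(3) p1 p2)
  with \<eta>(2) show ?thesis by simp
qed

section \<open>Couplings from increasing families of measures\<close>

text \<open>On the set where \<open>g < f\<close>, domination leaves \<open>f - g\<close> with
  integral \<open>0\<close>; the finite integral of \<open>g\<close> permits the
  cancellation.\<close>

lemma AE_le_of_density_le:
  assumes f: "f \<in> borel_measurable M" and g: "g \<in> borel_measurable M"
    and le: "density M f \<le> density M g" and int: "(\<integral>\<^sup>+x. g x \<partial>M) < \<infinity>"
  shows "AE x in M. f x \<le> g x"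
proof -
  define A where "A = {x \<in> space M. g x < f x}"
  have A[measurable]: "A \<in> sets M" unfolding A_def using f g by measurable
  note [measurable] = f g
  have eq: "f x * indicator A x = g x * indicator A x + (f x - g x) * indicator A x" for x
    by (auto simp: A_def indicator_def less_imp_le add_diff_inverse_ennreal)
  have "(\<integral>\<^sup>+x. g x * indicator A x \<partial>M) + (\<integral>\<^sup>+x. (f x - g x) * indicator A x \<partial>M)
      = (\<integral>\<^sup>+x. f x * indicator A x \<partial>M)"
    by (subst nn_integral_add[symmetric]) (auto simp: eq)
  also have "\<dots> = emeasure (density M f) A" by (simp add: emeasure_density)
  also have "\<dots> \<le> emeasure (density M g) A" by (rule le_measureD3[OF le]) simp
  also have "\<dots> = (\<integral>\<^sup>+x. g x * indicator A x \<partial>M)" by (simp add: emeasure_density)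
  finally have le0: "(\<integral>\<^sup>+x. g x * indicator A x \<partial>M) + (\<integral>\<^sup>+x. (f x - g x) * indicator A x \<partial>M)
      \<le> (\<integral>\<^sup>+x. g x * indicator A x \<partial>M) + 0" by simp
  have "(\<integral>\<^sup>+x. g x * indicator A x \<partial>M) \<le> (\<integral>\<^sup>+x. g x \<partial>M)"
    by (intro nn_integral_mono) (auto simp: indicator_def)
  with int have "(\<integral>\<^sup>+x. g x * indicator A x \<partial>M) \<noteq> \<infinity>" by (auto simp: top_unique)
  with le0 have "(\<integral>\<^sup>+x. (f x - g x) * indicator A x \<partial>M) = 0"
    by (subst (asm) ennreal_add_left_cancel_le) auto
  then have "AE x in M. (f x - g x) * indicator A x = 0"
    by (subst (asm) nn_integral_0_iff_AE) auto
  then show ?thesis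
  proof (rule AE_mp, intro AE_I2 impI)
    fix x assume "x \<in> space M" "(f x - g x) * indicator A x = 0"
    then show "f x \<le> g x"
      by (auto simp: A_def indicator_def diff_eq_0_iff_ennreal not_less split: if_splits)
  qed
qed

section \<open>Restrictions of measures\<close>

lemma sets_restr [simp]: "sets (restr \<mu> A) = sets \<mu>"
  by (simp add: restr_def)

lemma emeasure_restr:
  "A \<in> sets \<mu> \<Longrightarrow> B \<in> sets \<mu> \<Longrightarrow> emeasure (restr \<mu> A) B = emeasure \<mu> (A \<inter> B)"
  unfolding restr_def by (subst emeasure_density) (auto simp: indicator_inter_arith[symmetric])

lemma integral_restr:
  fixes f :: "'a \<Rightarrow> real"
  assumes "A \<in> sets \<mu>" "f \<in> borel_measurable \<mu>"
  shows "(\<integral>x. f x \<partial>restr \<mu> A) = (\<integral>x. indicator A x * f x \<partial>\<mu>)"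
proof -
  have "restr \<mu> A = density \<mu> (\<lambda>x. ennreal (indicator A x))"
    by (simp add: restr_def ennreal_indicator)
  then show ?thesis using assms by (simp add: integral_density)
qed

lemma restr_mono:
  assumes "A \<in> sets \<mu>" "B \<in> sets \<mu>" "A \<subseteq> B"
  shows "restr \<mu> A \<le> restr \<mu> B"
  using assms by (subst le_measure) (auto simp: emeasure_restr intro!: emeasure_mono)

lemma restr_le: "A \<in> sets \<mu> \<Longrightarrow> restr \<mu> A \<le> \<mu>"
  by (subst le_measure) (auto simp: emeasure_restr intro!: emeasure_mono)

lemma restr_finite_measures:
  assumes "\<mu> \<in> finite_measures" "A \<in> sets borel"
  shows "restr \<mu> A \<in> finite_measures"
  using assms finite_measuresD(2)[OF assms(1)] by (intro finite_measures_mono[OF assms(1)] restr_le) auto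

lemma measure_restr_UNIV:
  assumes "\<mu> \<in> finite_measures"
  shows "measure (restr \<mu> {..x}) UNIV = cdf \<mu> x"
  using assms finite_measuresD(2)[OF assms] by (simp add: measure_def emeasure_restr cdf_def)

text \<open>The potential of \<mu> is followed up to \<open>x\<close> and then continued along its
  supporting line of slope \<open>cdf \<mu> x\<close>. Thus potentials of restrictions converge once
  potentials and the cdf at \<open>x\<close> do.\<close>

lemma potential_restr:
  assumes \<mu>: "\<mu> \<in> finite_measures"
  shows "potential (restr \<mu> {..x}) k = potential \<mu> (min k x) + cdf \<mu> x * max 0 (k - x)"
proof -
  have "potential (restr \<mu> {..x}) k = (\<integral>t. indicator {..x} t * max 0 (k - t) \<partial>\<mu>)"
    unfolding potential_def using finite_measuresD(2)[OF \<mu>]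
    by (intro integral_restr finite_measures_measurable[OF \<mu>]) auto
  also have "\<dots> = (\<integral>t. max 0 (min k x - t) + indicator {..x} t * max 0 (k - x) \<partial>\<mu>)"
    by (intro Bochner_Integration.integral_cong) (auto simp: indicator_def)
  also have "\<dots> = potential \<mu> (min k x) + cdf \<mu> x * max 0 (k - x)"
    unfolding potential_def cdf_def using finite_measuresD(3)[OF \<mu>]
    by (subst Bochner_Integration.integral_add)
       (auto intro!: integrable_finite_measures[OF \<mu>] integrable_mult_left)
  finally show ?thesis .
qed

text \<open>If \<open>S x\<close> has \<open>\<nu>\<close>-density \<open>g x\<close>, then \<open>x \<mapsto> g x y\<close> is the conditional distribution function
  of \<open>X\<close> given \<open>Y = y\<close>; \<open>X\<close> is realised as its quantile function at an independent uniform variable.\<close>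

lemma coupling_of_increasing_family:
  fixes S :: "real \<Rightarrow> real measure"
  assumes \<mu>: "real_distribution \<mu>" and \<nu>: "real_distribution \<nu>"
    and sets_S: "\<And>x. sets (S x) = sets borel"
    and S_mono: "\<And>x x'. x \<le> x' \<Longrightarrow> S x \<le> S x'" and S_le: "\<And>x. S x \<le> \<nu>"
    and mass: "\<And>x. measure (S x) UNIV = cdf \<mu> x"
  obtains \<pi> :: "(real \<times> real) measure" where "prob_space \<pi>" "sets \<pi> = sets borel"
    "\<And>x B. B \<in> sets borel \<Longrightarrow> emeasure \<pi> ({..x} \<times> B) = emeasure (S x) B"
proof -
  interpret \<mu>: real_distribution \<mu> by fact
  interpret \<nu>: real_distribution \<nu> by fact
  have sets_\<nu>: "sets \<nu> = sets borel" by simp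
  have emS: "emeasure (S x) B \<le> emeasure \<nu> B" for x B
    using le_measureD3[OF S_le] sets_S by simp
  have finS: "finite_measure (S x)" for x
  proof (rule finite_measureI)
    show "emeasure (S x) (space (S x)) \<noteq> \<infinity>"
      using emS[of x "space (S x)"] \<nu>.emeasure_le_1[of "space (S x)"] by (auto simp: top_unique)
  qed
  have emS_eq: "emeasure (S x) B = ennreal (measure (S x) B)" for x B
    using finite_measure.emeasure_eq_measure[OF finS] .
  have measure_S_mono: "measure (S x) B \<le> measure (S x') B" if "x \<le> x'" for x x' B
    using le_measureD3[OF S_mono[OF that], of B] sets_S by (simp add: emS_eq)
  have space_S: "space (S x) = UNIV" for x using sets_eq_imp_space_eq[OF sets_S] by simp
  \<comment> \<open>The complement of \<open>B\<close> gains mass as well, so the mass of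
    \<open>B\<close> grows no faster than the total mass. This yields right continuity in
    \<open>x\<close>.\<close>
  have measure_S_diff: "measure (S x') B - measure (S x) B \<le> cdf \<mu> x' - cdf \<mu> x"
    if "x \<le> x'" "B \<in> sets borel" for x x' B
  proof -
    have "measure (S y) (UNIV - B) = cdf \<mu> y - measure (S y) B" for y
      using finite_measure.finite_measure_compl[OF finS, of B y] that(2) sets_S by (simp add: space_S mass)
    then show ?thesis using measure_S_mono[OF that(1), of "UNIV - B"] by simp
  qed
  define g where "g = (\<lambda>x. RN_deriv \<nu> (S x))"
  have g_meas[measurable]: "g x \<in> borel_measurable borel" for x
    using borel_measurable_RN_deriv[of \<nu> "S x"] measurable_cong_sets[OF sets_\<nu> refl] unfolding g_def by blast
  have g_meas': "g x \<in> borel_measurable \<nu>" for x by (simp add: g_def)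
  have g_dens: "density \<nu> (g x) = S x" for x
    unfolding g_def
  proof (rule \<nu>.density_RN_deriv)
    have "emeasure (S x) B = 0" if "emeasure \<nu> B = 0" for B
      using emS[of x B] that by simp
    then show "absolutely_continuous \<nu> (S x)"
      using sets_S by (auto simp: absolutely_continuous_def null_sets_def)
  qed (simp add: sets_S)
  have g_mono: "AE y in \<nu>. g x y \<le> g x' y" if "x \<le> x'" for x x'
  proof (rule AE_le_of_density_le[OF g_meas' g_meas'])
    have "(\<integral>\<^sup>+y. g x' y \<partial>\<nu>) = emeasure (density \<nu> (g x')) (space \<nu>)"
      using g_meas' by (subst emeasure_density) (auto intro!: nn_integral_cong)
    then show "(\<integral>\<^sup>+y. g x' y \<partial>\<nu>) < \<infinity>" by (simp add: g_dens emS_eq)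
  qed (use S_mono that g_dens in auto)
  have g_le1: "AE y in \<nu>. g x y \<le> 1" for x
    by (rule AE_le_of_density_le[OF g_meas'])
       (use S_le g_dens in \<open>auto simp: density_1 less_top[symmetric]\<close>)
  define U where "U = uniform_measure lborel {0..1::real}"
  interpret U: prob_space U unfolding U_def by (rule prob_space_uniform_measure) auto
  have sets_U[measurable_cong]: "sets U = sets borel" by (simp add: U_def)
  have U_less: "emeasure U {v. ennreal v < c} = c" if c: "c \<le> 1" for c
  proof -
    obtain r where r: "c = ennreal r" "0 \<le> r" "r \<le> 1" using c by (cases c) (auto simp: top_unique)
    have eq: "{0..1} \<inter> {v. ennreal v < c} = {0..<r}"
      using r by (auto simp: ennreal_less_iff)
    have "{v \<in> space borel. ennreal v < c} \<in> sets borel" by measurable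
    then have "emeasure U {v. ennreal v < c} = emeasure lborel ({0..1} \<inter> {v. ennreal v < c}) / emeasure lborel {0..1::real}"
      unfolding U_def by (intro emeasure_uniform_measure) auto
    then show ?thesis using r unfolding eq by (simp add: divide_ennreal_def)
  qed
  define P where "P = \<nu> \<Otimes>\<^sub>M U"
  interpret P: pair_prob_space \<nu> U ..
  interpret P': prob_space P unfolding P_def by (rule P.prob_space_axioms)
  have sets_P[measurable_cong]: "sets P = sets (borel \<Otimes>\<^sub>M borel)"
    unfolding P_def by (intro sets_pair_measure_cong sets_U) simp
  \<comment> \<open>The quantile of \<open>g q y\<close> in \<open>q\<close> at the level of the
    uniform variable. Only rational \<open>q\<close> enter, because monotonicity in \<open>q\<close>
    holds almost everywhere for each pair and countably many exceptional sets can be discarded. If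
    no \<open>q\<close> qualifies, the value is \<infinity>.\<close>
  define T :: "real \<times> real \<Rightarrow> ereal" where
    "T = (\<lambda>p. INF q\<in>\<rat>. if ennreal (snd p) < g q (fst p) then ereal q else \<infinity>)"
  have T_less: "T p < ereal x \<longleftrightarrow> (\<exists>q\<in>\<rat>. q < x \<and> ennreal (snd p) < g q (fst p))" for p x
    unfolding T_def INF_less_iff by auto
  have [measurable]: "T \<in> borel_measurable (borel \<Otimes>\<^sub>M borel)"
    unfolding T_def by (intro borel_measurable_INF countable_rat) measurable
  have em_P: "emeasure P {p. fst p \<in> B \<and> Q p} = (\<integral>\<^sup>+y. indicator B y * emeasure U {v. Q (y, v)} \<partial>\<nu>)"
    if "B \<in> sets borel" and [measurable]: "Measurable.pred (borel \<Otimes>\<^sub>M borel) Q" for B Q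
  proof -
    have [measurable]: "B \<in> sets borel" by fact
    have "{p \<in> space (borel \<Otimes>\<^sub>M borel). fst p \<in> B \<and> Q p} \<in> sets (borel \<Otimes>\<^sub>M borel)" by measurable
    then have "{p. fst p \<in> B \<and> Q p} \<in> sets (\<nu> \<Otimes>\<^sub>M U)" using sets_P by (simp add: P_def space_pair_measure)
    then show ?thesis unfolding P_def
      by (subst U.emeasure_pair_measure_alt) (auto intro!: nn_integral_cong simp: indicator_def vimage_def)
  qed
  have em_S: "emeasure (S x) B = (\<integral>\<^sup>+y. indicator B y * g x y \<partial>\<nu>)" if "B \<in> sets borel" for x B
    unfolding g_dens[symmetric] using that g_meas' by (subst emeasure_density) (auto intro!: nn_integral_cong simp: mult.commute)
  \<comment> \<open>Over \<open>B\<close>, the event \<open>T < x\<close> is caught between the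
    masses of \<open>S q\<close>, for rational \<open>q < x\<close>, and of \<open>S x\<close>. The
    event \<open>T \<le> x\<close> is then reached by approaching \<open>x\<close> from the
    right.\<close>
  have upper: "emeasure P {p. fst p \<in> B \<and> T p < ereal x} \<le> emeasure (S x) B" if B: "B \<in> sets borel" for B x
  proof -
    have "AE y in \<nu>. \<forall>q\<in>\<rat> \<inter> {..<x}. g q y \<le> g x y"
      by (subst AE_ball_countable) (auto intro!: g_mono countable_Int1 countable_rat)
    then have "AE y in \<nu>. emeasure U {v. T (y, v) < ereal x} \<le> g x y"
      using g_le1[of x]
    proof eventually_elim
      case (elim y)
      have "emeasure U {v. T (y, v) < ereal x} \<le> emeasure U {v. ennreal v < g x y}"
        using elim(1) by (intro emeasure_mono) (auto simp: T_less sets_U intro: order_less_le_trans)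
      then show ?case using U_less[OF elim(2)] by simp
    qed
    then show ?thesis
      unfolding em_S[OF B] by (subst em_P[OF B]) (auto intro!: nn_integral_mono_AE mult_left_mono)
  qed
  have lower: "emeasure (S q) B \<le> emeasure P {p. fst p \<in> B \<and> T p < ereal x}"
    if B: "B \<in> sets borel" and q: "q \<in> \<rat>" "q < x" for B x q
  proof -
    have "AE y in \<nu>. g q y \<le> emeasure U {v. T (y, v) < ereal x}"
      using g_le1[of q]
    proof eventually_elim
      case (elim y)
      have [measurable]: "(\<lambda>v. T (y, v)) \<in> borel_measurable borel" by measurable
      have "{v \<in> space borel. T (y, v) < ereal x} \<in> sets borel" by measurable
      then have "emeasure U {v. ennreal v < g q y} \<le> emeasure U {v. T (y, v) < ereal x}"
        using q by (intro emeasure_mono) (auto simp: T_less sets_U)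
      then show ?case using U_less[OF elim] by simp
    qed
    then show ?thesis
      unfolding em_S[OF B] by (subst em_P[OF B]) (auto intro!: nn_integral_mono_AE mult_left_mono)
  qed
  define F where "F = (\<lambda>B x. measure P {p. fst p \<in> B \<and> T p < ereal x})"
  have F_upper: "F B x \<le> measure (S x) B" if "B \<in> sets borel" for B x
    using upper[OF that, of x] by (simp add: F_def P'.emeasure_eq_measure emS_eq)
  have F_lower: "measure (S x') B \<le> F B x" if B: "B \<in> sets borel" and less: "x' < x" for B x x'
  proof -
    obtain q where q: "q \<in> \<rat>" "x' < q" "q < x" using Rats_dense_in_real[OF less] by blast
    have "measure (S x') B \<le> measure (S q) B" using q by (intro measure_S_mono) auto
    also have "\<dots> \<le> F B x" using lower[OF B q(1,3)] by (simp add: F_def P'.emeasure_eq_measure emS_eq)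
    finally show ?thesis .
  qed
  have setsT[measurable]: "{p. fst p \<in> B \<and> Q (T p)} \<in> sets P"
    if "B \<in> sets borel" and [measurable]: "Measurable.pred borel Q" for B Q
  proof -
    have [measurable]: "B \<in> sets borel" by fact
    have "{p \<in> space (borel \<Otimes>\<^sub>M borel). fst p \<in> B \<and> Q (T p)} \<in> sets (borel \<Otimes>\<^sub>M borel)" by measurable
    then show ?thesis using sets_P by (simp add: space_pair_measure)
  qed
  have le_eq: "measure P {p. fst p \<in> B \<and> T p \<le> ereal x} = measure (S x) B" if B: "B \<in> sets borel" for B x
  proof (rule LIMSEQ_unique)
    let ?x = "\<lambda>n. x + inverse (real (Suc n))"
    have "(\<lambda>n. F B (?x n)) \<longlonglongrightarrow> measure P (\<Inter>n. {p. fst p \<in> B \<and> T p < ereal (?x n)})"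
      unfolding F_def
    proof (rule P'.finite_Lim_measure_decseq)
      show "range (\<lambda>n. {p. fst p \<in> B \<and> T p < ereal (?x n)}) \<subseteq> P'.events"
        using setsT[OF B] by auto
      show "decseq (\<lambda>n. {p. fst p \<in> B \<and> T p < ereal (?x n)})"
      proof (rule decseq_SucI, safe)
        fix n p assume "T p < ereal (?x (Suc n))"
        also have "?x (Suc n) \<le> ?x n" by (simp add: le_imp_inverse_le)
        finally show "T p < ereal (?x n)" by simp
      qed
    qed
    also have "(\<Inter>n. {p. fst p \<in> B \<and> T p < ereal (?x n)}) = {p. fst p \<in> B \<and> T p \<le> ereal x}"
    proof safe
      fix p assume p: "p \<in> (\<Inter>n. {p. fst p \<in> B \<and> T p < ereal (?x n)})"
      then show "fst p \<in> B" by auto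
      show "T p \<le> ereal x"
      proof (rule LIMSEQ_le_const)
        have "?x \<longlonglongrightarrow> x" using LIMSEQ_inverse_real_of_nat_add by simp
        then show "(\<lambda>n. ereal (?x n)) \<longlonglongrightarrow> ereal x" by (rule tendsto_ereal)
      qed (use p in \<open>auto intro!: less_imp_le\<close>)
    next
      fix p n assume "T p \<le> ereal x"
      also have "ereal x < ereal (?x n)" by simp
      finally show "T p < ereal (?x n)" .
    qed
    finally show "(\<lambda>n. F B (?x n)) \<longlonglongrightarrow> measure P {p. fst p \<in> B \<and> T p \<le> ereal x}" .
    show "(\<lambda>n. F B (?x n)) \<longlonglongrightarrow> measure (S x) B"
    proof (rule tendsto_sandwich[OF _ _ tendsto_const])
      show "\<forall>\<^sub>F n in sequentially. measure (S x) B \<le> F B (?x n)"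
        by (intro always_eventually allI F_lower B) simp
      show "\<forall>\<^sub>F n in sequentially. F B (?x n) \<le> measure (S x) B + (cdf \<mu> (?x n) - cdf \<mu> x)"
      proof (intro always_eventually allI)
        fix n
        show "F B (?x n) \<le> measure (S x) B + (cdf \<mu> (?x n) - cdf \<mu> x)"
          using F_upper[OF B, of "?x n"] measure_S_diff[OF _ B, of x "?x n"] by simp
      qed
      have "(cdf \<mu> \<longlongrightarrow> cdf \<mu> x) (at_right x)"
        using \<mu>.cdf_is_right_cont by (simp add: continuous_within)
      moreover have "filterlim ?x (at_right x) sequentially"
        using LIMSEQ_inverse_real_of_nat_add[of x] by (simp add: filterlim_at)
      ultimately have "(\<lambda>n. cdf \<mu> (?x n)) \<longlonglongrightarrow> cdf \<mu> x" by (rule filterlim_compose)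
      then show "(\<lambda>n. measure (S x) B + (cdf \<mu> (?x n) - cdf \<mu> x)) \<longlonglongrightarrow> measure (S x) B"
        by (auto intro!: tendsto_eq_intros)
    qed
  qed
  have em_T: "measure P {p. T p \<le> ereal x} = cdf \<mu> x" for x
    using le_eq[of UNIV x] by (simp add: mass)
  have T_sets: "{p. Q (T p)} \<in> sets P" if "Measurable.pred borel Q" for Q
    using setsT[OF _ that, of UNIV] by simp
  \<comment> \<open>Infinite values have probability \<open>0\<close> because
    \<open>cdf \<mu>\<close> tends to \<open>0\<close> and \<open>1\<close>; the value
    \<open>real_of_ereal\<close> assigns to them is then immaterial.\<close>
  have "measure P {p. T p = - \<infinity>} \<le> 0"
  proof (rule tendsto_lowerbound[OF \<mu>.cdf_lim_neg_infty])
    have "measure P {p. T p = - \<infinity>} \<le> cdf \<mu> (- real n)" for n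
      unfolding em_T[symmetric] by (intro P'.finite_measure_mono T_sets) auto
    then show "\<forall>\<^sub>F n in sequentially. measure P {p. T p = - \<infinity>} \<le> cdf \<mu> (- real n)" by simp
  qed simp
  then have "{p. T p = - \<infinity>} \<in> null_sets P"
    by (intro null_setsI T_sets) (auto simp: P'.emeasure_eq_measure measure_le_0_iff)
  moreover have "measure P {p. T p = \<infinity>} \<le> 0"
  proof (rule tendsto_lowerbound)
    show "(\<lambda>n. 1 - cdf \<mu> (real n)) \<longlonglongrightarrow> 0"
      using \<mu>.cdf_lim_infty_prob by (auto intro!: tendsto_eq_intros)
    have "measure P {p. T p = \<infinity>} \<le> 1 - cdf \<mu> (real n)" for n
    proof -
      have "measure P {p. T p = \<infinity>} \<le> measure P (space P - {p. T p \<le> ereal (real n)})"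
        by (intro P'.finite_measure_mono sets.compl_sets T_sets)
           (auto simp: P_def space_pair_measure U_def)
      then show ?thesis by (subst (asm) P'.prob_compl) (auto simp: em_T intro: T_sets)
    qed
    then show "\<forall>\<^sub>F n in sequentially. measure P {p. T p = \<infinity>} \<le> 1 - cdf \<mu> (real n)" by simp
  qed simp
  then have "{p. T p = \<infinity>} \<in> null_sets P"
    by (intro null_setsI T_sets) (auto simp: P'.emeasure_eq_measure measure_le_0_iff)
  ultimately have T_finite: "AE p in P. \<bar>T p\<bar> \<noteq> \<infinity>"
    using AE_not_in[of "{p. T p = - \<infinity>}" P] AE_not_in[of "{p. T p = \<infinity>}" P] by auto
  \<comment> \<open>\<open>P\<close> carries \<open>Y\<close> as its first coordinate and the
    uniform variable as its second; the coupling lists \<open>X\<close> first.\<close>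
  define \<pi> where "\<pi> = distr P borel (\<lambda>p. (real_of_ereal (T p), fst p))"
  have meas: "(\<lambda>p. (real_of_ereal (T p), fst p)) \<in> measurable P borel"
    unfolding borel_prod[symmetric] by measurable
  show thesis
  proof (rule that[of \<pi>])
    show "prob_space \<pi>" unfolding \<pi>_def by (rule P'.prob_space_distr[OF meas])
    show "sets \<pi> = sets borel" by (simp add: \<pi>_def)
    fix x :: real and B :: "real set" assume B: "B \<in> sets borel"
    have "{..x} \<times> B \<in> sets (borel \<Otimes>\<^sub>M borel)" using B by (intro pair_measureI) auto
    then have "emeasure \<pi> ({..x} \<times> B) = emeasure P {p \<in> space P. real_of_ereal (T p) \<le> x \<and> fst p \<in> B}"
      unfolding \<pi>_def borel_prod by (subst emeasure_distr[OF meas]) (auto intro!: arg_cong[where f = "emeasure P"])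
    also have "\<dots> = emeasure P {p \<in> space P. fst p \<in> B \<and> T p \<le> ereal x}"
    proof (rule emeasure_eq_AE)
      show "AE p in P. p \<in> {p \<in> space P. real_of_ereal (T p) \<le> x \<and> fst p \<in> B}
          \<longleftrightarrow> p \<in> {p \<in> space P. fst p \<in> B \<and> T p \<le> ereal x}"
        using T_finite by eventually_elim (auto simp: real_le_ereal_iff)
      have [measurable]: "B \<in> sets borel" by fact
      show "{p \<in> space P. real_of_ereal (T p) \<le> x \<and> fst p \<in> B} \<in> sets P"
        "{p \<in> space P. fst p \<in> B \<and> T p \<le> ereal x} \<in> sets P" by measurable
    qed
    also have "{p \<in> space P. fst p \<in> B \<and> T p \<le> ereal x} = {p. fst p \<in> B \<and> T p \<le> ereal x}"
      by (auto simp: P_def space_pair_measure U_def)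
    also have "emeasure P \<dots> = emeasure (S x) B"
      by (simp add: P'.emeasure_eq_measure le_eq[OF B] emS_eq)
    finally show "emeasure \<pi> ({..x} \<times> B) = emeasure (S x) B" .
  qed
qed

section \<open>The left-curtain coupling\<close>

lemma prob_measures_realD:
  assumes "\<mu> \<in> (prob_measures :: real measure set)"
  shows "\<mu> \<in> finite_measures" "real_distribution \<mu>"
proof -
  have "(norm :: real \<Rightarrow> real) = (\<lambda>x. \<bar>x\<bar>)" by (rule ext) simp
  then have p: "prob_space \<mu>" "sets \<mu> = sets borel" "integrable \<mu> (\<lambda>x. \<bar>x\<bar>)"
    using assms unfolding prob_measures_def by (metis (mono_tags, lifting) mem_Collect_eq)+
  then show "\<mu> \<in> finite_measures"
    by (simp add: finite_measures_def prob_space.finite_measure)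
  show "real_distribution \<mu>"
    using p sets_eq_imp_space_eq[OF p(2)] by (simp add: real_distribution_def real_distribution_axioms_def)
qed

lemma atMost_prod: "{..(a, b)} = {..a} \<times> {..b}"
  by auto

lemma emeasure_marginal2_restr:
  assumes \<pi>: "sets \<pi> = sets (borel :: (real \<times> real) measure)" and B: "B \<in> sets borel"
  shows "emeasure (marginal2 (restr \<pi> ({..x} \<times> UNIV))) B = emeasure \<pi> ({..x} \<times> B)"
proof -
  have sp: "space \<pi> = UNIV" using sets_eq_imp_space_eq[OF \<pi>] by simp
  have A: "{..x} \<times> UNIV \<in> sets \<pi>" "UNIV \<times> B \<in> sets \<pi>"
    unfolding \<pi> borel_prod[symmetric] using B by (auto intro!: pair_measureI)
  have "sets (restr \<pi> ({..x} \<times> UNIV)) = sets (borel \<Otimes>\<^sub>M borel)" unfolding borel_prod by (simp add: \<pi>)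
  then have m: "snd \<in> measurable (restr \<pi> ({..x} \<times> UNIV)) borel"
    using measurable_snd measurable_cong_sets[OF _ refl] by blast
  have "emeasure (marginal2 (restr \<pi> ({..x} \<times> UNIV))) B = emeasure (restr \<pi> ({..x} \<times> UNIV)) (UNIV \<times> B)"
    using B sp by (subst emeasure_distr[OF m]) (auto simp: restr_def intro!: arg_cong[where f = "emeasure _"])
  also have "\<dots> = emeasure \<pi> ({..x} \<times> UNIV \<inter> UNIV \<times> B)" by (rule emeasure_restr[OF A])
  also have "{..x} \<times> UNIV \<inter> UNIV \<times> B = {..x} \<times> B" by auto
  finally show ?thesis .
qed

lemma is_left_curtainD:
  assumes "is_left_curtain \<mu> \<nu> \<pi>" "B \<in> sets borel"
  shows "emeasure \<pi> ({..x} \<times> B) = emeasure (shadow \<nu> (restr \<mu> {..x})) B"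
proof -
  have "sets \<pi> = sets borel" and eq: "marginal2 (restr \<pi> ({..x} \<times> UNIV)) = shadow \<nu> (restr \<mu> {..x})"
    using assms(1) by (auto simp: is_left_curtain_def martingale_couplings_def prob_measures_def)
  from emeasure_marginal2_restr[OF this(1) assms(2), of x] show ?thesis unfolding eq by simp
qed

text \<open>The shadows prescribe the masses of all strips \<open>{..x} \<times> B\<close>; those
  with \<open>B = {..y}\<close> already form an intersection-stable generator.\<close>

lemma is_left_curtain_unique:
  assumes "is_left_curtain \<mu> \<nu> \<pi>" "is_left_curtain \<mu> \<nu> \<pi>'"
  shows "\<pi> = \<pi>'"
proof -
  have p: "sets \<pi> = sets borel" "sets \<pi>' = sets borel" "prob_space \<pi>"
    using assms by (auto simp: is_left_curtain_def martingale_couplings_def prob_measures_def)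
  interpret prob_space \<pi> by fact
  show ?thesis
  proof (rule measure_eqI_generator_eq[where \<Omega> = UNIV and E = "range atMost" and A = "\<lambda>n. {..(real n, real n)}"])
    show "Int_stable (range atMost :: (real \<times> real) set set)"
    proof (rule Int_stableI_image)
      fix a b :: "real \<times> real"
      have "{..a} \<inter> {..b} = {..inf a b}" by (rule set_eqI) (simp only: Int_iff atMost_iff le_inf_iff)
      then show "\<exists>c\<in>UNIV. {..a} \<inter> {..b} = {..c}" by blast
    qed
    show "emeasure \<pi> X = emeasure \<pi>' X" if X: "X \<in> range atMost" for X
    proof -
      obtain a b where "X = {..a} \<times> {..b}" using X by (auto simp: atMost_prod[symmetric])
      then show ?thesis using is_left_curtainD[OF assms(1)] is_left_curtainD[OF assms(2)] by simp
    qed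
    show "(\<Union>n. {..(real n, real n)}) = UNIV"
    proof (intro equalityI subset_UNIV subsetI)
      fix z :: "real \<times> real"
      obtain n :: nat where "max (fst z) (snd z) \<le> real n" using real_arch_simple by blast
      then show "z \<in> (\<Union>n. {..(real n, real n)})" by (cases z) auto
    qed
  qed (auto simp: p borel_eq_atMost emeasure_eq_measure)
qed

section \<open>Existence of the left-curtain coupling\<close>

context
  fixes \<mu> \<nu> :: "real measure"
  assumes \<mu>: "\<mu> \<in> prob_measures" and \<nu>: "\<nu> \<in> prob_measures" and order: "\<mu> \<preceq>\<^sub>C \<nu>"
begin

private lemmas \<mu>_fm = prob_measures_realD(1)[OF \<mu>] and \<nu>_fm = prob_measures_realD(1)[OF \<nu>]
private lemmas sets_\<mu> = finite_measuresD(2)[OF \<mu>_fm]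

lemma restr_atMost_finite_measures: "restr \<mu> {..x} \<in> finite_measures"
  by (rule restr_finite_measures[OF \<mu>_fm]) simp

lemma subdominated_restr: "subdominated (restr \<mu> {..x}) \<nu>"
  by (rule subdominated_of_le[OF \<mu>_fm \<nu>_fm restr_atMost_finite_measures restr_le order]) (simp add: sets_\<mu>)

lemma shadow_restr:
  shows "shadow \<nu> (restr \<mu> {..x}) \<in> finite_measures"
    and "shadow \<nu> (restr \<mu> {..x}) \<le> \<nu>"
    and "measure (shadow \<nu> (restr \<mu> {..x})) UNIV = cdf \<mu> x"
    and "(\<integral>y. y \<partial>shadow \<nu> (restr \<mu> {..x})) = (\<integral>y. indicator {..x} y * y \<partial>\<mu>)"
    and "potential (shadow \<nu> (restr \<mu> {..x})) k = potential \<nu> k - shadow_hull \<nu> (restr \<mu> {..x}) k"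
proof -
  note s = is_shadow_shadow[OF restr_atMost_finite_measures \<nu>_fm subdominated_restr, of x]
  then show fm: "shadow \<nu> (restr \<mu> {..x}) \<in> finite_measures" and "shadow \<nu> (restr \<mu> {..x}) \<le> \<nu>"
    by (auto simp: is_shadow_def)
  have "restr \<mu> {..x} \<preceq>\<^sub>C shadow \<nu> (restr \<mu> {..x})" using s by (auto simp: is_shadow_def)
  note o = this[unfolded convex_order_iff[OF restr_atMost_finite_measures fm]]
  show "measure (shadow \<nu> (restr \<mu> {..x})) UNIV = cdf \<mu> x"
    using o measure_restr_UNIV[OF \<mu>_fm, of x] by simp
  have "(\<integral>y. y \<partial>restr \<mu> {..x}) = (\<integral>y. indicator {..x} y * y \<partial>\<mu>)"
    by (rule integral_restr) (auto simp: sets_\<mu> intro!: finite_measures_measurable[OF \<mu>_fm])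
  then show "(\<integral>y. y \<partial>shadow \<nu> (restr \<mu> {..x})) = (\<integral>y. indicator {..x} y * y \<partial>\<mu>)" using o by simp
  show "potential (shadow \<nu> (restr \<mu> {..x})) k = potential \<nu> k - shadow_hull \<nu> (restr \<mu> {..x}) k"
    by (rule potential_shadow[OF restr_atMost_finite_measures \<nu>_fm subdominated_restr])
qed

lemma shadow_restr_mono: "x \<le> x' \<Longrightarrow> shadow \<nu> (restr \<mu> {..x}) \<le> shadow \<nu> (restr \<mu> {..x'})"
  by (intro shadow_mono \<nu>_fm restr_atMost_finite_measures subdominated_restr restr_mono) (auto simp: sets_\<mu>)

lemma left_curtain_exists:
  obtains \<pi> where "is_left_curtain \<mu> \<nu> \<pi>"
proof -
  define S where "S = (\<lambda>x. shadow \<nu> (restr \<mu> {..x}))"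
  interpret \<mu>: real_distribution \<mu> by (rule prob_measures_realD[OF \<mu>])
  interpret \<nu>: real_distribution \<nu> by (rule prob_measures_realD[OF \<nu>])
  have S_fm: "S x \<in> finite_measures" and S_le: "S x \<le> \<nu>" and S_mass: "measure (S x) UNIV = cdf \<mu> x"
    and S_mean: "(\<integral>y. y \<partial>S x) = (\<integral>y. indicator {..x} y * y \<partial>\<mu>)" for x
    using shadow_restr by (auto simp: S_def)
  note sets_S = finite_measuresD(2)[OF S_fm]
  have emS_eq: "emeasure (S x) B = ennreal (measure (S x) B)" for x B
    using finite_measure.emeasure_eq_measure[OF finite_measuresD(1)[OF S_fm]] .
  obtain \<pi> :: "(real \<times> real) measure" where \<pi>: "prob_space \<pi>" "sets \<pi> = sets borel"
    and em: "\<And>x B. B \<in> sets borel \<Longrightarrow> emeasure \<pi> ({..x} \<times> B) = emeasure (S x) B"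
    using coupling_of_increasing_family[OF \<mu>.real_distribution_axioms \<nu>.real_distribution_axioms sets_S _ S_le S_mass]
      shadow_restr_mono unfolding S_def by metis
  interpret \<pi>: prob_space \<pi> by fact
  have space_\<pi>: "space \<pi> = UNIV" using sets_eq_imp_space_eq[OF \<pi>(2)] by simp
  have [measurable_cong]: "sets \<pi> = sets (borel \<Otimes>\<^sub>M borel)" unfolding borel_prod by (rule \<pi>(2))
  have fst_m: "fst \<in> measurable \<pi> borel" and snd_m: "snd \<in> measurable \<pi> borel" by measurable
  have rect: "A \<times> B \<in> sets \<pi>" if "A \<in> sets borel" "B \<in> sets borel" for A B
    using that \<pi>(2) by (auto simp: borel_prod[symmetric])
  have m: "measure \<pi> ({..x} \<times> B) = measure (S x) B" if "B \<in> sets borel" for x B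
    using em[OF that, of x] by (simp add: measure_def)
  have marg1: "marginal1 \<pi> = \<mu>"
  proof (rule cdf_unique')
    interpret d: prob_space "marginal1 \<pi>" by (rule \<pi>.prob_space_distr[OF fst_m])
    show "finite_borel_measure (marginal1 \<pi>)" by unfold_locales simp
    show "cdf (marginal1 \<pi>) = cdf \<mu>"
    proof
      fix x
      have "fst -` {..x} \<inter> space \<pi> = {..x} \<times> (UNIV :: real set)" by (auto simp: space_\<pi>)
      then show "cdf (marginal1 \<pi>) x = cdf \<mu> x"
        unfolding cdf_def using m[of UNIV x] S_mass[of x] by (simp add: measure_distr[OF fst_m] cdf_def)
    qed
  qed unfold_locales
  have marg2: "marginal2 \<pi> = \<nu>"
  proof (rule measure_eqI)
    fix B assume "B \<in> sets (marginal2 \<pi>)"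
    then have B: "B \<in> sets borel" by simp
    have eq: "snd -` B \<inter> space \<pi> = (\<Union>n. {..real n} \<times> B)"
      using real_arch_simple by (auto simp: space_\<pi>)
    have "(\<lambda>n. measure \<pi> ({..real n} \<times> B)) \<longlonglongrightarrow> measure \<pi> (snd -` B \<inter> space \<pi>)"
      unfolding eq using B by (intro \<pi>.finite_Lim_measure_incseq) (auto simp: incseq_def rect)
    moreover have "(\<lambda>n. measure \<pi> ({..real n} \<times> B)) \<longlonglongrightarrow> measure \<nu> B"
    proof (rule tendsto_sandwich[OF _ _ _ tendsto_const])
      have le: "measure (S x) A \<le> measure \<nu> A" for x A
        using le_measureD3[OF S_le, of x A] sets_S by (simp add: emS_eq \<nu>.emeasure_eq_measure)
      show "\<forall>\<^sub>F n in sequentially. measure \<pi> ({..real n} \<times> B) \<le> measure \<nu> B"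
        using le by (simp add: m[OF B])
      \<comment> \<open>The part of \<nu> not covered by \<open>S x\<close> has mass
        \<open>1 - cdf \<mu> x\<close>, which vanishes as \<open>x\<close> grows.\<close>
      have "measure \<nu> B - (1 - cdf \<mu> x) \<le> measure (S x) B" for x
      proof -
        have "measure (S x) (UNIV - B) = cdf \<mu> x - measure (S x) B"
          using finite_measure.finite_measure_compl[OF finite_measuresD(1)[OF S_fm], of B x] B sets_S
            finite_measuresD(3)[OF S_fm] by (simp add: S_mass)
        moreover have "measure \<nu> (UNIV - B) = 1 - measure \<nu> B"
          using \<nu>.prob_compl[of B] B by simp
        ultimately show ?thesis using le[of x "UNIV - B"] by simp
      qed
      then show "\<forall>\<^sub>F n in sequentially. measure \<nu> B - (1 - cdf \<mu> (real n)) \<le> measure \<pi> ({..real n} \<times> B)"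
        by (simp add: m[OF B])
      show "(\<lambda>n. measure \<nu> B - (1 - cdf \<mu> (real n))) \<longlonglongrightarrow> measure \<nu> B"
        using \<mu>.cdf_lim_infty_prob by (auto intro!: tendsto_eq_intros)
    qed
    ultimately have "measure \<pi> (snd -` B \<inter> space \<pi>) = measure \<nu> B" by (rule LIMSEQ_unique)
    then show "emeasure (marginal2 \<pi>) B = emeasure \<nu> B"
      using B by (simp add: emeasure_distr[OF snd_m] \<pi>.emeasure_eq_measure \<nu>.emeasure_eq_measure)
  qed simp
  have int_fst: "integrable \<pi> fst"
    using integrable_finite_measures(3)[OF \<mu>_fm] unfolding marg1[symmetric]
    by (subst (asm) integrable_distr_eq) (auto intro: fst_m)
  have int_snd: "integrable \<pi> snd"
    using integrable_finite_measures(3)[OF \<nu>_fm] unfolding marg2[symmetric]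
    by (subst (asm) integrable_distr_eq) (auto intro: snd_m)
  have norm_m: "norm \<in> borel_measurable \<pi>"
    using \<pi>(2) measurable_cong_sets[OF \<pi>(2) refl] borel_measurable_norm by blast
  have "integrable \<pi> norm"
  proof (rule Bochner_Integration.integrable_bound)
    show "integrable \<pi> (\<lambda>z. \<bar>fst z\<bar> + \<bar>snd z\<bar>)"
      using int_fst int_snd by (intro Bochner_Integration.integrable_add integrable_abs)
    show "AE z in \<pi>. norm (norm z) \<le> norm (\<bar>fst z\<bar> + \<bar>snd z\<bar>)"
      by (intro AE_I2) (simp, metis norm_Pair_le prod.collapse real_norm_def)
  qed (rule norm_m)
  then have \<pi>_prob: "\<pi> \<in> prob_measures" using \<pi> by (simp add: prob_measures_def)
  have curtain: "marginal2 (restr \<pi> ({..x} \<times> UNIV)) = S x" for x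
    by (rule measure_eqI) (auto simp: sets_S emeasure_marginal2_restr[OF \<pi>(2)] em)
  have restr1: "marginal1 (restr \<pi> ({..x} \<times> UNIV)) = restr \<mu> {..x}" for x
  proof (rule measure_eqI)
    fix A assume "A \<in> sets (marginal1 (restr \<pi> ({..x} \<times> UNIV)))"
    then have A: "A \<in> sets borel" by simp
    have fm: "fst \<in> measurable (restr \<pi> ({..x} \<times> UNIV)) borel" by (simp add: restr_def fst_m)
    have "emeasure (marginal1 (restr \<pi> ({..x} \<times> UNIV))) A = emeasure (restr \<pi> ({..x} \<times> UNIV)) (A \<times> UNIV)"
      using A by (subst emeasure_distr[OF fm]) (auto simp: restr_def space_\<pi> intro!: arg_cong[where f = "emeasure _"])
    also have "\<dots> = emeasure \<pi> ({..x} \<times> UNIV \<inter> A \<times> UNIV)"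
      using A by (intro emeasure_restr rect) auto
    also have "{..x} \<times> UNIV \<inter> A \<times> UNIV = fst -` ({..x} \<inter> A) \<inter> space \<pi>" by (auto simp: space_\<pi>)
    also have "emeasure \<pi> \<dots> = emeasure (marginal1 \<pi>) ({..x} \<inter> A)"
      using A by (subst emeasure_distr[OF fst_m]) auto
    also have "\<dots> = emeasure (restr \<mu> {..x}) A" using A by (simp add: marg1 emeasure_restr)
    finally show "emeasure (marginal1 (restr \<pi> ({..x} \<times> UNIV))) A = emeasure (restr \<mu> {..x}) A" .
  qed simp
  \<comment> \<open>\<open>D A\<close> is the integral of \<open>Y - X\<close> over the event
    \<open>X \<in> A\<close>. It vanishes on half-lines because the shadow keeps the mean of the
    restriction; additivity and a Dynkin class argument extend this to Borel sets, which is the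
    martingale property.\<close>
  define D where "D = (\<lambda>A. \<integral>z. indicator A (fst z) * (snd z - fst z) \<partial>\<pi>)"
  have int_D: "integrable \<pi> (\<lambda>z. indicator A (fst z) * (snd z - fst z))" if "A \<in> sets borel" for A
  proof -
    have "integrable \<pi> (\<lambda>z. indicator (fst -` A \<inter> space \<pi>) z *\<^sub>R (snd z - fst z))"
      using int_fst int_snd that fst_m
      by (intro integrable_mult_indicator Bochner_Integration.integrable_diff measurable_sets[of fst \<pi> borel]) auto
    then show ?thesis by (rule Bochner_Integration.integrable_cong[THEN iffD1, rotated 2]) (auto simp: indicator_def)
  qed
  have D_atMost: "D {..x} = 0" for x
  proof -
    have i: "integrable \<pi> (\<lambda>z. indicator {..x} (fst z) * f z)" if "integrable \<pi> f" for f :: "real \<times> real \<Rightarrow> real"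
    proof -
      have "integrable \<pi> (\<lambda>z. indicator (fst -` {..x} \<inter> space \<pi>) z *\<^sub>R f z)"
        using that fst_m by (intro integrable_mult_indicator measurable_sets[of fst \<pi> borel]) auto
      then show ?thesis by (rule Bochner_Integration.integrable_cong[THEN iffD1, rotated 2]) (auto simp: indicator_def)
    qed
    have ind: "indicator ({..x} \<times> UNIV) z = (indicator {..x} (fst z) :: real)" for z :: "real \<times> real"
      by (auto simp: indicator_def mem_Times_iff)
    have "D {..x} = (\<integral>z. indicator {..x} (fst z) * snd z - indicator {..x} (fst z) * fst z \<partial>\<pi>)"
      unfolding D_def by (simp add: right_diff_distrib)
    also have "\<dots> = (\<integral>z. indicator {..x} (fst z) * snd z \<partial>\<pi>) - (\<integral>z. indicator {..x} (fst z) * fst z \<partial>\<pi>)"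
      by (intro Bochner_Integration.integral_diff i int_fst int_snd)
    also have "(\<integral>z. indicator {..x} (fst z) * snd z \<partial>\<pi>) = (\<integral>z. snd z \<partial>restr \<pi> ({..x} \<times> UNIV))"
      by (subst integral_restr) (auto simp: ind rect snd_m)
    also have "\<dots> = (\<integral>y. y \<partial>S x)"
      unfolding curtain[symmetric] by (subst integral_distr) (auto simp: restr_def snd_m)
    also have "\<dots> = (\<integral>y. indicator {..x} y * y \<partial>marginal1 \<pi>)" unfolding S_mean marg1 ..
    also have "\<dots> = (\<integral>z. indicator {..x} (fst z) * fst z \<partial>\<pi>)"
      by (subst integral_distr[OF fst_m]) auto
    finally show ?thesis by simp
  qed
  \<comment> \<open>Complements in the Dynkin class argument require the total integral to vanish
    too.\<close>
  have D_UNIV: "D UNIV = 0"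
  proof (rule LIMSEQ_unique)
    show "(\<lambda>n. D {..real n}) \<longlonglongrightarrow> 0" by (simp add: D_atMost)
    show "(\<lambda>n. D {..real n}) \<longlonglongrightarrow> D UNIV"
      unfolding D_def
    proof (rule integral_dominated_convergence[where w = "\<lambda>z. \<bar>snd z - fst z\<bar>"])
      show "AE z in \<pi>. (\<lambda>n. indicator {..real n} (fst z) * (snd z - fst z)) \<longlonglongrightarrow> indicator UNIV (fst z) * (snd z - fst z)"
      proof (rule AE_I2)
        fix z :: "real \<times> real"
        obtain N :: nat where N: "fst z \<le> real N" using real_arch_simple by blast
        have "\<forall>\<^sub>F n in sequentially. indicator {..real n} (fst z) * (snd z - fst z) = indicator UNIV (fst z) * (snd z - fst z)"
          using eventually_ge_at_top[of N] by eventually_elim (use N in \<open>auto simp: indicator_def\<close>)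
        then show "(\<lambda>n. indicator {..real n} (fst z) * (snd z - fst z)) \<longlonglongrightarrow> indicator UNIV (fst z) * (snd z - fst z)"
          by (rule tendsto_eventually)
      qed
      show "integrable \<pi> (\<lambda>z. \<bar>snd z - fst z\<bar>)" using int_fst int_snd by auto
      show "AE z in \<pi>. norm (indicator {..real n} (fst z) * (snd z - fst z)) \<le> \<bar>snd z - fst z\<bar>" for n
        by (auto simp: indicator_def)
    qed (use int_D in \<open>auto dest: borel_measurable_integrable\<close>)
  qed
  have D0: "D A = 0" if "A \<in> sets borel" for A
  proof -
    have "Int_stable (range atMost :: real set set)" by (auto simp: Int_stable_def)
    moreover have "(range atMost :: real set set) \<subseteq> Pow UNIV" by simp
    moreover have "A \<in> sigma_sets UNIV (range atMost)" using that by (simp add: borel_eq_atMost)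
    ultimately show ?thesis
    proof (induct rule: sigma_sets_induct_disjoint)
      fix A :: "real set" assume "A \<in> sigma_sets UNIV (range atMost)" and 0: "D A = 0"
      then have A: "A \<in> sets borel" by (simp add: borel_eq_atMost)
      have "D (UNIV - A) = (\<integral>z. indicator UNIV (fst z) * (snd z - fst z) - indicator A (fst z) * (snd z - fst z) \<partial>\<pi>)"
        unfolding D_def by (intro Bochner_Integration.integral_cong) (auto simp: indicator_def)
      also have "\<dots> = D UNIV - D A" unfolding D_def
        using A by (intro Bochner_Integration.integral_diff int_D) auto
      finally show "D (UNIV - A) = 0" using 0 D_UNIV by simp
    next
      fix A :: "nat \<Rightarrow> real set"
      assume dis: "disjoint_family A" and A: "range A \<subseteq> sigma_sets UNIV (range atMost)" and 0: "\<And>i. D (A i) = 0"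
      have A: "A i \<in> sets borel" for i using A by (auto simp: borel_eq_atMost)
      let ?B = "\<lambda>n. \<Union>i<n. A i"
      have Dn: "D (?B n) = 0" for n
      proof (induction n)
        case (Suc n)
        have "A n \<inter> A i = {}" if "i < n" for i
          using dis that by (intro disjoint_family_onD) auto
        then have "A n \<inter> ?B n = {}" by auto
        then have "D (?B (Suc n)) = (\<integral>z. indicator (A n) (fst z) * (snd z - fst z) + indicator (?B n) (fst z) * (snd z - fst z) \<partial>\<pi>)"
          unfolding D_def lessThan_Suc by (intro Bochner_Integration.integral_cong) (auto simp: indicator_def)
        also have "\<dots> = D (A n) + D (?B n)" unfolding D_def
          using A by (intro Bochner_Integration.integral_add int_D) auto
        finally show ?case using 0 Suc by simp
      qed (simp add: D_def)
      show "D (\<Union>i. A i) = 0"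
      proof (rule LIMSEQ_unique)
        show "(\<lambda>n. D (?B n)) \<longlonglongrightarrow> 0" by (simp add: Dn)
        show "(\<lambda>n. D (?B n)) \<longlonglongrightarrow> D (\<Union>i. A i)"
          unfolding D_def
        proof (rule integral_dominated_convergence[where w = "\<lambda>z. \<bar>snd z - fst z\<bar>"])
          show "AE z in \<pi>. (\<lambda>n. indicator (?B n) (fst z) * (snd z - fst z)) \<longlonglongrightarrow> indicator (\<Union>i. A i) (fst z) * (snd z - fst z)"
            by (intro AE_I2 tendsto_mult tendsto_const LIMSEQ_indicator_UN)
          show "integrable \<pi> (\<lambda>z. \<bar>snd z - fst z\<bar>)" using int_fst int_snd by auto
          show "AE z in \<pi>. norm (indicator (?B n) (fst z) * (snd z - fst z)) \<le> \<bar>snd z - fst z\<bar>" for n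
            by (auto simp: indicator_def)
        qed (use int_D A in \<open>auto intro!: borel_measurable_integrable[OF int_D]\<close>)
      qed
    qed (use D_atMost in auto, simp add: D_def)
  qed
  have sub: "subalgebra \<pi> (vimage_algebra UNIV fst borel)"
    unfolding subalgebra_def
  proof
    show "sets (vimage_algebra UNIV fst borel) \<subseteq> sets \<pi>"
      using measurable_sets[OF fst_m] by (auto simp: sets_vimage_algebra2 space_\<pi>)
  qed (simp add: space_\<pi>)
  interpret F: finite_measure_subalgebra \<pi> "vimage_algebra UNIV fst borel"
    by unfold_locales (rule sub)
  have "AE z in \<pi>. real_cond_exp \<pi> (vimage_algebra UNIV fst borel) snd z = fst z"
  proof (rule F.real_cond_exp_charact[OF _ int_snd int_fst])
    show "fst \<in> borel_measurable (vimage_algebra UNIV fst borel)"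
      by (rule measurable_vimage_algebra1) simp
    fix C assume "C \<in> sets (vimage_algebra UNIV fst (borel :: real measure) :: (real \<times> real) measure)"
    then obtain A where A: "A \<in> sets borel" "C = fst -` A" by (auto simp: sets_vimage_algebra2)
    have C: "C \<in> sets \<pi>" using A measurable_sets[OF fst_m A(1)] by (simp add: space_\<pi>)
    have "(\<integral>z\<in>C. snd z \<partial>\<pi>) - (\<integral>z\<in>C. fst z \<partial>\<pi>) = (\<integral>z\<in>C. snd z - fst z \<partial>\<pi>)"
      using int_fst int_snd C
      by (intro set_integral_diff(2)[symmetric]) (simp_all only: set_integrable_def integrable_mult_indicator)
    also have "\<dots> = D A" unfolding D_def set_lebesgue_integral_def A(2)
      by (intro Bochner_Integration.integral_cong) (auto simp: indicator_def)
    finally show "(\<integral>z\<in>C. snd z \<partial>\<pi>) = (\<integral>z\<in>C. fst z \<partial>\<pi>)" using D0[OF A(1)] by simp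
  qed
  then have "\<pi> \<in> martingale_couplings \<mu> \<nu>"
    using \<pi>_prob marg1 marg2 by (simp add: martingale_couplings_def)
  then have "is_left_curtain \<mu> \<nu> \<pi>"
    using restr1 curtain by (simp add: is_left_curtain_def S_def)
  then show ?thesis by (rule that)
qed

lemma is_left_curtain_Curt: "is_left_curtain \<mu> \<nu> (Curt (\<mu>, \<nu>))"
proof -
  obtain \<pi> where \<pi>: "is_left_curtain \<mu> \<nu> \<pi>" by (rule left_curtain_exists)
  show ?thesis
    unfolding Curt_def prod.case by (rule theI[of "is_left_curtain \<mu> \<nu>", OF \<pi> is_left_curtain_unique[OF _ \<pi>]])
qed

end

section \<open>Weak convergence in the plane\<close>

text \<open>Supplies a single shift for which every point of a rational grid avoids the countably
  many coordinates where quadrant masses need not converge.\<close>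

lemma countable_avoiding_rational_shifts:
  assumes "countable (C :: real set)"
  obtains \<theta> where "\<And>q. q \<in> \<rat> \<Longrightarrow> \<theta> + q \<notin> C"
proof -
  have "countable (\<Union>q\<in>\<rat>. (\<lambda>c. c - q) ` C)"
    using assms by (intro countable_UN countable_rat countable_image)
  then have "(\<Union>q\<in>\<rat>. (\<lambda>c. c - q) ` C) \<noteq> UNIV" using uncountable_UNIV_real by metis
  then obtain \<theta> where \<theta>: "\<theta> \<notin> (\<Union>q\<in>\<rat>. (\<lambda>c. c - q) ` C)" by blast
  have "\<theta> + q \<notin> C" if "q \<in> \<rat>" for q
  proof
    assume "\<theta> + q \<in> C"
    then have "\<theta> \<in> (\<lambda>c. c - q) ` C" by (auto intro!: image_eqI[of _ _ "\<theta> + q"])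
    with \<theta> that show False by blast
  qed
  then show ?thesis by (rule that)
qed

lemma measure_half_open_rectangle:
  fixes P :: "(real \<times> real) measure"
  assumes P: "prob_space P" "sets P = sets borel" and le: "a \<le> b" "c \<le> d"
  shows "measure P ({a<..b} \<times> {c<..d}) = measure P ({..b} \<times> {..d}) - measure P ({..a} \<times> {..d})
    - (measure P ({..b} \<times> {..c}) - measure P ({..a} \<times> {..c}))"
proof -
  interpret prob_space P by fact
  have rect: "A \<times> B \<in> sets P" if "A \<in> sets borel" "B \<in> sets borel" for A B
    using that P(2) by (auto simp: borel_prod[symmetric])
  have strip: "measure P ({a<..b} \<times> {..t}) = measure P ({..b} \<times> {..t}) - measure P ({..a} \<times> {..t})" for t
  proof -
    have "{a<..b} \<times> {..t} = {..b} \<times> {..t} - {..a} \<times> {..t}" by auto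
    then show ?thesis using le rect by (simp add: finite_measure_Diff Sigma_mono)
  qed
  have "{a<..b} \<times> {c<..d} = {a<..b} \<times> {..d} - {a<..b} \<times> {..c}" by auto
  then have "measure P ({a<..b} \<times> {c<..d}) = measure P ({a<..b} \<times> {..d}) - measure P ({a<..b} \<times> {..c})"
    using le rect by (simp add: finite_measure_Diff Sigma_mono)
  then show ?thesis by (simp add: strip)
qed

section \<open>Step functions on a mesh\<close>

definition mesh :: "real \<Rightarrow> nat \<Rightarrow> nat \<Rightarrow> nat \<Rightarrow> real" where
  "mesh \<theta> N m j = \<theta> - real N + real j / real m"

text \<open>With indices below \<open>2 * N * m\<close> the half-open cells tile the box of points
  with both coordinates in \<open>{\<theta> - N<..\<theta> + N}\<close>, and all corner coordinates
  are rational shifts of \<theta>.\<close>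

definition mesh_cell :: "real \<Rightarrow> nat \<Rightarrow> nat \<Rightarrow> nat \<times> nat \<Rightarrow> (real \<times> real) set" where
  "mesh_cell \<theta> N m p = {mesh \<theta> N m (fst p)<..mesh \<theta> N m (Suc (fst p))}
     \<times> {mesh \<theta> N m (snd p)<..mesh \<theta> N m (Suc (snd p))}"

lemma mesh_approximation:
  fixes f :: "real \<times> real \<Rightarrow> real"
  assumes f: "continuous_on UNIV f" and e: "e > 0"
  obtains m :: nat where "m > 0"
    "\<And>z. z \<in> {\<theta> - real N<..\<theta> + real N} \<times> {\<theta> - real N<..\<theta> + real N} \<Longrightarrow>
      \<bar>f z - (\<Sum>p\<in>{..<2 * N * m} \<times> {..<2 * N * m}.
         f (mesh \<theta> N m (Suc (fst p)), mesh \<theta> N m (Suc (snd p))) * indicator (mesh_cell \<theta> N m p) z)\<bar> < e"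
proof -
  let ?I = "{\<theta> - real N..\<theta> + real N}"
  have "uniformly_continuous_on (?I \<times> ?I) f"
    by (intro compact_uniformly_continuous compact_Times compact_Icc continuous_on_subset[OF f]) simp
  then obtain d where d: "d > 0" "\<And>z z'. z \<in> ?I \<times> ?I \<Longrightarrow> z' \<in> ?I \<times> ?I \<Longrightarrow> dist z' z < d \<Longrightarrow> dist (f z') (f z) < e"
    using e unfolding uniformly_continuous_on_def by metis
  \<comment> \<open>A point differs from the upper right corner of its cell by at most
    \<open>1 / m\<close> in each coordinate, hence the \<open>2\<close>.\<close>
  obtain m :: nat where m: "m > 0" "2 / real m < d"
  proof -
    obtain m :: nat where "2 / d < real m" using reals_Archimedean2 by blast
    moreover have "2 / d > 0" using d by simp
    ultimately have "real m > 0" by linarith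
    then show ?thesis using \<open>2 / d < real m\<close> d by (intro that[of m]) (auto simp: field_simps)
  qed
  define a where "a = mesh \<theta> N m"
  have a_eq: "a j = \<theta> - real N + real j / real m" for j by (simp add: a_def mesh_def)
  have cell: "\<exists>j<2 * N * m. \<forall>i. x \<in> {a i<..a (Suc i)} \<longleftrightarrow> i = j" if x: "x \<in> {\<theta> - real N<..\<theta> + real N}" for x
  proof -
    \<comment> \<open>Rescaling turns the cells into \<open>{i<..i + 1}\<close>; as these are closed
      on the right, the index is \<open>\<lceil>t\<rceil> - 1\<close>.\<close>
    define t where "t = (x - (\<theta> - N)) * m"
    have "0 < t" using x m by (simp add: t_def)
    have "t \<le> (2 * real N) * m" unfolding t_def using x m by (intro mult_right_mono) auto
    then have t2: "t \<le> real (2 * N * m)" by simp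
    have in_iff: "x \<in> {a i<..a (Suc i)} \<longleftrightarrow> \<lceil>t\<rceil> = int i + 1" for i
      using m by (auto simp: a_eq t_def ceiling_eq_iff field_simps)
    have "0 < \<lceil>t\<rceil>" using \<open>0 < t\<close> by simp
    moreover have "\<lceil>t\<rceil> \<le> int (2 * N * m)" using t2 by (simp add: ceiling_le_iff)
    ultimately have "nat (\<lceil>t\<rceil> - 1) < 2 * N * m" "\<lceil>t\<rceil> = int (nat (\<lceil>t\<rceil> - 1)) + 1" by linarith+
    then show ?thesis unfolding in_iff by (metis add_right_cancel of_nat_eq_iff)
  qed
  show ?thesis
  proof (rule that[OF m(1)])
    fix z assume z: "z \<in> {\<theta> - real N<..\<theta> + real N} \<times> {\<theta> - real N<..\<theta> + real N}"
    obtain x y where xy: "z = (x, y)" by (cases z)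
    have x: "x \<in> {\<theta> - real N<..\<theta> + real N}" and y: "y \<in> {\<theta> - real N<..\<theta> + real N}"
      using z by (auto simp: xy)
    obtain j where j: "j < 2 * N * m" "\<And>i. x \<in> {a i<..a (Suc i)} \<longleftrightarrow> i = j" using cell[OF x] by blast
    obtain k where k: "k < 2 * N * m" "\<And>i. y \<in> {a i<..a (Suc i)} \<longleftrightarrow> i = k" using cell[OF y] by blast
    let ?K = "{..<2 * N * m} \<times> {..<2 * N * m}"
    have "(\<Sum>p\<in>?K. f (a (Suc (fst p)), a (Suc (snd p))) * indicator (mesh_cell \<theta> N m p) (x, y))
        = (\<Sum>p\<in>?K. if p = (j, k) then f (a (Suc j), a (Suc k)) else 0)"
    proof (intro sum.cong refl)
      fix p assume "p \<in> ?K"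
      have "(x, y) \<in> mesh_cell \<theta> N m p \<longleftrightarrow> p = (j, k)"
        using j(2)[of "fst p"] k(2)[of "snd p"]
        by (cases p) (simp add: mesh_cell_def a_def)
      then show "f (a (Suc (fst p)), a (Suc (snd p))) * indicator (mesh_cell \<theta> N m p) (x, y)
        = (if p = (j, k) then f (a (Suc j), a (Suc k)) else 0)"
        by (auto simp: indicator_def)
    qed
    also have "\<dots> = f (a (Suc j), a (Suc k))" using j(1) k(1) by (subst sum.delta) auto
    finally have eq: "(\<Sum>p\<in>?K. f (a (Suc (fst p)), a (Suc (snd p))) * indicator (mesh_cell \<theta> N m p) (x, y))
        = f (a (Suc j), a (Suc k))" .
    have near: "\<bar>x - a (Suc j)\<bar> \<le> 1 / m" "\<bar>y - a (Suc k)\<bar> \<le> 1 / m"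
      using j(2)[of j] k(2)[of k] by (auto simp: a_eq add_divide_distrib)
    have "dist (x, y) (a (Suc j), a (Suc k)) \<le> \<bar>x - a (Suc j)\<bar> + \<bar>y - a (Suc k)\<bar>"
      using norm_Pair_le[of "x - a (Suc j)" "y - a (Suc k)"] by (simp add: dist_norm)
    also have "\<dots> < d" using near m(2) by simp
    finally have close: "dist (x, y) (a (Suc j), a (Suc k)) < d" .
    have aI: "a (Suc i) \<in> ?I" if "i < 2 * N * m" for i
    proof -
      have "real (Suc i) \<le> real (2 * N * m)" using that by (simp only: of_nat_le_iff Suc_le_eq)
      then have "real (Suc i) / m \<le> 2 * real N" using m by (simp add: field_simps)
      then show ?thesis by (simp add: a_eq del: of_nat_Suc)
    qed
    have "dist (f (x, y)) (f (a (Suc j), a (Suc k))) < e"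
      using x y aI[OF j(1)] aI[OF k(1)] by (intro d(2) close) auto
    then show "\<bar>f z - (\<Sum>p\<in>?K.
         f (mesh \<theta> N m (Suc (fst p)), mesh \<theta> N m (Suc (snd p))) * indicator (mesh_cell \<theta> N m p) z)\<bar> < e"
      using eq by (simp add: a_def xy dist_real_def)
  qed
qed

text \<open>Tightness comes from the limit: a box with almost all mass of \<open>Q\<close>
  eventually has almost all mass of \<open>P i\<close>, as its corners avoid \<open>C\<close>. On
  the box \<open>f\<close> is replaced by a step function whose integral is a finite combination of
  quadrant masses.\<close>

lemma weak_convergence_of_quadrants:
  fixes P :: "'i \<Rightarrow> (real \<times> real) measure"
  assumes P: "\<And>i. prob_space (P i)" "\<And>i. sets (P i) = sets borel" and Q: "prob_space Q" "sets Q = sets borel"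
    and C: "countable C"
    and lim: "\<And>x y. x \<notin> C \<Longrightarrow> y \<notin> C \<Longrightarrow> ((\<lambda>i. measure (P i) ({..x} \<times> {..y})) \<longlongrightarrow> measure Q ({..x} \<times> {..y})) L"
    and f: "continuous_on UNIV f" "\<And>z. \<bar>f z\<bar> \<le> (M :: real)"
  shows "((\<lambda>i. \<integral>z. f z \<partial>P i) \<longlongrightarrow> (\<integral>z. f z \<partial>Q)) L"
proof (rule tendstoI)
  fix \<epsilon> :: real assume \<epsilon>: "\<epsilon> > 0"
  have M: "M \<ge> 0" using f(2)[of undefined] by linarith
  \<comment> \<open>\<open>e\<close> bounds both the error inside the box and the mass outside,
    where \<bar>f\<bar> is at most \<open>M\<close>. The \<open>+ 2\<close> makes
    \<open>e + M * e\<close> strictly smaller than \<open>\<epsilon> / 3\<close>.\<close>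
  define e where "e = \<epsilon> / (3 * (M + 2))"
  have e: "e > 0" using \<epsilon> M by (simp add: e_def)
  have e3: "e + M * e < \<epsilon> / 3"
  proof -
    have "e * (M + 2) = \<epsilon> / 3" using M by (simp add: e_def field_simps)
    then show ?thesis using e by (simp add: algebra_simps)
  qed
  obtain \<theta> where \<theta>: "\<And>q. q \<in> \<rat> \<Longrightarrow> \<theta> + q \<notin> C" using countable_avoiding_rational_shifts[OF C] by blast
  have rect_lim: "((\<lambda>i. measure (P i) ({a<..b} \<times> {c<..d})) \<longlongrightarrow> measure Q ({a<..b} \<times> {c<..d})) L"
    if "a \<notin> C" "b \<notin> C" "c \<notin> C" "d \<notin> C" "a \<le> b" "c \<le> d" for a b c d
    unfolding measure_half_open_rectangle[OF P that(5,6)] measure_half_open_rectangle[OF Q that(5,6)]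
    by (intro tendsto_intros lim that)
  interpret Q: prob_space Q by fact
  have space_Q: "space Q = UNIV" using sets_eq_imp_space_eq[OF Q(2)] by simp
  have rect: "A \<times> B \<in> sets (borel :: (real \<times> real) measure)" if "A \<in> sets borel" "B \<in> sets borel" for A B :: "real set"
    using that by (auto simp: borel_prod[symmetric])
  define box where "box = (\<lambda>N::nat. {\<theta> - N<..\<theta> + N} \<times> {\<theta> - N<..\<theta> + N})"
  have box_meas: "box N \<in> sets borel" for N by (simp add: box_def rect)
  have "(\<lambda>N. measure Q (box N)) \<longlonglongrightarrow> measure Q (\<Union>N. box N)"
    using box_meas Q(2) by (intro Q.finite_Lim_measure_incseq) (auto simp: incseq_def box_def)
  also have "(\<Union>N. box N) = UNIV"
  proof (intro equalityI subset_UNIV subsetI)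
    fix z :: "real \<times> real"
    obtain N :: nat where "max \<bar>fst z - \<theta>\<bar> \<bar>snd z - \<theta>\<bar> < real N" using reals_Archimedean2 by blast
    then have "z \<in> box N" by (cases z) (auto simp: box_def)
    then show "z \<in> (\<Union>N. box N)" by blast
  qed
  finally have "(\<lambda>N. measure Q (box N)) \<longlonglongrightarrow> 1" using Q.prob_space by (simp add: space_Q)
  then have "\<forall>\<^sub>F N in sequentially. 1 - e < measure Q (box N)" using e by (intro order_tendstoD(1)) auto
  then obtain N where N: "1 - e < measure Q (box N)" by (auto simp: eventually_sequentially)
  define K where "K = (\<lambda>m. {..<2 * N * m} \<times> {..<2 * N * m})"
  obtain m :: nat where m: "m > 0" and approx: "\<And>z. z \<in> box N \<Longrightarrow>
      \<bar>f z - (\<Sum>p\<in>K m. f (mesh \<theta> N m (Suc (fst p)), mesh \<theta> N m (Suc (snd p))) * indicator (mesh_cell \<theta> N m p) z)\<bar> < e"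
    by (rule mesh_approximation[OF f(1) e, of \<theta> N], rule that) (simp_all only: box_def K_def)
  define a where "a = mesh \<theta> N m"
  have a_eq: "a j = \<theta> - real N + real j / real m" for j by (simp add: a_def mesh_def)
  define R where "R = (\<lambda>p. {a (fst p)<..a (Suc (fst p))} \<times> {a (snd p)<..a (Suc (snd p))})"
  define v where "v = (\<lambda>p. f (a (Suc (fst p)), a (Suc (snd p))))"
  have approx: "\<bar>f z - (\<Sum>p\<in>K m. v p * indicator (R p) z)\<bar> < e" if "z \<in> box N" for z
    using approx[OF that] by (simp add: v_def R_def a_def mesh_cell_def)
  define s where "s = (\<lambda>z. \<Sum>p\<in>K m. v p * indicator (R p) z)"
  have R_box: "R p \<subseteq> box N" if "p \<in> K m" for p
  proof -
    have "a (Suc j) \<le> \<theta> + N" if "j < 2 * N * m" for j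
    proof -
      have "real (Suc j) \<le> real (2 * N * m)" using that by (simp only: of_nat_le_iff Suc_le_eq)
      then have "real (Suc j) / m \<le> 2 * real N" using m by (simp add: field_simps)
      then show ?thesis by (simp add: a_eq del: of_nat_Suc)
    qed
    moreover have "\<theta> - N \<le> a j" for j by (simp add: a_eq)
    ultimately have sub: "{a j<..a (Suc j)} \<subseteq> {\<theta> - N<..\<theta> + N}" if "j < 2 * N * m" for j
      using that by (intro subsetI) (auto intro: order_le_less_trans order_trans)
    have "fst p < 2 * N * m" "snd p < 2 * N * m" using that by (auto simp: K_def)
    then show ?thesis unfolding R_def box_def by (intro Sigma_mono sub)
  qed
  have a_C: "a j \<notin> C" for j
  proof -
    have "a j = \<theta> + (real j / real m - real N)" by (simp add: a_eq)
    also have "\<dots> \<notin> C" by (intro \<theta> Rats_diff Rats_divide) auto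
    finally show ?thesis .
  qed
  have a_mono: "a j \<le> a (Suc j)" for j by (simp add: a_eq divide_right_mono)
  have R_meas: "R p \<in> sets borel" for p by (simp add: R_def rect)
  have error: "\<bar>(\<integral>z. f z \<partial>W) - (\<Sum>p\<in>K m. v p * measure W (R p))\<bar> < \<epsilon> / 3"
    if W: "prob_space W" "sets W = sets borel" and tight: "1 - e < measure W (box N)" for W
  proof -
    interpret W: prob_space W by fact
    have space_W: "space W = UNIV" using sets_eq_imp_space_eq[OF W(2)] by simp
    have f_int: "integrable W f"
      using f(2) borel_measurable_continuous_onI[OF f(1)] measurable_cong_sets[OF W(2) refl]
      by (intro W.integrable_const_bound[of _ M]) auto
    have ind: "integrable W (\<lambda>z. indicator A z :: real)" if "A \<in> sets borel" for A
      using that W(2) by (simp add: W.emeasure_finite less_top[symmetric])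
    have s_int: "integrable W s" unfolding s_def
      by (intro Bochner_Integration.integrable_sum integrable_mult_right ind R_meas)
    have "(\<integral>z. s z \<partial>W) = (\<Sum>p\<in>K m. v p * measure W (R p))"
      unfolding s_def
      by (subst Bochner_Integration.integral_sum) (auto intro!: integrable_mult_right ind R_meas simp: space_W)
    then have "\<bar>(\<integral>z. f z \<partial>W) - (\<Sum>p\<in>K m. v p * measure W (R p))\<bar> = \<bar>\<integral>z. f z - s z \<partial>W\<bar>"
      using f_int s_int by simp
    also have "\<dots> \<le> (\<integral>z. \<bar>f z - s z\<bar> \<partial>W)" by (rule integral_abs_bound)
    also have "\<dots> \<le> (\<integral>z. e + M * indicator (- box N) z \<partial>W)"
    proof (rule integral_mono)
      show "integrable W (\<lambda>z. \<bar>f z - s z\<bar>)" using f_int s_int by auto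
      show "integrable W (\<lambda>z. e + M * indicator (- box N) z)"
        using box_meas by (intro Bochner_Integration.integrable_add integrable_mult_right ind) auto
      fix z
      show "\<bar>f z - s z\<bar> \<le> e + M * indicator (- box N) z"
      proof (cases "z \<in> box N")
        case True
        then show ?thesis using approx[OF True] by (simp add: s_def)
      next
        case False
        then have "s z = 0" using R_box unfolding s_def by (intro sum.neutral) (auto simp: indicator_def)
        then show ?thesis using False f(2)[of z] e by simp
      qed
    qed
    also have "\<dots> = e + M * measure W (- box N)"
      using box_meas W.prob_space
      by (subst Bochner_Integration.integral_add) (auto intro!: integrable_mult_right ind simp: space_W)
    also have "\<dots> \<le> e + M * e"
    proof -
      have "measure W (- box N) = 1 - measure W (box N)"
        using W.prob_compl[of "box N"] box_meas W(2) by (simp add: space_W Compl_eq_Diff_UNIV)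
      then show ?thesis using tight M by (intro add_left_mono mult_left_mono) auto
    qed
    finally show ?thesis using e3 by simp
  qed
  have "((\<lambda>i. \<Sum>p\<in>K m. v p * measure (P i) (R p)) \<longlongrightarrow> (\<Sum>p\<in>K m. v p * measure Q (R p))) L"
  proof (intro tendsto_sum tendsto_mult tendsto_const)
    fix p
    show "((\<lambda>i. measure (P i) (R p)) \<longlongrightarrow> measure Q (R p)) L"
      unfolding R_def by (intro rect_lim a_C a_mono)
  qed
  then have "\<forall>\<^sub>F i in L. dist (\<Sum>p\<in>K m. v p * measure (P i) (R p)) (\<Sum>p\<in>K m. v p * measure Q (R p)) < \<epsilon> / 3"
    using \<epsilon> by (intro tendstoD) auto
  moreover have "\<forall>\<^sub>F i in L. 1 - e < measure (P i) (box N)"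
  proof (rule order_tendstoD(1)[OF _ N])
    have "\<theta> + real N \<notin> C" "\<theta> - real N \<notin> C" using \<theta>[of "real N"] \<theta>[of "- real N"] by auto
    then show "((\<lambda>i. measure (P i) (box N)) \<longlongrightarrow> measure Q (box N)) L"
      unfolding box_def by (intro rect_lim) auto
  qed
  ultimately show "\<forall>\<^sub>F i in L. dist (\<integral>z. f z \<partial>P i) (\<integral>z. f z \<partial>Q) < \<epsilon>"
  proof eventually_elim
    case (elim i)
    then show ?case using error[OF P elim(2)] error[OF Q N] unfolding dist_real_def by linarith
  qed
qed

section \<open>Continuity of the left-curtain coupling\<close>

lemma measure_left_curtain_quadrant:
  assumes D: "(\<mu>, \<nu>) \<in> curtain_domain"
  shows "measure (Curt (\<mu>, \<nu>)) ({..x} \<times> {..y}) = cdf (shadow \<nu> (restr \<mu> {..x})) y"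
proof -
  have "is_left_curtain \<mu> \<nu> (Curt (\<mu>, \<nu>))"
    using D by (intro is_left_curtain_Curt) (auto simp: curtain_domain_def)
  from is_left_curtainD[OF this] show ?thesis by (simp add: measure_def cdf_def)
qed

text \<open>The part of \<nu> outside the shadow has mass \<open>1 - cdf \<mu> x\<close>. This
  settles convergence where \<open>cdf \<mu>0 x = 1\<close>.\<close>

lemma cdf_shadow_bounds:
  assumes \<mu>: "\<mu> \<in> prob_measures" and \<nu>: "\<nu> \<in> prob_measures" and order: "\<mu> \<preceq>\<^sub>C \<nu>"
  shows "cdf (shadow \<nu> (restr \<mu> {..x})) y \<le> cdf \<nu> y"
    and "cdf \<nu> y - (1 - cdf \<mu> x) \<le> cdf (shadow \<nu> (restr \<mu> {..x})) y"
proof -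
  interpret \<nu>: real_distribution \<nu> by (rule prob_measures_realD[OF \<nu>])
  note S = shadow_restr(1-3)[OF \<mu> \<nu> order, of x]
  interpret S: finite_borel_measure "shadow \<nu> (restr \<mu> {..x})" by (rule finite_measuresD(5)[OF S(1)])
  have le: "measure (shadow \<nu> (restr \<mu> {..x})) A \<le> measure \<nu> A" for A
    using le_measureD3[OF S(2), of A] S.M_is_borel by (simp add: S.emeasure_eq_measure \<nu>.emeasure_eq_measure)
  show "cdf (shadow \<nu> (restr \<mu> {..x})) y \<le> cdf \<nu> y" using le by (simp add: cdf_def)
  have "measure (shadow \<nu> (restr \<mu> {..x})) (UNIV - {..y}) = cdf \<mu> x - cdf (shadow \<nu> (restr \<mu> {..x})) y"
    using S.finite_measure_compl[of "{..y}"] S.M_is_borel S(3) by (simp add: S.borel_UNIV cdf_def)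
  moreover have "measure \<nu> (UNIV - {..y}) = 1 - cdf \<nu> y"
    using \<nu>.prob_compl[of "{..y}"] by (simp add: cdf_def)
  ultimately show "cdf \<nu> y - (1 - cdf \<mu> x) \<le> cdf (shadow \<nu> (restr \<mu> {..x})) y"
    using le[of "UNIV - {..y}"] by simp
qed

text \<open>Weak convergence alone allows first moments to escape; potentials converge only up to
  additive constants.\<close>

lemma potential_tendsto:
  fixes P :: "'i \<Rightarrow> real measure"
  assumes P: "\<And>i. P i \<in> finite_measures" "P0 \<in> finite_measures"
    and weak: "\<And>f. continuous_on UNIV f \<Longrightarrow> bounded (range f) \<Longrightarrow>
        ((\<lambda>i. \<integral>x. f x \<partial>P i) \<longlongrightarrow> (\<integral>x. f x \<partial>P0 :: real)) L"
  shows "((\<lambda>i. potential (P i) k - (potential (P i) 0 - potential P0 0)) \<longlongrightarrow> potential P0 k) L"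
proof -
  \<comment> \<open>Subtracting the test function for \<open>0\<close> leaves a function bounded by
    \<open>\<bar>k\<bar>\<close>.\<close>
  let ?f = "\<lambda>x. max 0 (k - x) - max 0 (0 - x)"
  have eq: "(\<integral>x. ?f x \<partial>Q) = potential Q k - potential Q 0" if "Q \<in> finite_measures" for Q
    unfolding potential_def by (intro Bochner_Integration.integral_diff integrable_finite_measures[OF that])
  have "((\<lambda>i. \<integral>x. ?f x \<partial>P i) \<longlongrightarrow> (\<integral>x. ?f x \<partial>P0)) L"
  proof (rule weak)
    show "bounded (range ?f)" by (rule boundedI[of _ "\<bar>k\<bar>"]) auto
  qed (intro continuous_intros)
  then have "((\<lambda>i. potential (P i) k - potential (P i) 0) \<longlongrightarrow> potential P0 k - potential P0 0) L"
    by (simp only: eq P)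
  from tendsto_add[OF this tendsto_const[of "potential P0 0"]] show ?thesis
    by (simp add: algebra_simps)
qed

context
  fixes \<mu> \<nu> :: "'i \<Rightarrow> real measure" and \<mu>0 \<nu>0 :: "real measure" and L :: "'i filter"
  assumes D: "\<And>i. (\<mu> i, \<nu> i) \<in> curtain_domain" and D0: "(\<mu>0, \<nu>0) \<in> curtain_domain"
    and weak_\<mu>: "\<And>f. continuous_on UNIV f \<Longrightarrow> bounded (range f) \<Longrightarrow>
        ((\<lambda>i. \<integral>x. f x \<partial>\<mu> i) \<longlongrightarrow> (\<integral>x. f x \<partial>\<mu>0 :: real)) L"
    and weak_\<nu>: "\<And>f. continuous_on UNIV f \<Longrightarrow> bounded (range f) \<Longrightarrow>
        ((\<lambda>i. \<integral>x. f x \<partial>\<nu> i) \<longlongrightarrow> (\<integral>x. f x \<partial>\<nu>0 :: real)) L"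
begin

private lemma domain:
  "\<mu> i \<in> prob_measures" "\<nu> i \<in> prob_measures" "\<mu> i \<preceq>\<^sub>C \<nu> i" "\<mu>0 \<in> prob_measures" "\<nu>0 \<in> prob_measures" "\<mu>0 \<preceq>\<^sub>C \<nu>0"
  using D[of i] D0 by (auto simp: curtain_domain_def)

private lemmas fm = prob_measures_realD(1)[OF domain(1)] prob_measures_realD(1)[OF domain(2)]
  prob_measures_realD(1)[OF domain(4)] prob_measures_realD(1)[OF domain(5)]

private lemmas potential_\<mu> = potential_tendsto[OF fm(1,3) weak_\<mu>]
private lemmas potential_\<nu> = potential_tendsto[OF fm(2,4) weak_\<nu>]

text \<open>Every potential converges after its own correction: \<open>c\<nu>\<close> for \<nu>,
  \<open>c\<mu>\<close> for \<mu> and its restriction, so \<open>c\<nu> - c\<mu>\<close> for the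
  difference and its hull, and \<open>c\<mu>\<close> for the shadow. The cdfs follow at continuity
  points.\<close>

lemma cdf_shadow_tendsto:
  assumes x: "isCont (cdf \<mu>0) x" and y: "isCont (cdf \<nu>0) y"
  shows "((\<lambda>i. cdf (shadow (\<nu> i) (restr (\<mu> i) {..x})) y) \<longlongrightarrow> cdf (shadow \<nu>0 (restr \<mu>0 {..x})) y) L"
proof -
  interpret \<mu>i: real_distribution "\<mu> i" for i by (rule prob_measures_realD[OF domain(1)])
  interpret \<nu>i: real_distribution "\<nu> i" for i by (rule prob_measures_realD[OF domain(2)])
  interpret \<mu>0: real_distribution \<mu>0 by (rule prob_measures_realD[OF domain(4)])
  interpret \<nu>0: real_distribution \<nu>0 by (rule prob_measures_realD[OF domain(5)])
  note sub_\<nu> = potential_subgradient[OF fm(2)] potential_subgradient[OF fm(4)]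
  have cdf_\<mu>: "((\<lambda>i. cdf (\<mu> i) x) \<longlongrightarrow> cdf \<mu>0 x) L"
    by (rule subgradient_tendsto_isCont[OF potential_subgradient[OF fm(1)] potential_subgradient[OF fm(3)] potential_\<mu> x])
  have cdf_\<nu>: "((\<lambda>i. cdf (\<nu> i) y) \<longlongrightarrow> cdf \<nu>0 y) L"
    by (rule subgradient_tendsto_isCont[OF sub_\<nu> potential_\<nu> y])
  show ?thesis
  proof (cases "cdf \<mu>0 x = 1")
    \<comment> \<open>No slope lies strictly between \<open>0\<close> and
      \<open>1 - cdf \<mu>0 x\<close> here. Instead, the shadow leaves out a mass
      \<open>1 - cdf (\<mu> i) x\<close> of \<open>\<nu> i\<close>, which tends to
      \<open>0\<close>.\<close>
    case True
    have "cdf (shadow \<nu>0 (restr \<mu>0 {..x})) y = cdf \<nu>0 y"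
      using cdf_shadow_bounds[OF domain(4-6), where x = x and y = y] True by simp
    moreover have "((\<lambda>i. cdf (shadow (\<nu> i) (restr (\<mu> i) {..x})) y) \<longlongrightarrow> cdf \<nu>0 y) L"
    proof (rule tendsto_sandwich[OF _ _ _ cdf_\<nu>])
      have "((\<lambda>i. cdf (\<nu> i) y - (1 - cdf (\<mu> i) x)) \<longlongrightarrow> cdf \<nu>0 y - (1 - cdf \<mu>0 x)) L"
        by (intro tendsto_intros cdf_\<mu> cdf_\<nu>)
      then show "((\<lambda>i. cdf (\<nu> i) y - (1 - cdf (\<mu> i) x)) \<longlongrightarrow> cdf \<nu>0 y) L" using True by simp
    qed (use cdf_shadow_bounds[OF domain(1-3)] in auto)
    ultimately show ?thesis by simp
  next
    case False
    define S where "S = 1 - cdf \<mu>0 x"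
    have S: "S > 0" using False \<mu>0.cdf_bounded_prob[of x] by (simp add: S_def)
    define r where "r = (\<lambda>\<mu>. restr \<mu> {..x})"
    define G where "G = (\<lambda>i k. potential (\<nu> i) k - potential (r (\<mu> i)) k)"
    define H where "H = (\<lambda>k. potential \<nu>0 k - potential (r \<mu>0) k)"
    define c\<mu> where "c\<mu> = (\<lambda>i. potential (\<mu> i) 0 - potential \<mu>0 0)"
    define c\<nu> where "c\<nu> = (\<lambda>i. potential (\<nu> i) 0 - potential \<nu>0 0)"
    have r_fm: "r (\<mu> i) \<in> finite_measures" "r \<mu>0 \<in> finite_measures" for i
      unfolding r_def by (intro restr_finite_measures fm; simp)+
    have r_sub: "subdominated (r (\<mu> i)) (\<nu> i)" "subdominated (r \<mu>0) \<nu>0" for i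
      unfolding r_def by (rule subdominated_restr[OF domain(1-3)] subdominated_restr[OF domain(4-6)])+
    have r_mass: "measure (r (\<mu> i)) UNIV = cdf (\<mu> i) x" "measure (r \<mu>0) UNIV = cdf \<mu>0 x" for i
      unfolding r_def by (intro measure_restr_UNIV fm)+
    have \<nu>_mass: "measure (\<nu> i) UNIV = 1" "measure \<nu>0 UNIV = 1" for i
      using \<nu>i.prob_space \<nu>0.prob_space by auto
    have lip: "\<bar>(potential \<nu>' a - potential \<mu>' a) - (potential \<nu>' b - potential \<mu>' b)\<bar> \<le> 2 * \<bar>a - b\<bar>"
      if "\<nu>' \<in> finite_measures" "\<mu>' \<in> finite_measures" "measure \<nu>' UNIV = 1" "measure \<mu>' UNIV \<le> 1" for \<nu>' \<mu>' a b
    proof -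
      have "measure \<mu>' UNIV * \<bar>a - b\<bar> \<le> 1 * \<bar>a - b\<bar>" using that by (intro mult_right_mono) auto
      then have m: "\<bar>potential \<mu>' a - potential \<mu>' b\<bar> \<le> \<bar>a - b\<bar>"
        using potential_lipschitz[OF that(2), of a b] by simp
      have n: "\<bar>potential \<nu>' a - potential \<nu>' b\<bar> \<le> \<bar>a - b\<bar>"
        using potential_lipschitz[OF that(1), of a b] that(3) by simp
      have "(potential \<nu>' a - potential \<mu>' a) - (potential \<nu>' b - potential \<mu>' b)
          = (potential \<nu>' a - potential \<nu>' b) - (potential \<mu>' a - potential \<mu>' b)" by simp
      then show ?thesis
        using order_trans[OF abs_triangle_ineq4 add_mono[OF n m]] by (simp only: mult_2)
    qed
    have "((\<lambda>i. convex_hull_fun (G i) k - (c\<nu> i - c\<mu> i)) \<longlongrightarrow> convex_hull_fun H k) L" for k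
    proof (rule convex_hull_fun_tendsto)
      show "\<bar>G i a - G i b\<bar> \<le> 2 * \<bar>a - b\<bar>" for i a b
        unfolding G_def by (intro lip fm r_fm \<nu>_mass) (simp add: r_mass \<mu>i.cdf_bounded_prob)
      show "\<bar>H a - H b\<bar> \<le> 2 * \<bar>a - b\<bar>" for a b
        unfolding H_def by (intro lip fm r_fm \<nu>_mass) (simp add: r_mass \<mu>0.cdf_bounded_prob)
      show "((\<lambda>i. G i k - (c\<nu> i - c\<mu> i)) \<longlongrightarrow> H k) L" for k
      proof -
        \<comment> \<open>In \<open>potential_restr\<close> only the summand
          \<open>potential \<mu> (min k x)\<close> needs a correction, since
          \<open>cdf (\<mu> i) x\<close> converges; so the restriction shares the constant
          \<open>c\<mu>\<close>.\<close>
        have "((\<lambda>i. (potential (\<nu> i) k - c\<nu> i) - ((potential (\<mu> i) (min k x) - c\<mu> i) + cdf (\<mu> i) x * max 0 (k - x)))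
          \<longlongrightarrow> potential \<nu>0 k - (potential \<mu>0 (min k x) + cdf \<mu>0 x * max 0 (k - x))) L"
          unfolding c\<mu>_def c\<nu>_def by (intro tendsto_intros potential_\<mu> potential_\<nu> cdf_\<mu>)
        then show ?thesis
          by (simp add: G_def H_def r_def potential_restr fm algebra_simps)
      qed
      show "0 \<le> G i k" for i k using r_sub(1) by (simp add: G_def subdominated_def)
      show "S > 0" by (rule S)
      show "max 0 (S * k - ((\<integral>x. x \<partial>\<nu>0) - (\<integral>x. x \<partial>r \<mu>0))) \<le> H k" for k
        using r_sub(2) by (simp add: H_def S_def r_mass \<nu>_mass subdominated_def)
      show "H k \<le> (potential \<nu>0 0 + \<bar>\<integral>x. x \<partial>r \<mu>0\<bar>) + max 0 (S * k)" for k
      proof (cases "k \<le> 0")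
        case True
        then show ?thesis
          using potential_mono[OF fm(4) True] potential_nonneg[of "r \<mu>0" k] by (simp add: H_def)
      next
        case False
        then have "potential \<nu>0 k \<le> potential \<nu>0 0 + k"
          using potential_diff_le[OF fm(4), of 0 k] by (simp add: \<nu>_mass)
        moreover have "cdf \<mu>0 x * k - (\<integral>x. x \<partial>r \<mu>0) \<le> potential (r \<mu>0) k"
          using potential_ge[OF r_fm(2), of k] by (simp add: r_mass)
        ultimately have "H k \<le> potential \<nu>0 0 + (\<integral>x. x \<partial>r \<mu>0) + S * k" by (simp add: H_def S_def algebra_simps)
        then show ?thesis using abs_ge_self[of "\<integral>x. x \<partial>r \<mu>0"] max.cobounded2[of "S * k" 0] by linarith
      qed
      fix s assume s: "0 < s" "s < S"
      \<comment> \<open>The slack \<open>S - s\<close> is spent in three equal parts: on the mass of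
        \<open>\<nu>0\<close> beyond \<open>t2\<close>, on replacing \<open>\<nu>0\<close> by
        \<open>\<nu> i\<close>, and on replacing \<open>cdf \<mu>0 x\<close> by
        \<open>cdf (\<mu> i) x\<close>.\<close>
      define d where "d = (S - s) / 3"
      have d: "d > 0" and d3: "3 * d = S - s" using s by (auto simp: d_def)
      have "\<forall>\<^sub>F t in at_bot. cdf \<nu>0 t < s / 2" using s by (intro order_tendstoD(2)[OF \<nu>0.cdf_lim_at_bot]) auto
      then obtain t1 where t1: "cdf \<nu>0 t1 < s / 2" by (auto simp: eventually_at_bot_linorder)
      have "\<forall>\<^sub>F t in at_top. 1 - d < cdf \<nu>0 t" using d by (intro order_tendstoD(1)[OF \<nu>0.cdf_lim_at_top_prob]) auto
      then obtain t2 where t2: "1 - d < cdf \<nu>0 t2" by (auto simp: eventually_at_top_linorder)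
      \<comment> \<open>\<open>- K\<close> and \<open>K\<close> lie at least one unit outside
        \<open>t1\<close> and \<open>t2\<close>, because cdfs along the filter are compared with the
        limit only at strictly ordered points.\<close>
      define K where "K = max (1 - t1) (t2 + 1)"
      have "\<forall>\<^sub>F i in L. cdf (\<nu> i) (- K) < cdf \<nu>0 t1 + s / 2"
        using s by (intro subgradient_eventually_less[OF sub_\<nu> potential_\<nu>]) (auto simp: K_def)
      moreover have "\<forall>\<^sub>F i in L. cdf \<nu>0 t2 - d < cdf (\<nu> i) K"
        using d by (intro subgradient_eventually_greater[OF sub_\<nu> potential_\<nu>]) (auto simp: K_def)
      moreover have "\<forall>\<^sub>F i in L. cdf (\<mu> i) x < cdf \<mu>0 x + d"
        using d by (intro order_tendstoD(2)[OF cdf_\<mu>]) auto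
      ultimately have "\<forall>\<^sub>F i in L. (\<forall>k\<ge>K. s * (k - K) \<le> G i k - G i K) \<and> (\<forall>k\<le>-K. s * (k + K) \<le> G i k - G i (-K))"
      proof eventually_elim
        case (elim i)
        have less: "s < cdf (\<nu> i) K - cdf (\<mu> i) x" using elim(2,3) t2 d3 S_def by linarith
        have "s * (k - K) \<le> G i k - G i K" if "k \<ge> K" for k
        proof -
          have "s * (k - K) \<le> (cdf (\<nu> i) K - cdf (\<mu> i) x) * (k - K)"
            using less that by (intro mult_right_mono) auto
          moreover have "cdf (\<nu> i) K * (k - K) \<le> potential (\<nu> i) k - potential (\<nu> i) K"
            using subgradientD[OF sub_\<nu>(1), of i K k] by simp
          moreover have "potential (r (\<mu> i)) k - potential (r (\<mu> i)) K \<le> cdf (\<mu> i) x * (k - K)"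
            using potential_diff_le[OF r_fm(1) that] by (simp add: r_mass)
          ultimately show ?thesis by (simp add: G_def left_diff_distrib)
        qed
        moreover have "s * (k + K) \<le> G i k - G i (- K)" if "k \<le> - K" for k
        proof -
          have "s * (k + K) \<le> cdf (\<nu> i) (- K) * (k + K)"
            using elim(1) t1 that by (intro mult_right_mono_neg) auto
          moreover have "cdf (\<nu> i) (- K) * (k + K) \<le> potential (\<nu> i) k - potential (\<nu> i) (- K)"
            using subgradientD[OF sub_\<nu>(1), of i "- K" k] by simp
          moreover have "potential (r (\<mu> i)) k \<le> potential (r (\<mu> i)) (- K)"
            by (rule potential_mono[OF r_fm(1) that])
          ultimately show ?thesis by (simp add: G_def)
        qed
        ultimately show ?case by blast
      qed
      then show "\<exists>K. \<forall>\<^sub>F i in L. (\<forall>k\<ge>K. s * (k - K) \<le> G i k - G i K) \<and> (\<forall>k\<le>-K. s * (k + K) \<le> G i k - G i (-K))"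
        by blast
    qed
    then have hull: "((\<lambda>i. shadow_hull (\<nu> i) (r (\<mu> i)) k - (c\<nu> i - c\<mu> i)) \<longlongrightarrow> shadow_hull \<nu>0 (r \<mu>0) k) L" for k
      by (simp add: shadow_hull_def G_def H_def)
    have pot: "((\<lambda>i. potential (shadow (\<nu> i) (r (\<mu> i))) k - c\<mu> i) \<longlongrightarrow> potential (shadow \<nu>0 (r \<mu>0)) k) L" for k
    proof -
      have "((\<lambda>i. (potential (\<nu> i) k - c\<nu> i) - (shadow_hull (\<nu> i) (r (\<mu> i)) k - (c\<nu> i - c\<mu> i)))
        \<longlongrightarrow> potential \<nu>0 k - shadow_hull \<nu>0 (r \<mu>0) k) L"
        using hull[of k] potential_\<nu>[of k] by (intro tendsto_diff) (simp_all add: c\<nu>_def)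
      moreover have "(potential (\<nu> i) k - c\<nu> i) - (shadow_hull (\<nu> i) (r (\<mu> i)) k - (c\<nu> i - c\<mu> i))
          = potential (shadow (\<nu> i) (r (\<mu> i))) k - c\<mu> i" for i
        unfolding r_def shadow_restr(5)[OF domain(1-3)] by simp
      moreover have "potential \<nu>0 k - shadow_hull \<nu>0 (r \<mu>0) k = potential (shadow \<nu>0 (r \<mu>0)) k"
        unfolding r_def shadow_restr(5)[OF domain(4-6)] by simp
      ultimately show ?thesis by simp
    qed
    have S_fm: "shadow (\<nu> i) (r (\<mu> i)) \<in> finite_measures" "shadow \<nu>0 (r \<mu>0) \<in> finite_measures" for i
      unfolding r_def by (rule shadow_restr(1)[OF domain(1-3)] shadow_restr(1)[OF domain(4-6)])+
    have S_le: "shadow \<nu>0 (r \<mu>0) \<le> \<nu>0"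
      unfolding r_def by (rule shadow_restr(2)[OF domain(4-6)])
    interpret S0: finite_borel_measure "shadow \<nu>0 (r \<mu>0)" by (rule finite_measuresD(5)[OF S_fm(2)])
    \<comment> \<open>Atoms of the shadow are atoms of \<open>\<nu>0\<close>, so continuity of
      \<open>cdf \<nu>0\<close> at \<open>y\<close> passes to the shadow.\<close>
    have "measure (shadow \<nu>0 (r \<mu>0)) {y} \<le> measure \<nu>0 {y}"
      using le_measureD3[OF S_le, of "{y}"] S0.M_is_borel
      by (simp add: S0.emeasure_eq_measure \<nu>0.emeasure_eq_measure)
    then have "isCont (cdf (shadow \<nu>0 (r \<mu>0))) y"
      using y by (simp add: S0.isCont_cdf \<nu>0.isCont_cdf measure_le_0_iff)
    then show ?thesis
      using subgradient_tendsto_isCont[OF potential_subgradient[OF S_fm(1)] potential_subgradient[OF S_fm(2)] pot]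
      by (simp add: r_def)
  qed
qed

lemma integral_Curt_tendsto:
  fixes f :: "real \<times> real \<Rightarrow> real"
  assumes f: "continuous_on UNIV f" "bounded (range f)"
  shows "((\<lambda>i. \<integral>z. f z \<partial>Curt (\<mu> i, \<nu> i)) \<longlongrightarrow> (\<integral>z. f z \<partial>Curt (\<mu>0, \<nu>0))) L"
proof -
  interpret \<mu>0: real_distribution \<mu>0 by (rule prob_measures_realD[OF domain(4)])
  interpret \<nu>0: real_distribution \<nu>0 by (rule prob_measures_realD[OF domain(5)])
  obtain M where M: "\<And>z. \<bar>f z\<bar> \<le> M" using f(2) by (auto simp: bounded_iff)
  have Curt: "prob_space (Curt d)" "sets (Curt d) = sets borel" if "d \<in> curtain_domain" for d
    using that is_left_curtain_Curt[of "fst d" "snd d"]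
    by (auto simp: curtain_domain_def is_left_curtain_def martingale_couplings_def prob_measures_def)
  show ?thesis
  proof (rule weak_convergence_of_quadrants[OF Curt[OF D] Curt[OF D0] _ _ f(1) M])
    show "countable ({x. 0 < measure \<mu>0 {x}} \<union> {x. 0 < measure \<nu>0 {x}})"
      by (intro countable_Un \<mu>0.countable_atoms \<nu>0.countable_atoms)
    fix x y
    assume "x \<notin> {x. 0 < measure \<mu>0 {x}} \<union> {x. 0 < measure \<nu>0 {x}}"
      and "y \<notin> {x. 0 < measure \<mu>0 {x}} \<union> {x. 0 < measure \<nu>0 {x}}"
    then have "isCont (cdf \<mu>0) x" "isCont (cdf \<nu>0) y"
      by (auto simp: \<mu>0.isCont_cdf \<nu>0.isCont_cdf zero_less_measure_iff)
    then show "((\<lambda>i. measure (Curt (\<mu> i, \<nu> i)) ({..x} \<times> {..y})) \<longlongrightarrow> measure (Curt (\<mu>0, \<nu>0)) ({..x} \<times> {..y})) L"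
      unfolding measure_left_curtain_quadrant[OF D] measure_left_curtain_quadrant[OF D0]
      by (rule cdf_shadow_tendsto)
  qed
qed

end

text \<open>Continuity into a product topology is continuity of each coordinate, here of each
  integral; \<open>Bcontfun\<close> mediates between the type of bounded continuous functions and
  the two predicates.\<close>

lemma continuous_map_weak_topology_iff:
  "continuous_map X (weak_topology P) g \<longleftrightarrow> g \<in> topspace X \<rightarrow> P \<and>
     (\<forall>f. continuous_on UNIV f \<longrightarrow> bounded (range f) \<longrightarrow>
        continuous_map X euclideanreal (\<lambda>d. \<integral>x. f x \<partial>g d))" (is "_ \<longleftrightarrow> ?R")
proof
  let ?I = "\<lambda>\<mu> (f :: 'b \<Rightarrow>\<^sub>C real). \<integral>x. apply_bcontfun f x \<partial>\<mu>"
  show ?R if g: "continuous_map X (weak_topology P) g"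
  proof (intro conjI allI impI)
    show "g \<in> topspace X \<rightarrow> P" using continuous_map_funspace[OF g] by simp
    fix f :: "'b \<Rightarrow> real" assume f: "continuous_on UNIV f" "bounded (range f)"
    have "continuous_map euclidean euclidean (\<lambda>u :: ('b \<Rightarrow>\<^sub>C real) \<Rightarrow> real. u (Bcontfun f))"
      by (auto intro: continuous_on_product_coordinates)
    from continuous_map_compose[OF g[unfolded weak_topology_def] continuous_map_pullback[OF this]]
    show "continuous_map X euclideanreal (\<lambda>d. \<integral>x. f x \<partial>g d)"
      using f by (simp add: comp_def Bcontfun_inverse bcontfun_def)
  qed
  show "continuous_map X (weak_topology P) g" if R: ?R
    unfolding weak_topology_def
  proof (rule continuous_map_pullback')
    show "topspace X \<subseteq> g -` P" using R by auto
    have "continuous_map X euclideanreal (\<lambda>d. ?I (g d) f)" for f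
      using R apply_bcontfun[of f] by (auto simp: bcontfun_def)
    then show "continuous_map X euclidean (?I \<circ> g)"
      unfolding euclidean_product_topology[symmetric] continuous_map_componentwise_UNIV by simp
  qed
qed

theorem theorem2p16:
  shows "continuous_map
           (subtopology
             (prod_topology (weak_topology prob_measures) (weak_topology prob_measures))
             curtain_domain)
           (weak_topology prob_measures)
           Curt"
proof -
  define X where "X = subtopology (prod_topology (weak_topology prob_measures) (weak_topology prob_measures)) curtain_domain"
  have topX: "topspace X = curtain_domain" by (auto simp: X_def curtain_domain_def)
  have "continuous_map X (weak_topology prob_measures) fst" "continuous_map X (weak_topology prob_measures) snd"
    unfolding X_def by (intro continuous_map_from_subtopology continuous_map_fst continuous_map_snd)+
  then have proj: "continuous_map X euclideanreal (\<lambda>d. \<integral>x. f x \<partial>fst d)"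
      "continuous_map X euclideanreal (\<lambda>d. \<integral>x. f x \<partial>snd d)"
    if "continuous_on UNIV f" "bounded (range f)" for f :: "real \<Rightarrow> real"
    using that unfolding continuous_map_weak_topology_iff by blast+
  have "continuous_map X (weak_topology prob_measures) Curt"
    unfolding continuous_map_weak_topology_iff
  proof (intro conjI allI impI)
    show "Curt \<in> topspace X \<rightarrow> prob_measures"
      using is_left_curtain_Curt
      by (auto simp: topX curtain_domain_def is_left_curtain_def martingale_couplings_def)
    fix f :: "real \<times> real \<Rightarrow> real" assume f: "continuous_on UNIV f" "bounded (range f)"
    show "continuous_map X euclideanreal (\<lambda>d. \<integral>z. f z \<partial>Curt d)"
      unfolding continuous_map_atin limitin_canonical_iff
    proof
      fix d0 assume d0: "d0 \<in> topspace X"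
      \<comment> \<open>\<open>integral_Curt_tendsto\<close> asks for every index to lie in the
        domain, while \<open>atin X d0\<close> does so only eventually; pairs outside are redirected
        to \<open>d0\<close>.\<close>
      define p where "p = (\<lambda>d. if d \<in> curtain_domain then d else d0)"
      have ev: "\<forall>\<^sub>F d in atin X d0. p d = d"
        unfolding eventually_atin using d0 openin_topspace[of X] by (auto simp: p_def topX)
      have lim: "((\<lambda>d. \<integral>x. g x \<partial>q (p d)) \<longlongrightarrow> (\<integral>x. g x \<partial>q d0)) (atin X d0)"
        if "continuous_map X euclideanreal (\<lambda>d. \<integral>x. g x \<partial>q d)" for g :: "real \<Rightarrow> real" and q
      proof (rule Lim_transform_eventually)
        show "((\<lambda>d. \<integral>x. g x \<partial>q d) \<longlongrightarrow> (\<integral>x. g x \<partial>q d0)) (atin X d0)"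
          using that d0 by (simp add: continuous_map_atin)
        show "\<forall>\<^sub>F d in atin X d0. (\<integral>x. g x \<partial>q d) = (\<integral>x. g x \<partial>q (p d))"
          using ev by eventually_elim simp
      qed
      have "((\<lambda>d. \<integral>z. f z \<partial>Curt (fst (p d), snd (p d))) \<longlongrightarrow> (\<integral>z. f z \<partial>Curt (fst d0, snd d0))) (atin X d0)"
        using d0 by (intro integral_Curt_tendsto f lim proj) (auto simp: p_def topX)
      moreover have "\<forall>\<^sub>F d in atin X d0. (\<integral>z. f z \<partial>Curt (fst (p d), snd (p d))) = (\<integral>z. f z \<partial>Curt d)"
        using ev by eventually_elim simp
      ultimately have "((\<lambda>d. \<integral>z. f z \<partial>Curt d) \<longlongrightarrow> (\<integral>z. f z \<partial>Curt (fst d0, snd d0))) (atin X d0)"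
        by (rule Lim_transform_eventually)
      then show "((\<lambda>d. \<integral>z. f z \<partial>Curt d) \<longlongrightarrow> (\<integral>z. f z \<partial>Curt d0)) (atin X d0)" by simp
    qed
  qed
  then show ?thesis by (simp add: X_def)
qed

end
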